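(* Let $m,d$ be positive integers such that $d\geq m>1$. Let $\delta:=\left(\lfloor \frac{m}{3}\rfloor+1\right)^{3}$ if $3\nmid m$ and $\delta:=\frac{m}{3}\left( \frac{m}{3}+1\right)^2$ if $3\mid m$. Then $\mathcal{T}^3_{d,m}$ is contained in the closure of $V^3_{d,\delta}$. In other words, if $X\subset\mathbf{P}^3$ is a surface of degree $d$ with an ordinary $m$-fold point and no further singularities, then there exists a family of degree $d$ surfaces such that the general fiber is a surface of degree $d$ with $\delta$ nodes and the special fiber is $X$.
   Context: We work over $\mathbf{C}$. $V^n_{d,\delta}\subset \mathbf{P}(\mathbf{C}[x_0,\dots,x_n]_d)$ denotes the Severi variety of degree $d$ hypersurfaces in $\mathbf{P}^n$ with $\delta$ nodes (precisely $\delta$ nodes and no other singularities); a node is an ordinary double point. The closure is taken in $\mathbf{P}(\mathbf{C}[x_0,\dots,x_n]_d)$. An ordinary $m$-fold point of a hypersurface in $\mathbf{P}^n$ is an isolated singularity of multiplicity $m$ whose tangent cone is a cone over a smooth hypersurface of degree $m$ in $\mathbf{P}^{n-1}$. $\mathcal{T}^n_{d,m}\subset \mathbf{P}(\mathbf{C}[x_0,\dots,x_n]_d)$ denotes the locus of hypersurfaces in $\mathbf{P}^n$ of degree $d$ with an ordinary $m$-fold point as singularity and no further singularities. *)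

theory Defs
  imports Complex_Main "HOL-Library.Poly_Mapping"
begin

text \<open>
  Polynomials over the complex numbers in variables indexed by \<open>'v\<close>: an exponent is a finitely
  supported function \<open>'v \<Rightarrow>\<^sub>0 nat\<close>. Index sets \<open>I\<close> select the variables in use, so that the same
  definitions serve P^n (\<open>I = {0..n}\<close>), its affine charts and tangent directions (\<open>I = {0..n} - {i}\<close>),
  and the parameter space of hypersurfaces, whose coordinates are indexed by the monomials.
\<close>

type_synonym 'v cpoly = "('v \<Rightarrow>\<^sub>0 nat) \<Rightarrow>\<^sub>0 complex"

definition total_degree :: "('v \<Rightarrow>\<^sub>0 nat) \<Rightarrow> nat" where
  "total_degree e = (\<Sum>i\<in>Poly_Mapping.keys e. Poly_Mapping.lookup e i)"

definition monomials :: "'v set \<Rightarrow> nat \<Rightarrow> ('v \<Rightarrow>\<^sub>0 nat) set" where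
  "monomials I d = {e. Poly_Mapping.keys e \<subseteq> I \<and> total_degree e = d}"

text \<open>The vector space of forms of degree \<open>d\<close>, including \<open>0\<close>.\<close>

definition forms :: "'v set \<Rightarrow> nat \<Rightarrow> 'v cpoly set" where
  "forms I d = {F. Poly_Mapping.keys F \<subseteq> monomials I d}"

definition substitute :: "(complex \<Rightarrow> 'a::comm_ring_1) \<Rightarrow> ('v \<Rightarrow> 'a) \<Rightarrow> 'v cpoly \<Rightarrow> 'a" where
  "substitute h a F = (\<Sum>e\<in>Poly_Mapping.keys F.
     h (Poly_Mapping.lookup F e) * (\<Prod>i\<in>Poly_Mapping.keys e. a i ^ Poly_Mapping.lookup e i))"

definition eval_at :: "('v \<Rightarrow> complex) \<Rightarrow> 'v cpoly \<Rightarrow> complex" where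
  "eval_at a F = substitute (\<lambda>c. c) a F"

definition const_poly :: "complex \<Rightarrow> 'v cpoly" where
  "const_poly c = Poly_Mapping.single 0 c"

definition var_poly :: "'v \<Rightarrow> 'v cpoly" where
  "var_poly i = Poly_Mapping.single (Poly_Mapping.single i 1) 1"

text \<open>Where \<open>e\<close> does not involve \<open>i\<close>, the truncated exponent is harmless: its coefficient is \<open>0\<close>.\<close>

definition partial_deriv :: "'v \<Rightarrow> 'v cpoly \<Rightarrow> 'v cpoly" where
  "partial_deriv i F = (\<Sum>e\<in>Poly_Mapping.keys F.
     Poly_Mapping.single (e - Poly_Mapping.single i 1)
       (of_nat (Poly_Mapping.lookup e i) * Poly_Mapping.lookup F e))"

definition hom_part :: "nat \<Rightarrow> 'v cpoly \<Rightarrow> 'v cpoly" where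
  "hom_part k f = (\<Sum>e | e \<in> Poly_Mapping.keys f \<and> total_degree e = k.
     Poly_Mapping.single e (Poly_Mapping.lookup f e))"

text \<open>
  A point of projective space is the set of its homogeneous coordinate vectors; coordinates outside
  the index set are \<open>0\<close>.
\<close>

definition proj_point :: "('v \<Rightarrow> complex) \<Rightarrow> ('v \<Rightarrow> complex) set" where
  "proj_point a = {(\<lambda>i. c * a i) |c. c \<noteq> 0}"

definition proj_space :: "'v set \<Rightarrow> ('v \<Rightarrow> complex) set set" where
  "proj_space I = {proj_point a |a. (\<forall>i. i \<notin> I \<longrightarrow> a i = 0) \<and> (\<exists>i\<in>I. a i \<noteq> 0)}"

text \<open>Zariski closure in \<open>proj_space I\<close>.\<close>

definition proj_closure :: "'v set \<Rightarrow> ('v \<Rightarrow> complex) set set \<Rightarrow> ('v \<Rightarrow> complex) set set" where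
  "proj_closure I S = {x \<in> proj_space I. \<forall>k. \<forall>P\<in>forms I k.
     (\<forall>y\<in>S. \<forall>a\<in>y. eval_at a P = 0) \<longrightarrow> (\<forall>a\<in>x. eval_at a P = 0)}"

text \<open>
  Singular points of the hypersurface \<open>F = 0\<close>, taken as a scheme (points on multiple components are
  singular), by the Jacobian criterion.
\<close>

definition singular_points :: "'v set \<Rightarrow> 'v cpoly \<Rightarrow> ('v \<Rightarrow> complex) set set" where
  "singular_points I F = {x \<in> proj_space I.
     \<forall>a\<in>x. eval_at a F = 0 \<and> (\<forall>i\<in>I. eval_at a (partial_deriv i F) = 0)}"

text \<open>
  For \<open>a i = 1\<close>: the equation of \<open>F = 0\<close> in the affine chart \<open>x_i = 1\<close>, translated so that the point
  with coordinates \<open>a\<close> becomes the origin.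
\<close>

definition local_equation :: "'v \<Rightarrow> ('v \<Rightarrow> complex) \<Rightarrow> 'v cpoly \<Rightarrow> 'v cpoly" where
  "local_equation i a F =
     substitute const_poly (\<lambda>j. if j = i then 1 else const_poly (a j) + var_poly j) F"

text \<open>
  An isolated singularity where the local equation has lowest-order part of degree \<open>m\<close>, this part
  defining a smooth hypersurface of degree \<open>m\<close> in the projectivised tangent space. The condition
  does not depend on the chart.
\<close>

definition ordinary_point :: "'v set \<Rightarrow> 'v cpoly \<Rightarrow> nat \<Rightarrow> ('v \<Rightarrow> complex) set \<Rightarrow> bool" where
  "ordinary_point I F m x \<longleftrightarrow>
     x \<in> singular_points I F \<and>
     x \<notin> proj_closure I (singular_points I F - {x}) \<and>
     (\<exists>i\<in>I. \<exists>a\<in>x. a i = 1 \<and>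
        (\<forall>k<m. hom_part k (local_equation i a F) = 0) \<and>
        hom_part m (local_equation i a F) \<noteq> 0 \<and>
        singular_points (I - {i}) (hom_part m (local_equation i a F)) = {})"

abbreviation node :: "'v set \<Rightarrow> 'v cpoly \<Rightarrow> ('v \<Rightarrow> complex) set \<Rightarrow> bool" where
  "node I F x \<equiv> ordinary_point I F 2 x"

text \<open>
  The projective space of forms of degree \<open>d\<close> in \<open>x_0, ..., x_n\<close> is
  \<open>proj_space (monomials {0..n} d)\<close>: its homogeneous coordinates are the coefficients, and the point
  given by a form \<open>F \<noteq> 0\<close> is \<open>hypersurface F\<close>.
\<close>

definition hypersurface :: "nat cpoly \<Rightarrow> ((nat \<Rightarrow>\<^sub>0 nat) \<Rightarrow> complex) set" where
  "hypersurface F = proj_point (Poly_Mapping.lookup F)"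

definition hypersurface_closure ::
  "nat \<Rightarrow> nat \<Rightarrow> ((nat \<Rightarrow>\<^sub>0 nat) \<Rightarrow> complex) set set \<Rightarrow> ((nat \<Rightarrow>\<^sub>0 nat) \<Rightarrow> complex) set set" where
  "hypersurface_closure n d S = proj_closure (monomials {0..n} d) S"

definition severi_variety :: "nat \<Rightarrow> nat \<Rightarrow> nat \<Rightarrow> ((nat \<Rightarrow>\<^sub>0 nat) \<Rightarrow> complex) set set" where
  "severi_variety n d \<delta> = {hypersurface F |F. F \<in> forms {0..n} d \<and> F \<noteq> 0 \<and>
     finite (singular_points {0..n} F) \<and> card (singular_points {0..n} F) = \<delta> \<and>
     (\<forall>x\<in>singular_points {0..n} F. node {0..n} F x)}"

definition ordinary_locus :: "nat \<Rightarrow> nat \<Rightarrow> nat \<Rightarrow> ((nat \<Rightarrow>\<^sub>0 nat) \<Rightarrow> complex) set set" where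
  "ordinary_locus n d m = {hypersurface F |F. F \<in> forms {0..n} d \<and> F \<noteq> 0 \<and>
     (\<exists>x. singular_points {0..n} F = {x} \<and> ordinary_point {0..n} F m x)}"

end

theory Submission
  imports Defs "HOL-Analysis.Analysis" "HOL-Computational_Algebra.Polynomial"
begin

text \<open>
  Let \<open>F\<close> have an ordinary \<open>m\<close>-fold point \<open>p\<close>, and let \<open>g\<close> be a polynomial of degree \<open>m\<close> in three
  affine variables whose surface has \<open>\<delta>\<close> nodes and no other singularities. If the tangent cone of \<open>F\<close>
  at \<open>p\<close> were the leading form of \<open>g\<close>, one could add to the local equation of \<open>F\<close> the terms
  \<open>t^(m-k) g_k\<close> with \<open>k < m\<close>. At scale \<open>t\<close> around \<open>p\<close> the new surface is then a small perturbation of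
  \<open>g = 0\<close>. The perturbation alone would destroy the nodes, but if they impose independent conditions
  on polynomials of degree less than \<open>m\<close>, then a small correction of the coefficients of degree less
  than \<open>m\<close> restores all of them (\<open>nodes_persist\<close>). As these coefficients are multiplied by positive
  powers of \<open>t\<close>, the surface still tends to \<open>F\<close> for \<open>t \<rightarrow> 0\<close>.

  The tangent cone of \<open>F\<close> is arbitrary, whereas \<open>g\<close> is explicit. So \<open>F\<close> is joined by a line to one
  surface \<open>G\<close> whose local equation begins with the leading form of \<open>g\<close>. For small \<open>s\<close> the tangent
  cone of \<open>G + s (F - G)\<close> differs little from that of \<open>G\<close>, and the difference is one more small
  perturbation, which the same correction absorbs. Hence every polynomial that vanishes on the Severi
  variety vanishes at \<open>G + s (F - G)\<close> for all small \<open>s\<close>; being a polynomial in \<open>s\<close>, it vanishes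
  also at \<open>s = 1\<close>, which is \<open>F\<close> (\<open>vanishes_at_F\<close>).

  That the deformed surfaces have exactly \<open>\<delta>\<close> singular points is a compactness argument at three
  scales. Away from \<open>p\<close>, a limit of singular points is singular on \<open>G\<close>, which is smooth there. At a
  scale between \<open>t\<close> and \<open>1\<close> around \<open>p\<close>, a limit is a singular point of the projectivised tangent cone
  of \<open>G\<close>, which is smooth too. At scale \<open>t\<close> it is one of the nodes of \<open>g\<close>, and near a node the gradient is
  injective (\<open>grad_perturbed_expanding\<close>), so that only the restored node remains.

  A suitable \<open>g\<close> is a weighted sum of three univariate polynomials of degree \<open>m\<close> that have
  \<open>n_1\<close>, \<open>n_2\<close>, \<open>n_3\<close> double roots: its nodes form a grid. The conditions are independent in degree less than
  \<open>m\<close> as soon as \<open>n_1 + n_2 + n_3 \<le> m + 2\<close>, and \<open>n_j \<le> m/2\<close> leaves room for the double roots. This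
  yields \<open>\<delta>\<close> nodes except for \<open>m = 3\<close>, where \<open>g\<close> is a cubic with four nodes (\<open>nodal_model_exists\<close>).
\<close>

section \<open>Evaluation of polynomials\<close>

definition monomial_value :: "('v \<Rightarrow> 'a::comm_ring_1) \<Rightarrow> ('v \<Rightarrow>\<^sub>0 nat) \<Rightarrow> 'a" where
  "monomial_value a e = (\<Prod>i\<in>Poly_Mapping.keys e. a i ^ Poly_Mapping.lookup e i)"

lemma monomial_value_superset:
  assumes "finite S" "Poly_Mapping.keys e \<subseteq> S"
  shows "monomial_value a e = (\<Prod>i\<in>S. a i ^ Poly_Mapping.lookup e i)"
  unfolding monomial_value_def
  by (rule prod.mono_neutral_left) (use assms in \<open>auto simp: in_keys_iff\<close>)

lemma monomial_value_add: "monomial_value a (e + f) = monomial_value a e * monomial_value a f"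
proof -
  let ?S = "Poly_Mapping.keys e \<union> Poly_Mapping.keys f"
  have "monomial_value a (e + f) = (\<Prod>i\<in>?S. a i ^ Poly_Mapping.lookup (e + f) i)"
    by (rule monomial_value_superset) (use keys_add[of e f] in auto)
  also have "\<dots> = (\<Prod>i\<in>?S. a i ^ Poly_Mapping.lookup e i) * (\<Prod>i\<in>?S. a i ^ Poly_Mapping.lookup f i)"
    by (simp add: lookup_add power_add prod.distrib)
  finally show ?thesis by (simp add: monomial_value_superset[of ?S])
qed

lemma monomial_value_zero [simp]: "monomial_value a 0 = 1"
  by (simp add: monomial_value_def)

lemma monomial_value_single [simp]: "monomial_value a (Poly_Mapping.single i k) = a i ^ k"
  by (simp add: monomial_value_def)

lemma total_degree_superset:
  assumes "finite S" "Poly_Mapping.keys e \<subseteq> S"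
  shows "total_degree e = (\<Sum>i\<in>S. Poly_Mapping.lookup e i)"
  unfolding total_degree_def
  by (rule sum.mono_neutral_left) (use assms in \<open>auto simp: in_keys_iff\<close>)

lemma total_degree_add: "total_degree (e + f) = total_degree e + total_degree f"
proof -
  let ?S = "Poly_Mapping.keys e \<union> Poly_Mapping.keys f"
  have "total_degree (e + f) = (\<Sum>i\<in>?S. Poly_Mapping.lookup (e + f) i)"
    by (rule total_degree_superset) (use keys_add[of e f] in auto)
  also have "\<dots> = (\<Sum>i\<in>?S. Poly_Mapping.lookup e i) + (\<Sum>i\<in>?S. Poly_Mapping.lookup f i)"
    by (simp add: lookup_add sum.distrib)
  finally show ?thesis by (simp add: total_degree_superset[of ?S])
qed

lemma total_degree_zero [simp]: "total_degree 0 = 0"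
  by (simp add: total_degree_def)

lemma total_degree_single [simp]: "total_degree (Poly_Mapping.single i k) = k"
  by (simp add: total_degree_def)

lemma monomial_value_scale:
  "monomial_value (\<lambda>i. c * a i) e = c ^ total_degree e * monomial_value a e"
  by (simp add: monomial_value_def total_degree_def power_mult_distrib prod.distrib power_sum)

lemma substitute_eq:
  "substitute h a F = (\<Sum>e\<in>Poly_Mapping.keys F. h (Poly_Mapping.lookup F e) * monomial_value a e)"
  by (simp add: substitute_def monomial_value_def)

lemma substitute_superset:
  assumes "h 0 = 0" "finite S" "Poly_Mapping.keys F \<subseteq> S"
  shows "substitute h a F = (\<Sum>e\<in>S. h (Poly_Mapping.lookup F e) * monomial_value a e)"
  unfolding substitute_eq
  by (rule sum.mono_neutral_left) (use assms in \<open>auto simp: in_keys_iff\<close>)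

lemma eval_at_eq:
  "eval_at a F = (\<Sum>e\<in>Poly_Mapping.keys F. Poly_Mapping.lookup F e * monomial_value a e)"
  by (simp add: eval_at_def substitute_eq)

lemma eval_at_superset:
  assumes "finite S" "Poly_Mapping.keys F \<subseteq> S"
  shows "eval_at a F = (\<Sum>e\<in>S. Poly_Mapping.lookup F e * monomial_value a e)"
  unfolding eval_at_def by (rule substitute_superset) (use assms in auto)

lemma eval_at_zero [simp]: "eval_at a 0 = 0"
  by (simp add: eval_at_eq)

lemma eval_at_add: "eval_at a (F + G) = eval_at a F + eval_at a G"
proof -
  let ?S = "Poly_Mapping.keys F \<union> Poly_Mapping.keys G"
  have "eval_at a (F + G) = (\<Sum>e\<in>?S. Poly_Mapping.lookup (F + G) e * monomial_value a e)"
    by (rule eval_at_superset) (use keys_add[of F G] in auto)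
  also have "\<dots> = eval_at a F + eval_at a G"
    by (simp add: lookup_add sum.distrib distrib_right eval_at_superset[of ?S])
  finally show ?thesis .
qed

lemma eval_at_sum: "eval_at a (sum F A) = (\<Sum>x\<in>A. eval_at a (F x))"
  by (induction A rule: infinite_finite_induct) (auto simp: eval_at_add)

lemma eval_at_single: "eval_at a (Poly_Mapping.single e c) = c * monomial_value a e"
  by (cases "c = 0") (simp_all add: eval_at_eq)

lemma poly_mapping_eq_sum_single:
  "(F :: 'v cpoly) = (\<Sum>e\<in>Poly_Mapping.keys F. Poly_Mapping.single e (Poly_Mapping.lookup F e))"
  by (rule poly_mapping_eqI)
     (auto simp: lookup_sum lookup_single when_def in_keys_iff sum.delta' 
       intro!: sum.neutral)

lemma eval_at_mult: "eval_at a (F * G) = eval_at a F * eval_at a G"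
proof -
  have 1: "eval_at a (Poly_Mapping.single e c * G) = c * monomial_value a e * eval_at a G" for e c
  proof -
    have "Poly_Mapping.single e c * G = (\<Sum>f\<in>Poly_Mapping.keys G. Poly_Mapping.single e c * Poly_Mapping.single f (Poly_Mapping.lookup G f))"
      by (subst (1) poly_mapping_eq_sum_single[of G]) (simp add: sum_distrib_left)
    then show ?thesis
      by (simp add: eval_at_sum mult_single eval_at_single monomial_value_add sum_distrib_left
          eval_at_eq[of a G] algebra_simps)
  qed
  have "F * G = (\<Sum>e\<in>Poly_Mapping.keys F. Poly_Mapping.single e (Poly_Mapping.lookup F e) * G)"
    by (subst (1) poly_mapping_eq_sum_single[of F]) (simp add: sum_distrib_right)
  then show ?thesis
    by (simp add: eval_at_sum 1 sum_distrib_right eval_at_eq[of a F])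
qed

lemma eval_at_const [simp]: "eval_at a (const_poly c) = c"
  by (simp add: const_poly_def eval_at_single)

lemma eval_at_var [simp]: "eval_at a (var_poly i) = a i"
  by (simp add: var_poly_def eval_at_single)

lemma eval_at_one [simp]: "eval_at a 1 = 1"
  using eval_at_const[of a 1] by (simp add: const_poly_def)

lemma eval_at_power: "eval_at a (F ^ k) = eval_at a F ^ k"
  by (induction k) (auto simp: eval_at_mult)

lemma eval_at_prod: "eval_at a (prod F A) = (\<Prod>x\<in>A. eval_at a (F x))"
  by (induction A rule: infinite_finite_induct) (auto simp: eval_at_mult)

lemma eval_at_diff: "eval_at a (F - G) = eval_at a F - eval_at a G"
  using eval_at_add[of a "F - G" G] by simp

lemma eval_at_monomial_value: "eval_at a (monomial_value b e) = monomial_value (\<lambda>i. eval_at a (b i)) e"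
  by (simp add: monomial_value_def eval_at_prod eval_at_power)

lemma eval_at_substitute:
  "eval_at a (substitute const_poly b F) = eval_at (\<lambda>i. eval_at a (b i)) F"
  unfolding substitute_eq eval_at_sum eval_at_mult eval_at_monomial_value
  by (simp add: eval_at_eq[of _ F])

lemma lookup_const_mult [simp]: "Poly_Mapping.lookup (const_poly c * F) e = c * Poly_Mapping.lookup F e"
proof -
  have "const_poly c * F = Poly_Mapping.map ((*) c) F"
    by (simp add: const_poly_def mult_map_scale_conv_mult)
  then show ?thesis by (simp add: Poly_Mapping.map.rep_eq when_def)
qed

lemma const_poly_zero [simp]: "const_poly 0 = 0"
  by (simp add: const_poly_def)

section \<open>Forms\<close>

lemma forms_zero [simp]: "0 \<in> forms I k" by (simp add: forms_def)

lemma forms_add: "F \<in> forms I k \<Longrightarrow> G \<in> forms I k \<Longrightarrow> F + G \<in> forms I k"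
  using keys_add[of F G] by (auto simp: forms_def)

lemma forms_sum: "(\<And>x. x \<in> A \<Longrightarrow> F x \<in> forms I k) \<Longrightarrow> sum F A \<in> forms I k"
  by (induction A rule: infinite_finite_induct) (auto simp: forms_add)

lemma forms_mult:
  assumes "F \<in> forms I k" "G \<in> forms I l" shows "F * G \<in> forms I (k + l)"
proof -
  have "e \<in> monomials I (k + l)" if "e \<in> Poly_Mapping.keys (F * G)" for e
  proof -
    from that keys_mult[of F G] obtain f g where
      fg: "e = f + g" "f \<in> Poly_Mapping.keys F" "g \<in> Poly_Mapping.keys G" by blast
    then have "f \<in> monomials I k" "g \<in> monomials I l" using assms by (auto simp: forms_def)
    then show ?thesis using keys_add[of f g] by (auto simp: fg monomials_def total_degree_add)
  qed
  then show ?thesis by (auto simp: forms_def)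
qed

lemma forms_const: "const_poly c \<in> forms I 0"
  by (cases "c = 0") (auto simp: forms_def monomials_def const_poly_def)

lemma forms_const_mult: "F \<in> forms I k \<Longrightarrow> const_poly c * F \<in> forms I k"
  using forms_mult[OF forms_const, of F I k c] by simp

lemma forms_diff: assumes "F \<in> forms I k" "G \<in> forms I k" shows "F - G \<in> forms I k"
  using assms keys_diff[of F G] by (auto simp: forms_def)

lemma forms_var: "i \<in> I \<Longrightarrow> var_poly i \<in> forms I 1"
  by (auto simp: forms_def monomials_def var_poly_def)

lemma forms_power: "F \<in> forms I k \<Longrightarrow> F ^ n \<in> forms I (k * n)"
  by (induction n) (use forms_const[of 1 I] in \<open>auto simp: const_poly_def dest: forms_mult\<close>)

lemma forms_prod:
  assumes "\<And>x. x \<in> A \<Longrightarrow> F x \<in> forms I (k x)" shows "prod F A \<in> forms I (sum k A)"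
  using assms forms_const[of 1 I]
  by (induction A rule: infinite_finite_induct) (auto simp: const_poly_def forms_mult)

lemma eval_at_scale:
  assumes "F \<in> forms I k" shows "eval_at (\<lambda>i. c * a i) F = c ^ k * eval_at a F"
  using assms by (auto simp: eval_at_eq monomial_value_scale sum_distrib_left forms_def monomials_def
      subset_iff intro!: sum.cong)

section \<open>Derivatives\<close>

lemma monomial_value_has_derivative:
  fixes b :: "'x::real_normed_vector \<Rightarrow> 'v \<Rightarrow> complex"
  assumes I: "finite I" "Poly_Mapping.keys e \<subseteq> I"
    and b: "\<And>i. i \<in> I \<Longrightarrow> ((\<lambda>x. b x i) has_derivative (\<lambda>h. b' h i)) (at x within S)"
  shows "((\<lambda>x. monomial_value (b x) e) has_derivative
    (\<lambda>h. \<Sum>i\<in>I. b' h i * (of_nat (Poly_Mapping.lookup e i)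
       * monomial_value (b x) (e - Poly_Mapping.single i 1)))) (at x within S)"
proof -
  let ?n = "Poly_Mapping.lookup e"
  have "((\<lambda>x. \<Prod>i\<in>I. b x i ^ ?n i) has_derivative
    (\<lambda>h. \<Sum>i\<in>I. (of_nat (?n i) * b' h i * b x i ^ (?n i - 1)) * (\<Prod>j\<in>I - {i}. b x j ^ ?n j))) (at x within S)"
    by (intro has_derivative_prod has_derivative_power b)
  then have der: "((\<lambda>x. monomial_value (b x) e) has_derivative
    (\<lambda>h. \<Sum>i\<in>I. (of_nat (?n i) * b' h i * b x i ^ (?n i - 1)) * (\<Prod>j\<in>I - {i}. b x j ^ ?n j))) (at x within S)"
    by (simp only: monomial_value_superset[OF I])
  have eq: "of_nat (?n i) * b' h i * b x i ^ (?n i - 1) * (\<Prod>j\<in>I - {i}. b x j ^ ?n j)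
     = b' h i * (of_nat (?n i) * monomial_value (b x) (e - Poly_Mapping.single i 1))" if "i \<in> I" for i h
  proof (cases "?n i = 0")
    case False
    have "monomial_value (b x) (e - Poly_Mapping.single i 1) =
       (\<Prod>j\<in>I. b x j ^ Poly_Mapping.lookup (e - Poly_Mapping.single i 1) j)"
      by (rule monomial_value_superset)
         (use I in \<open>auto simp: in_keys_iff lookup_minus subset_iff\<close>)
    also have "\<dots> = b x i ^ (?n i - 1) * (\<Prod>j\<in>I - {i}. b x j ^ ?n j)"
      by (subst prod.remove[OF I(1) that])
        (auto simp: lookup_minus lookup_single intro!: arg_cong2[where f="(*)"] prod.cong)
    finally show ?thesis by simp
  qed simp
  show ?thesis
    by (rule has_derivative_eq_rhs[OF der]) (intro ext sum.cong refl eq)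
qed

lemma eval_at_partial_deriv:
  "eval_at a (partial_deriv i F) = (\<Sum>e\<in>Poly_Mapping.keys F. Poly_Mapping.lookup F e *
     (of_nat (Poly_Mapping.lookup e i) * monomial_value a (e - Poly_Mapping.single i 1)))"
  by (simp add: partial_deriv_def eval_at_sum eval_at_single algebra_simps)

text \<open>The chain rule links the algebraic partial derivatives of the statement with analysis.\<close>

lemma eval_at_has_derivative:
  assumes I: "finite I" "F \<in> forms I k"
    and b: "\<And>i. i \<in> I \<Longrightarrow> ((\<lambda>x. b x i) has_derivative (\<lambda>h. b' h i)) (at x within S)"
  shows "((\<lambda>x. eval_at (b x) F) has_derivative
    (\<lambda>h. \<Sum>i\<in>I. b' h i * eval_at (b x) (partial_deriv i F))) (at x within S)"
proof -
  have e: "Poly_Mapping.keys e \<subseteq> I" if "e \<in> Poly_Mapping.keys F" for e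
    using that I(2) by (auto simp: forms_def monomials_def)
  have "((\<lambda>x. eval_at (b x) F) has_derivative (\<lambda>h. \<Sum>e\<in>Poly_Mapping.keys F.
      Poly_Mapping.lookup F e * (\<Sum>i\<in>I. b' h i * (of_nat (Poly_Mapping.lookup e i)
       * monomial_value (b x) (e - Poly_Mapping.single i 1))))) (at x within S)"
    unfolding eval_at_eq
    by (intro has_derivative_sum has_derivative_mult_right monomial_value_has_derivative I b e)
  moreover have "(\<Sum>e\<in>Poly_Mapping.keys F.
      Poly_Mapping.lookup F e * (\<Sum>i\<in>I. b' h i * (of_nat (Poly_Mapping.lookup e i)
       * monomial_value (b x) (e - Poly_Mapping.single i 1))))
     = (\<Sum>i\<in>I. b' h i * eval_at (b x) (partial_deriv i F))" for h
    unfolding eval_at_partial_deriv sum_distrib_left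
    by (subst sum.swap) (simp add: algebra_simps)
  ultimately show ?thesis by simp
qed

lemma eval_at_continuous:
  assumes "\<And>i. continuous_on S (\<lambda>x. b x i)" shows "continuous_on S (\<lambda>x. eval_at (b x) F)"
  unfolding eval_at_eq monomial_value_def by (intro continuous_intros assms)

lemma euler_formula:
  assumes "finite I" "F \<in> forms I k"
  shows "(\<Sum>i\<in>I. a i * eval_at a (partial_deriv i F)) = of_nat k * eval_at a F"
proof -
  have "((\<lambda>c. eval_at (\<lambda>i. c * a i) F) has_derivative
    (\<lambda>h. \<Sum>i\<in>I. (h * a i) * eval_at (\<lambda>i. 1 * a i) (partial_deriv i F))) (at 1)"
    by (rule eval_at_has_derivative[OF assms]) (auto intro!: derivative_eq_intros)
  moreover have "((\<lambda>c. eval_at (\<lambda>i. c * a i) F) has_derivative (\<lambda>h. h * of_nat k * eval_at a F)) (at 1)"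
    unfolding eval_at_scale[OF assms(2)] by (auto intro!: derivative_eq_intros)
  ultimately have "(\<lambda>h. \<Sum>i\<in>I. (h * a i) * eval_at (\<lambda>i. 1 * a i) (partial_deriv i F))
      = (\<lambda>h. h * of_nat k * eval_at a F)"
    by (rule has_derivative_unique)
  from fun_cong[OF this, of 1] show ?thesis by simp
qed

section \<open>Polynomial functions of three variables\<close>

text \<open>
  The grading is part of the rules, so that rule induction can turn such a function into a form of
  the same degree.
\<close>

inductive hform :: "nat \<Rightarrow> (complex^3 \<Rightarrow> complex) \<Rightarrow> bool" where
  hform_const: "hform 0 (\<lambda>_. c)"
| hform_coord: "hform 1 (\<lambda>v. v $ j)"
| hform_add: "hform k \<phi> \<Longrightarrow> hform k \<psi> \<Longrightarrow> hform k (\<lambda>v. \<phi> v + \<psi> v)"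
| hform_mult: "hform k \<phi> \<Longrightarrow> hform l \<psi> \<Longrightarrow> hform (k + l) (\<lambda>v. \<phi> v * \<psi> v)"

text \<open>
  Degree at most \<open>N\<close>, as a closure of the homogeneous functions under sums: the homogeneous parts of
  a polynomial function can then be read off by rule induction.
\<close>

inductive polyfn :: "nat \<Rightarrow> (complex^3 \<Rightarrow> complex) \<Rightarrow> bool" where
  polyfn_hform: "hform k \<phi> \<Longrightarrow> k \<le> N \<Longrightarrow> polyfn N \<phi>"
| polyfn_add: "polyfn N \<phi> \<Longrightarrow> polyfn N \<psi> \<Longrightarrow> polyfn N (\<lambda>v. \<phi> v + \<psi> v)"

lemma hform_scale: "hform k \<phi> \<Longrightarrow> \<phi> (r *\<^sub>R v) = of_real r ^ k * \<phi> v"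
  by (induction k \<phi> rule: hform.induct) (auto simp: algebra_simps power_add scaleR_conv_of_real[symmetric])

lemma hform_cmult: "hform k \<phi> \<Longrightarrow> hform k (\<lambda>v. c * \<phi> v)"
  using hform_mult[OF hform_const] by fastforce

lemma hform_zero [simp]: "hform k (\<lambda>_. 0)"
proof (induction k)
  case 0 then show ?case by (rule hform_const)
next
  case (Suc k)
  from hform_mult[OF hform_coord this] show ?case by simp
qed

lemma hform_sum: "(\<And>x. x \<in> A \<Longrightarrow> hform k (\<phi> x)) \<Longrightarrow> hform k (\<lambda>v. \<Sum>x\<in>A. \<phi> x v)"
  by (induction A rule: infinite_finite_induct) (auto intro: hform_add)

lemma hform_power: "hform k \<phi> \<Longrightarrow> hform (k * n) (\<lambda>v. \<phi> v ^ n)"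
  by (induction n) (auto intro: hform_const hform_mult)

lemma hform_coord_power: "hform n (\<lambda>v. v $ j ^ n)"
  using hform_power[OF hform_coord, of n j] by simp

lemma hform_prod: "(\<And>x. x \<in> A \<Longrightarrow> hform (k x) (\<phi> x)) \<Longrightarrow> hform (sum k A) (\<lambda>v. \<Prod>x\<in>A. \<phi> x v)"
  by (induction A rule: infinite_finite_induct) (auto intro: hform_const hform_mult)

lemma polyfn_mono: "polyfn N \<phi> \<Longrightarrow> N \<le> M \<Longrightarrow> polyfn M \<phi>"
  by (induction N \<phi> rule: polyfn.induct) (auto intro: polyfn.intros)

lemma polyfn_const: "polyfn N (\<lambda>_. c)"
  by (rule polyfn_hform[OF hform_const]) simp

lemma polyfn_coord: "1 \<le> N \<Longrightarrow> polyfn N (\<lambda>v. v $ j)"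
  by (rule polyfn_hform[OF hform_coord]) simp

lemma polyfn_mult: 
  assumes "polyfn N \<phi>" "polyfn M \<psi>" shows "polyfn (N + M) (\<lambda>v. \<phi> v * \<psi> v)"
  using assms
proof (induction N \<phi> rule: polyfn.induct)
  case (polyfn_hform k \<phi> N)
  note k = this
  from k(3) show ?case
  proof (induction M \<psi> rule: polyfn.induct)
    case (polyfn_hform l \<psi> M)
    then show ?case using k hform_mult[of k \<phi> l \<psi>] by (auto intro: polyfn.intros)
  next
    case (polyfn_add M \<psi>1 \<psi>2)
    then show ?case using polyfn.polyfn_add by (fastforce simp: distrib_left)
  qed
next
  case (polyfn_add N \<phi>1 \<phi>2)
  then show ?case using polyfn.polyfn_add by (fastforce simp: distrib_right)
qed

lemma polyfn_cmult: "polyfn N \<phi> \<Longrightarrow> polyfn N (\<lambda>v. c * \<phi> v)"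
  using polyfn_mult[OF polyfn_const[of 0 c], of N \<phi>] by simp

lemma polyfn_diff: "polyfn N \<phi> \<Longrightarrow> polyfn N \<psi> \<Longrightarrow> polyfn N (\<lambda>v. \<phi> v - \<psi> v)"
  using polyfn_add[of N \<phi> "\<lambda>v. (-1) * \<psi> v"] polyfn_cmult[of N \<psi> "-1"] by simp

lemma polyfn_sum: "(\<And>x. x \<in> A \<Longrightarrow> polyfn N (\<phi> x)) \<Longrightarrow> polyfn N (\<lambda>v. \<Sum>x\<in>A. \<phi> x v)"
  by (induction A rule: infinite_finite_induct) (auto intro: polyfn_add polyfn_const)

lemma polyfn_prod: "(\<And>x. x \<in> A \<Longrightarrow> polyfn (k x) (\<phi> x)) \<Longrightarrow> polyfn (sum k A) (\<lambda>v. \<Prod>x\<in>A. \<phi> x v)"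
  by (induction A rule: infinite_finite_induct) (auto intro: polyfn_const polyfn_mult)

lemma polyfn_decompose:
  "polyfn N \<phi> \<Longrightarrow> \<exists>\<Phi>. (\<forall>k. hform k (\<Phi> k)) \<and> (\<forall>v. \<phi> v = (\<Sum>k\<le>N. \<Phi> k v))"
proof (induction N \<phi> rule: polyfn.induct)
  case (polyfn_hform k \<phi> N)
  define \<Phi> where "\<Phi> l = (if l = k then \<phi> else (\<lambda>_. 0))" for l
  have "\<phi> v = (\<Sum>l\<le>N. \<Phi> l v)" for v
  proof -
    have "(\<Sum>l\<le>N. \<Phi> l v) = (\<Sum>l\<in>{k}. \<Phi> l v)"
      by (rule sum.mono_neutral_right) (use polyfn_hform in \<open>auto simp: \<Phi>_def\<close>)
    then show ?thesis by (simp add: \<Phi>_def)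
  qed
  moreover have "hform l (\<Phi> l)" for l using polyfn_hform by (auto simp: \<Phi>_def)
  ultimately show ?case by blast
next
  case (polyfn_add N \<phi> \<psi>)
  then obtain \<Phi> \<Psi> where "\<forall>k. hform k (\<Phi> k)" "\<forall>v. \<phi> v = (\<Sum>k\<le>N. \<Phi> k v)"
    "\<forall>k. hform k (\<Psi> k)" "\<forall>v. \<psi> v = (\<Sum>k\<le>N. \<Psi> k v)" by blast
  then show ?case
    by (intro exI[of _ "\<lambda>k v. \<Phi> k v + \<Psi> k v"]) (auto intro: hform_add simp: sum.distrib)
qed

section \<open>Gradients\<close>

definition grad :: "(complex^3 \<Rightarrow> complex) \<Rightarrow> complex^3 \<Rightarrow> complex^3" where
  "grad \<phi> v = (\<chi> j. deriv (\<lambda>x. \<phi> (v + axis j x)) 0)"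

lemma grad_eqI:
  assumes "(\<phi> has_derivative (\<lambda>h. \<Sum>j\<in>UNIV. D j * h $ j)) (at v)"
  shows "grad \<phi> v = (\<chi> j. D j)"
proof -
  have "deriv (\<lambda>x. \<phi> (v + axis j x)) 0 = D j" for j
  proof (rule DERIV_imp_deriv)
    have ax: "((\<lambda>x. v + axis j x) has_derivative (\<lambda>x. axis j x)) (at (0::complex))"
    proof -
      have "bounded_linear (axis j :: complex \<Rightarrow> complex^3)"
        by (intro linear_conv_bounded_linear[THEN iffD1] linearI) (auto simp: vec_eq_iff axis_def)
      then show ?thesis
        using bounded_linear_imp_has_derivative by (auto intro!: derivative_eq_intros)
    qed
    have "v + axis j 0 = v" by (auto simp: vec_eq_iff axis_def)
    with assms have "(\<phi> has_derivative (\<lambda>h. \<Sum>j\<in>UNIV. D j * h $ j)) (at (v + axis j 0))" by metis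
    from has_derivative_compose[OF ax this]
    have "((\<lambda>x. \<phi> (v + axis j x)) has_derivative (\<lambda>x. \<Sum>i\<in>UNIV. D i * axis j x $ i)) (at 0)" .
    moreover have "(\<Sum>i\<in>UNIV. D i * axis j x $ i) = D j * x" for x
      by (simp add: axis_def if_distrib cong: if_cong)
    ultimately show "((\<lambda>x. \<phi> (v + axis j x)) has_field_derivative D j) (at 0)"
      by (simp add: has_field_derivative_def)
  qed
  then show ?thesis by (simp add: grad_def)
qed

lemma hform_derivative:
  "hform k \<phi> \<Longrightarrow> \<exists>D. (\<forall>j. polyfn k (D j)) \<and> (\<forall>v. (\<phi> has_derivative (\<lambda>h. \<Sum>j\<in>UNIV. D j v * h $ j)) (at v))"
proof (induction k \<phi> rule: hform.induct)
  case (hform_const c)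
  show ?case by (intro exI[of _ "\<lambda>_ _. 0"]) (auto intro: polyfn_const)
next
  case (hform_coord j)
  have "((\<lambda>v. v $ j) has_derivative (\<lambda>h. h $ j)) (at v)" for v :: "complex^3"
    by (rule bounded_linear_imp_has_derivative[OF bounded_linear_vec_nth])
  moreover have "(\<Sum>i\<in>UNIV. (if i = j then 1 else 0) * h $ i) = h $ j" for h :: "complex^3"
    by (simp add: if_distrib[of "\<lambda>x. x * _"] cong: if_cong)
  ultimately show ?case by (intro exI[of _ "\<lambda>i _. if i = j then 1 else 0"]) (auto intro: polyfn_const)
next
  case (hform_add k \<phi> \<psi>)
  then obtain D E where D: "\<forall>j. polyfn k (D j)" "\<And>v. (\<phi> has_derivative (\<lambda>h. \<Sum>j\<in>UNIV. D j v * h $ j)) (at v)"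
    and E: "\<forall>j. polyfn k (E j)" "\<And>v. (\<psi> has_derivative (\<lambda>h. \<Sum>j\<in>UNIV. E j v * h $ j)) (at v)" by blast
  show ?case
    by (intro exI[of _ "\<lambda>j v. D j v + E j v"] conjI allI)
       (auto simp: distrib_right sum.distrib D E polyfn_add intro: has_derivative_add)
next
  case (hform_mult k \<phi> l \<psi>)
  then obtain D E where D: "\<forall>j. polyfn k (D j)" "\<And>v. (\<phi> has_derivative (\<lambda>h. \<Sum>j\<in>UNIV. D j v * h $ j)) (at v)"
    and E: "\<forall>j. polyfn l (E j)" "\<And>v. (\<psi> has_derivative (\<lambda>h. \<Sum>j\<in>UNIV. E j v * h $ j)) (at v)" by blast
  have p: "polyfn k \<phi>" "polyfn l \<psi>" using hform_mult by (auto intro: polyfn_hform)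
  have "((\<lambda>v. \<phi> v * \<psi> v) has_derivative (\<lambda>h. \<phi> v * (\<Sum>j\<in>UNIV. E j v * h $ j) + (\<Sum>j\<in>UNIV. D j v * h $ j) * \<psi> v)) (at v)" for v
    by (rule has_derivative_mult[OF D(2) E(2)])
  then have "((\<lambda>v. \<phi> v * \<psi> v) has_derivative (\<lambda>h. \<Sum>j\<in>UNIV. (D j v * \<psi> v + \<phi> v * E j v) * h $ j)) (at v)" for v
    by (rule has_derivative_eq_rhs)
      (auto simp: fun_eq_iff sum_distrib_left sum_distrib_right sum.distrib[symmetric] algebra_simps)
  then show ?case
    using D(1) E(1) p by (intro exI[of _ "\<lambda>j v. D j v * \<psi> v + \<phi> v * E j v"]) (auto intro!: polyfn_add polyfn_mult)
qed

lemma polyfn_derivative: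
  "polyfn k \<phi> \<Longrightarrow> \<exists>D. (\<forall>j. polyfn k (D j)) \<and> (\<forall>v. (\<phi> has_derivative (\<lambda>h. \<Sum>j\<in>UNIV. D j v * h $ j)) (at v))"
proof (induction k \<phi> rule: polyfn.induct)
  case (polyfn_hform k \<phi> N)
  then show ?case using hform_derivative[of k \<phi>] polyfn_mono[of k _ N] by blast
next
  case (polyfn_add k \<phi> \<psi>)
  then obtain D E where D: "\<forall>j. polyfn k (D j)" "\<And>v. (\<phi> has_derivative (\<lambda>h. \<Sum>j\<in>UNIV. D j v * h $ j)) (at v)"
    and E: "\<forall>j. polyfn k (E j)" "\<And>v. (\<psi> has_derivative (\<lambda>h. \<Sum>j\<in>UNIV. E j v * h $ j)) (at v)" by blast
  show ?case
    by (intro exI[of _ "\<lambda>j v. D j v + E j v"] conjI allI)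
       (auto simp: distrib_right sum.distrib D E polyfn.polyfn_add intro: has_derivative_add)
qed

lemma
  assumes "polyfn N \<phi>"
  shows polyfn_has_derivative: "(\<phi> has_derivative (\<lambda>h. \<Sum>j\<in>UNIV. grad \<phi> v $ j * h $ j)) (at v)"
    and polyfn_grad: "polyfn N (\<lambda>v. grad \<phi> v $ j)"
proof -
  from polyfn_derivative[OF assms] obtain D where D: "\<forall>j. polyfn N (D j)"
    "\<And>v. (\<phi> has_derivative (\<lambda>h. \<Sum>j\<in>UNIV. D j v * h $ j)) (at v)" by blast
  have "grad \<phi> v = (\<chi> j. D j v)" for v by (rule grad_eqI[OF D(2)])
  then show "(\<phi> has_derivative (\<lambda>h. \<Sum>j\<in>UNIV. grad \<phi> v $ j * h $ j)) (at v)" "polyfn N (\<lambda>v. grad \<phi> v $ j)"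
    using D by auto
qed

lemma grad_add: "polyfn N \<phi> \<Longrightarrow> polyfn M \<psi> \<Longrightarrow> grad (\<lambda>v. \<phi> v + \<psi> v) v = grad \<phi> v + grad \<psi> v"
proof -
  assume "polyfn N \<phi>" "polyfn M \<psi>"
  then have "((\<lambda>v. \<phi> v + \<psi> v) has_derivative (\<lambda>h. \<Sum>j\<in>UNIV. (grad \<phi> v $ j + grad \<psi> v $ j) * h $ j)) (at v)"
    by (auto simp: distrib_right sum.distrib intro!: has_derivative_add polyfn_has_derivative)
  from grad_eqI[OF this] show ?thesis by (simp add: vec_eq_iff)
qed

lemma grad_cmult: "polyfn N \<phi> \<Longrightarrow> grad (\<lambda>v. c * \<phi> v) v = c *s grad \<phi> v"
proof -
  assume "polyfn N \<phi>"
  then have "((\<lambda>v. c * \<phi> v) has_derivative (\<lambda>h. \<Sum>j\<in>UNIV. (c * grad \<phi> v $ j) * h $ j)) (at v)"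
    by (auto simp: mult.assoc sum_distrib_left[symmetric] intro!: has_derivative_mult_right polyfn_has_derivative)
  from grad_eqI[OF this] show ?thesis by (simp add: vec_eq_iff)
qed

lemma grad_const [simp]: "grad (\<lambda>_. c) v = 0"
  using grad_eqI[of "\<lambda>_. c" "\<lambda>_. 0" v] by (simp add: vec_eq_iff)

lemma grad_sum: "(\<And>x. x \<in> A \<Longrightarrow> polyfn N (\<phi> x)) \<Longrightarrow> grad (\<lambda>v. \<Sum>x\<in>A. \<phi> x v) v = (\<Sum>x\<in>A. grad (\<phi> x) v)"
proof (induction A rule: infinite_finite_induct)
  case (insert x A)
  then have "polyfn N (\<phi> x)" "polyfn N (\<lambda>v. \<Sum>x\<in>A. \<phi> x v)" by (auto intro: polyfn_sum)
  from grad_add[OF this] insert show ?case by simp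
qed auto

lemma hform_polyfn: "hform k \<phi> \<Longrightarrow> polyfn k \<phi>"
  by (rule polyfn_hform) auto

lemma polyfn_continuous: "polyfn N \<phi> \<Longrightarrow> continuous_on S \<phi>"
  by (meson polyfn_has_derivative has_derivative_continuous continuous_at_imp_continuous_on)

lemma polyfn_isCont: "polyfn N \<phi> \<Longrightarrow> isCont \<phi> x"
  by (meson polyfn_has_derivative has_derivative_continuous)

lemma grad_isCont: "polyfn N \<phi> \<Longrightarrow> isCont (grad \<phi>) x"
proof -
  assume "polyfn N \<phi>"
  from polyfn_isCont[OF polyfn_grad[OF this]]
  show ?thesis unfolding isCont_def by (intro vec_tendstoI)
qed

lemma polyfn_tendsto: "polyfn N \<phi> \<Longrightarrow> (u \<longlongrightarrow> l) F \<Longrightarrow> ((\<lambda>n. \<phi> (u n)) \<longlongrightarrow> \<phi> l) F"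
  by (rule isCont_tendsto_compose[OF polyfn_isCont])

lemma grad_tendsto: "polyfn N \<phi> \<Longrightarrow> (u \<longlongrightarrow> l) F \<Longrightarrow> ((\<lambda>n. grad \<phi> (u n)) \<longlongrightarrow> grad \<phi> l) F"
  by (rule isCont_tendsto_compose[OF grad_isCont])

text \<open>
  Differentiating \<open>\<phi> (r v) = r^k \<phi> v\<close> in \<open>v\<close> gives one factor \<open>r\<close> on the left, which is cancelled. For
  \<open>k = 0\<close> the truncated exponent does no harm, because the gradient vanishes.
\<close>

lemma grad_hform_scale:
  assumes "hform k \<phi>" "r \<noteq> 0" shows "grad \<phi> (r *\<^sub>R v) = r ^ (k - 1) *\<^sub>R grad \<phi> v"
proof (cases "k = 0")
  case True
  have "\<phi> v = \<phi> 0" for v using hform_scale[OF assms(1), of 0 v] True by simp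
  then have "\<phi> = (\<lambda>_. \<phi> 0)" by auto
  from arg_cong[OF this, of grad] show ?thesis by (metis grad_const scaleR_zero_right)
next
  case False
  have p: "polyfn k \<phi>" by (rule hform_polyfn[OF assms(1)])
  have "((\<lambda>v. \<phi> (r *\<^sub>R v)) has_derivative (\<lambda>h. \<Sum>j\<in>UNIV. grad \<phi> (r *\<^sub>R v) $ j * (r *\<^sub>R h) $ j)) (at v)"
    by (rule has_derivative_compose[OF _ polyfn_has_derivative[OF p]]) (auto intro!: derivative_eq_intros)
  moreover have "(\<lambda>h. \<Sum>j\<in>UNIV. grad \<phi> (r *\<^sub>R v) $ j * (r *\<^sub>R h) $ j) = (\<lambda>h. \<Sum>j\<in>UNIV. (of_real r * grad \<phi> (r *\<^sub>R v) $ j) * h $ j)"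
    by (simp add: scaleR_conv_of_real[where 'a = complex] algebra_simps)
  ultimately have "grad (\<lambda>v. \<phi> (r *\<^sub>R v)) v = (\<chi> j. of_real r * grad \<phi> (r *\<^sub>R v) $ j)"
    by (intro grad_eqI) simp
  moreover have "(\<lambda>v. \<phi> (r *\<^sub>R v)) = (\<lambda>v. of_real r ^ k * \<phi> v)" using hform_scale[OF assms(1)] by auto
  ultimately have "r *\<^sub>R grad \<phi> (r *\<^sub>R v) = r ^ k *\<^sub>R grad \<phi> v"
    using grad_cmult[OF p, of "of_real r ^ k" v] by (simp add: vec_eq_iff scaleR_conv_of_real[where 'a = complex])
  also have "\<dots> = r *\<^sub>R (r ^ (k - 1) *\<^sub>R grad \<phi> v)" using False by (cases k) auto
  finally show ?thesis by (rule scaleR_left_imp_eq[OF assms(2)])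
qed

section \<open>Hessians and strict differentiability\<close>

definition hess :: "(complex^3 \<Rightarrow> complex) \<Rightarrow> complex^3 \<Rightarrow> complex^3 \<Rightarrow> complex^3" where
  "hess \<phi> p h = (\<chi> j. \<Sum>l\<in>UNIV. grad (\<lambda>v. grad \<phi> v $ j) p $ l * h $ l)"

lemma norm_vec_le_sum: "norm (x :: complex^3) \<le> (\<Sum>j\<in>UNIV. norm (x $ j))"
  unfolding norm_vec_def by (rule L2_set_le_sum) auto

lemma linear_hess: "linear (hess \<phi> p)"
  by (rule linearI) (auto simp: hess_def vec_eq_iff algebra_simps sum.distrib scaleR_sum_right)

text \<open>
  The derivative is continuous, so the linear approximation taken at \<open>p\<close> serves all pairs of nearby
  points. This uniformity is what both the contraction and the local uniqueness of critical points need.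
\<close>

lemma polyfn_strict:
  assumes "polyfn N \<phi>" "e > 0"
  shows "\<exists>r>0. \<forall>x\<in>ball p r. \<forall>y\<in>ball p r.
    norm (\<phi> x - \<phi> y - (\<Sum>j\<in>UNIV. grad \<phi> p $ j * (x - y) $ j)) \<le> e * norm (x - y)"
proof -
  define f' where "f' = (\<lambda>v h. \<Sum>j\<in>UNIV. grad \<phi> v $ j * h $ j)"
  from grad_isCont[OF assms(1), of p] assms(2) obtain r where r: "r > 0"
    "\<And>x. norm (x - p) < r \<Longrightarrow> norm (grad \<phi> x - grad \<phi> p) < e / 3"
    unfolding isCont_def LIM_def dist_norm
    by (metis (no_types, lifting) assms(2) diff_self divide_pos_pos norm_zero zero_less_numeral)
  have "norm (\<phi> x - \<phi> y - f' p (x - y)) \<le> norm (x - y) * e" if "x \<in> ball p r" "y \<in> ball p r" for x y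
  proof (rule differentiable_bound_linearization[where S = "ball p r"])
    show "y + t *\<^sub>R (x - y) \<in> ball p r" if t: "t \<in> {0..1}" for t :: real
    proof -
      have "(1 - t) *\<^sub>R y + t *\<^sub>R x \<in> ball p r"
        by (rule convexD[OF convex_ball]) (use that t \<open>x \<in> ball p r\<close> \<open>y \<in> ball p r\<close> in auto)
      then show ?thesis by (simp add: algebra_simps)
    qed
    show "(\<phi> has_derivative f' v) (at v within ball p r)" for v
      unfolding f'_def by (rule has_derivative_at_withinI[OF polyfn_has_derivative[OF assms(1)]])
    show "onorm (f' v - f' p) \<le> e" if v: "v \<in> ball p r" for v
    proof (rule onorm_le)
      fix h
      have "norm ((f' v - f' p) h) = norm (\<Sum>j\<in>UNIV. (grad \<phi> v - grad \<phi> p) $ j * h $ j)"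
        by (simp add: f'_def sum_subtractf[symmetric] algebra_simps)
      also have "\<dots> \<le> (\<Sum>j\<in>(UNIV::3 set). e / 3 * norm h)"
      proof (rule order_trans[OF norm_sum], rule sum_mono)
        fix j :: 3
        have "norm ((grad \<phi> v - grad \<phi> p) $ j) \<le> e / 3"
          using Finite_Cartesian_Product.norm_nth_le[of "grad \<phi> v - grad \<phi> p" j] r(2)[of v] v by (auto simp: dist_norm norm_minus_commute)
        then show "norm ((grad \<phi> v - grad \<phi> p) $ j * h $ j) \<le> e / 3 * norm h"
          unfolding norm_mult using assms(2) by (intro mult_mono Finite_Cartesian_Product.norm_nth_le) auto
      qed
      also have "\<dots> = e * norm h" by simp
      finally show "norm ((f' v - f' p) h) \<le> e * norm h" .
    qed
  qed (use r in auto)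
  with r(1) show ?thesis unfolding f'_def by (auto simp: mult.commute)
qed

lemma grad_strict:
  assumes "polyfn N \<phi>" "e > 0"
  shows "\<exists>r>0. \<forall>x\<in>ball p r. \<forall>y\<in>ball p r.
    norm (grad \<phi> x - grad \<phi> y - hess \<phi> p (x - y)) \<le> e * norm (x - y)"
proof -
  have "\<forall>j. \<exists>r>0. \<forall>x\<in>ball p r. \<forall>y\<in>ball p r.
    norm (grad \<phi> x $ j - grad \<phi> y $ j - hess \<phi> p (x - y) $ j) \<le> e / 3 * norm (x - y)"
    using polyfn_strict[OF polyfn_grad[OF assms(1)], of "e/3" p] assms(2) by (auto simp: hess_def)
  then obtain r where r: "\<And>j. r j > 0" "\<And>j x y. x \<in> ball p (r j) \<Longrightarrow> y \<in> ball p (r j) \<Longrightarrow>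
      norm (grad \<phi> x $ j - grad \<phi> y $ j - hess \<phi> p (x - y) $ j) \<le> e / 3 * norm (x - y)" by metis
  have *: "norm (grad \<phi> x - grad \<phi> y - hess \<phi> p (x - y)) \<le> e * norm (x - y)"
    if "x \<in> ball p (Min (range r))" "y \<in> ball p (Min (range r))" for x y
  proof -
    have "Min (range r) \<le> r j" for j by simp
    with that have "x \<in> ball p (r j)" "y \<in> ball p (r j)" for j by (fastforce)+
    then have "(\<Sum>j\<in>UNIV. norm ((grad \<phi> x - grad \<phi> y - hess \<phi> p (x - y)) $ j)) \<le> (\<Sum>j\<in>(UNIV::3 set). e / 3 * norm (x - y))"
      using r(2) by (intro sum_mono) auto
    with norm_vec_le_sum[of "grad \<phi> x - grad \<phi> y - hess \<phi> p (x - y)"] show ?thesis by simp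
  qed
  show ?thesis by (rule exI[of _ "Min (range r)"]) (use r(1) * in auto)
qed

section \<open>Persistence of nodes under small perturbations\<close>

text \<open>
  Banach's fixed point theorem for a finite tuple of unknowns with the maximum distance. The length
  of the tuple will be the number of nodes, which is not the size of a fixed type, so the tuples are
  functions of which only the values on \<open>I\<close> matter.
\<close>

lemma contraction_fixed_point:
  fixes T :: "('i \<Rightarrow> 'b::complete_space) \<Rightarrow> 'i \<Rightarrow> 'b"
  assumes r: "0 \<le> r"
    and contr: "\<And>x y e. \<forall>i\<in>I. dist (x i) (x0 i) \<le> r \<Longrightarrow> \<forall>i\<in>I. dist (y i) (x0 i) \<le> r \<Longrightarrow>
       \<forall>i\<in>I. dist (x i) (y i) \<le> e \<Longrightarrow> \<forall>i\<in>I. dist (T x i) (T y i) \<le> e / 2"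
    and init: "\<forall>i\<in>I. dist (T x0 i) (x0 i) \<le> r / 2"
  shows "\<exists>x. (\<forall>i\<in>I. dist (x i) (x0 i) \<le> r) \<and> (\<forall>i\<in>I. T x i = x i)"
proof -
  define X where "X n = (T ^^ n) x0" for n
  have XS: "X (Suc n) = T (X n)" for n by (simp add: X_def)
  have ball: "(\<forall>i\<in>I. dist (X n i) (x0 i) \<le> r * (1 - 1 / 2 ^ n)) \<and>
              (\<forall>i\<in>I. dist (X (Suc n) i) (X n i) \<le> r / 2 ^ Suc n)" for n
  proof (induction n)
    case 0
    then show ?case using init by (simp add: X_def)
  next
    case (Suc n)
    have 1: "dist (X (Suc n) i) (x0 i) \<le> r * (1 - 1 / 2 ^ Suc n)" if "i \<in> I" for i
    proof -
      have "dist (X (Suc n) i) (x0 i) \<le> r / 2 ^ Suc n + r * (1 - 1 / 2 ^ n)"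
        using Suc.IH that by (intro order_trans[OF dist_triangle[of _ _ "X n i"] add_mono]) auto
      also have "\<dots> = r * (1 - 1 / 2 ^ Suc n)" by (simp add: field_simps)
      finally show ?thesis .
    qed
    have le: "r * (1 - 1 / 2 ^ k) \<le> r" for k using r by (simp add: mult_left_le)
    have "\<forall>i\<in>I. dist (T (X (Suc n)) i) (T (X n) i) \<le> r / 2 ^ Suc n / 2"
    proof (rule contr)
      show "\<forall>i\<in>I. dist (X (Suc n) i) (x0 i) \<le> r" using 1 le[of "Suc n"] by (auto intro: order_trans)
      show "\<forall>i\<in>I. dist (X n i) (x0 i) \<le> r" using Suc.IH le[of n] by (auto intro: order_trans)
    qed (use Suc.IH in auto)
    with 1 show ?case by (simp add: XS)
  qed
  have le: "r * (1 - 1 / 2 ^ k) \<le> r" for k using r by (simp add: mult_left_le)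
  have step: "dist (X (n + k) i) (X n i) \<le> r / 2 ^ n * (1 - 1 / 2 ^ k)" if "i \<in> I" for i n k
  proof (induction k)
    case (Suc k)
    have "dist (X (n + Suc k) i) (X n i) \<le> r / 2 ^ Suc (n + k) + r / 2 ^ n * (1 - 1 / 2 ^ k)"
      using ball[of "n + k"] that Suc by (intro order_trans[OF dist_triangle[of _ _ "X (n + k) i"] add_mono]) auto
    also have "\<dots> = r / 2 ^ n * (1 - 1 / 2 ^ Suc k)" by (simp add: field_simps power_add)
    finally show ?case .
  qed simp
  have step': "dist (X (n + k) i) (X n i) \<le> r / 2 ^ n" if "i \<in> I" for i n k
    by (rule order_trans[OF step[OF that]], rule mult_left_le) (use r in auto)
  have lim0: "(\<lambda>n. r / 2 ^ n) \<longlonglongrightarrow> 0"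
    using tendsto_mult[OF tendsto_const LIMSEQ_power_zero[of "1/2 :: real"], of r] by (simp add: power_divide)
  have "\<exists>l. (\<lambda>n. X n i) \<longlonglongrightarrow> l" if i: "i \<in> I" for i
  proof -
    have "Cauchy (\<lambda>n. X n i)"
    proof (rule metric_CauchyI)
      fix e :: real assume "0 < e"
      then obtain n0 where n0: "r / 2 ^ n0 < e / 2"
        using order_tendstoD(2)[OF lim0, of "e / 2"] by (auto simp: eventually_sequentially)
      have "dist (X m i) (X n i) < e" if "m \<ge> n0" "n \<ge> n0" for m n
      proof -
        have "dist (X m i) (X n0 i) \<le> r / 2 ^ n0" "dist (X n i) (X n0 i) \<le> r / 2 ^ n0"
          using step'[OF i, of n0 "m - n0"] step'[OF i, of n0 "n - n0"] that by simp_all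
        with n0 dist_triangle2[of "X m i" "X n i" "X n0 i"] show ?thesis by linarith
      qed
      then show "\<exists>M. \<forall>m\<ge>M. \<forall>n\<ge>M. dist (X m i) (X n i) < e" by blast
    qed
    then show ?thesis using Cauchy_convergent_iff convergent_def by blast
  qed
  then obtain x where x: "\<And>i. i \<in> I \<Longrightarrow> (\<lambda>n. X n i) \<longlonglongrightarrow> x i" by metis
  have close: "dist (x i) (X n i) \<le> r / 2 ^ n" if "i \<in> I" for i n
  proof (rule Lim_bounded)
    show "(\<lambda>k. dist (X k i) (X n i)) \<longlonglongrightarrow> dist (x i) (X n i)"
      by (intro tendsto_intros x that)
    show "\<forall>k\<ge>n. dist (X k i) (X n i) \<le> r / 2 ^ n"
      using step'[OF that, of n] by (metis le_add_diff_inverse)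
  qed
  have in0: "\<forall>i\<in>I. dist (x i) (x0 i) \<le> r" using close[of _ 0] by (auto simp: X_def)
  have "T x i = x i" if i: "i \<in> I" for i
  proof -
    have "dist (T x i) (X (Suc n) i) \<le> r / 2 ^ n / 2" for n
    proof -
      have "\<forall>i\<in>I. dist (X n i) (x0 i) \<le> r" using ball[of n] le[of n] by (auto intro: order_trans)
      from contr[OF in0 this, of "r / 2 ^ n"] close i show ?thesis by (simp add: XS)
    qed
    then have *: "dist (T x i) (x i) \<le> r / 2 ^ n" for n
    proof -
      have "dist (T x i) (x i) \<le> r / 2 ^ n / 2 + r / 2 ^ Suc n"
        by (rule order_trans[OF dist_triangle2[of _ _ "X (Suc n) i"] add_mono], fact, rule close[OF i])
      then show ?thesis by simp
    qed
    have "dist (T x i) (x i) \<le> 0"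
      by (rule LIMSEQ_le_const[OF lim0]) (use * in auto)
    then show ?thesis by simp
  qed
  with in0 show ?thesis by blast
qed

text \<open>
  One constant for the sizes and the variations of a function and of its gradient, so that finitely
  many perturbing functions at finitely many nodes can share it.
\<close>
definition lipschitz_at :: "real \<Rightarrow> real \<Rightarrow> complex^3 \<Rightarrow> (complex^3 \<Rightarrow> complex) \<Rightarrow> bool" where
  "lipschitz_at B r p \<phi> \<longleftrightarrow> (\<forall>x\<in>ball p r. \<forall>y\<in>ball p r.
     norm (\<phi> x - \<phi> y) \<le> B * norm (x - y) \<and> norm (grad \<phi> x - grad \<phi> y) \<le> B * norm (x - y)
     \<and> norm (\<phi> x) \<le> B \<and> norm (grad \<phi> x) \<le> B)"

lemma lipschitz_at_mono:
  assumes "lipschitz_at B r p \<phi>" "B \<le> B'" "r' \<le> r" shows "lipschitz_at B' r' p \<phi>"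
proof -
  have "norm (\<phi> x - \<phi> y) \<le> B' * norm (x - y) \<and> norm (grad \<phi> x - grad \<phi> y) \<le> B' * norm (x - y)
     \<and> norm (\<phi> x) \<le> B' \<and> norm (grad \<phi> x) \<le> B'" if "x \<in> ball p r'" "y \<in> ball p r'" for x y
  proof -
    have "x \<in> ball p r" "y \<in> ball p r" using that assms(3) by auto
    then have *: "norm (\<phi> x - \<phi> y) \<le> B * norm (x - y)" "norm (grad \<phi> x - grad \<phi> y) \<le> B * norm (x - y)"
      "norm (\<phi> x) \<le> B" "norm (grad \<phi> x) \<le> B" using assms(1) by (simp_all add: lipschitz_at_def)
    have "B * norm (x - y) \<le> B' * norm (x - y)" using assms(2) by (intro mult_right_mono) auto
    with * assms(2) show ?thesis by linarith
  qed
  then show ?thesis by (simp add: lipschitz_at_def)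
qed

lemma polyfn_lipschitz_at:
  assumes "polyfn N \<phi>" shows "\<exists>B r. r > 0 \<and> lipschitz_at B r p \<phi>"
proof -
  from polyfn_strict[OF assms zero_less_one, of p] obtain r1 where r1: "r1 > 0"
    "\<And>x y. x \<in> ball p r1 \<Longrightarrow> y \<in> ball p r1 \<Longrightarrow>
      norm (\<phi> x - \<phi> y - (\<Sum>j\<in>UNIV. grad \<phi> p $ j * (x - y) $ j)) \<le> 1 * norm (x - y)" by blast
  from grad_strict[OF assms zero_less_one, of p] obtain r2 where r2: "r2 > 0"
    "\<And>x y. x \<in> ball p r2 \<Longrightarrow> y \<in> ball p r2 \<Longrightarrow>
      norm (grad \<phi> x - grad \<phi> y - hess \<phi> p (x - y)) \<le> 1 * norm (x - y)" by blast
  obtain K1 where K1: "\<And>h. norm (\<Sum>j\<in>UNIV. grad \<phi> p $ j * h $ j) \<le> norm h * K1"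
    using bounded_linear.bounded[OF has_derivative_bounded_linear[OF polyfn_has_derivative[OF assms, of p]]] by metis
  obtain K2 where K2: "\<And>h. norm (hess \<phi> p h) \<le> norm h * K2"
    using bounded_linear.bounded[OF linear_hess[of \<phi> p, THEN linear_conv_bounded_linear[THEN iffD1]]] by metis
  define C where "C = max 0 (max (K1 + 1) (K2 + 1))"
  define r where "r = min 1 (min r1 r2)"
  have a: "norm (\<phi> x - \<phi> y) \<le> C * norm (x - y)" if "x \<in> ball p r" "y \<in> ball p r" for x y
  proof -
    let ?l = "\<Sum>j\<in>UNIV. grad \<phi> p $ j * (x - y) $ j"
    have "norm (\<phi> x - \<phi> y) \<le> norm (\<phi> x - \<phi> y - ?l) + norm ?l"
      using norm_triangle_sub[of "\<phi> x - \<phi> y" ?l] by simp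
    also have "\<dots> \<le> 1 * norm (x - y) + norm (x - y) * K1"
      by (intro add_mono r1(2) K1) (use that in \<open>simp_all add: r_def\<close>)
    also have "\<dots> = (K1 + 1) * norm (x - y)" by (simp add: distrib_right mult.commute)
    finally have "norm (\<phi> x - \<phi> y) \<le> (K1 + 1) * norm (x - y)" .
    also have "(K1 + 1) * norm (x - y) \<le> C * norm (x - y)" by (intro mult_right_mono) (auto simp: C_def)
    finally show ?thesis .
  qed
  have b: "norm (grad \<phi> x - grad \<phi> y) \<le> C * norm (x - y)" if "x \<in> ball p r" "y \<in> ball p r" for x y
  proof -
    have "norm (grad \<phi> x - grad \<phi> y) \<le> norm (grad \<phi> x - grad \<phi> y - hess \<phi> p (x - y)) + norm (hess \<phi> p (x - y))"
      using norm_triangle_sub[of "grad \<phi> x - grad \<phi> y" "hess \<phi> p (x - y)"] by simp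
    also have "\<dots> \<le> 1 * norm (x - y) + norm (x - y) * K2"
      by (intro add_mono r2(2) K2) (use that in \<open>simp_all add: r_def\<close>)
    also have "\<dots> = (K2 + 1) * norm (x - y)" by (simp add: distrib_right mult.commute)
    finally have "norm (grad \<phi> x - grad \<phi> y) \<le> (K2 + 1) * norm (x - y)" .
    also have "(K2 + 1) * norm (x - y) \<le> C * norm (x - y)" by (intro mult_right_mono) (auto simp: C_def)
    finally show ?thesis .
  qed
  define B where "B = C + norm (\<phi> p) + norm (grad \<phi> p)"
  have rp: "p \<in> ball p r" using r1(1) r2(1) by (simp add: r_def)
  have le: "C * norm (x - p) \<le> C" if "x \<in> ball p r" for x
  proof -
    have "norm (x - p) \<le> 1" using that by (auto simp: r_def dist_norm norm_minus_commute)
    then show ?thesis by (intro mult_left_le) (auto simp: C_def)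
  qed
  have "norm (\<phi> x) \<le> B" "norm (grad \<phi> x) \<le> B" if "x \<in> ball p r" for x
    using order_trans[OF norm_triangle_ineq2 a[OF that rp]] order_trans[OF norm_triangle_ineq2 b[OF that rp]]
      le[OF that] norm_ge_zero[of "\<phi> p"] norm_ge_zero[of "grad \<phi> p"]
    unfolding B_def by linarith+
  moreover have "C * norm (x - y) \<le> B * norm (x - y)" for x y :: "complex^3"
    by (intro mult_right_mono) (auto simp: B_def)
  ultimately have "lipschitz_at B r p \<phi>"
    unfolding lipschitz_at_def by (intro ballI conjI order_trans[OF a] order_trans[OF b])
  moreover have "r > 0" using r1 r2 by (simp add: r_def)
  ultimately show ?thesis by blast
qed

lemma uniform_lipschitz_at:
  assumes "finite S" "\<And>\<phi> p. (\<phi>, p) \<in> S \<Longrightarrow> polyfn N \<phi>"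
  shows "\<exists>B r. r > 0 \<and> (\<forall>(\<phi>, p)\<in>S. lipschitz_at B r p \<phi>)"
  using assms
proof (induction S rule: finite_induct)
  case empty
  then show ?case by (auto intro: exI[of _ "1::real"])
next
  case (insert x S)
  then obtain B r where Br: "r > 0" "\<forall>(\<phi>, p)\<in>S. lipschitz_at B r p \<phi>" by blast
  obtain \<phi> p where x: "x = (\<phi>, p)" by force
  from insert.prems[of \<phi> p] x polyfn_lipschitz_at[of N \<phi> p] obtain B' r' where "r' > 0" "lipschitz_at B' r' p \<phi>" by auto
  then have "\<forall>(\<phi>, p)\<in>insert x S. lipschitz_at (max B B') (min r r') p \<phi>"
    using Br x by (auto intro: lipschitz_at_mono)
  then show ?case using Br(1) \<open>r' > 0\<close> by (intro exI[of _ "max B B'"] exI[of _ "min r r'"]) auto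
qed

lemma lipschitz_at_combination:
  assumes "\<And>i. i \<in> A \<Longrightarrow> lipschitz_at B r p (M i)" "x \<in> ball p r" "y \<in> ball p r"
  shows "norm (\<Sum>i\<in>A. \<theta> i * (M i x - M i y)) \<le> (\<Sum>i\<in>A. norm (\<theta> i)) * B * norm (x - y)"
    and "norm (\<Sum>i\<in>A. \<theta> i *s (grad (M i) x - grad (M i) y)) \<le> (\<Sum>i\<in>A. norm (\<theta> i)) * B * norm (x - y)"
    and "norm (\<Sum>i\<in>A. \<theta> i * M i x) \<le> (\<Sum>i\<in>A. norm (\<theta> i)) * B"
    and "norm (\<Sum>i\<in>A. \<theta> i *s grad (M i) x) \<le> (\<Sum>i\<in>A. norm (\<theta> i)) * B"
proof -
  have nv: "norm (c *s v) = norm c * norm v" for c :: complex and v :: "complex^3"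
    by (simp add: norm_vec_def L2_set_def norm_mult power_mult_distrib sum_distrib_left[symmetric] real_sqrt_mult)
  have l: "norm (M i x - M i y) \<le> B * norm (x - y)" "norm (grad (M i) x - grad (M i) y) \<le> B * norm (x - y)"
    "norm (M i x) \<le> B" "norm (grad (M i) x) \<le> B" if "i \<in> A" for i
    using assms(1)[OF that] assms(2,3) unfolding lipschitz_at_def by blast+
  show "norm (\<Sum>i\<in>A. \<theta> i * (M i x - M i y)) \<le> (\<Sum>i\<in>A. norm (\<theta> i)) * B * norm (x - y)"
    unfolding sum_distrib_right mult.assoc
    by (intro sum_norm_le) (auto simp: norm_mult intro!: mult_left_mono l)
  show "norm (\<Sum>i\<in>A. \<theta> i *s (grad (M i) x - grad (M i) y)) \<le> (\<Sum>i\<in>A. norm (\<theta> i)) * B * norm (x - y)"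
    unfolding sum_distrib_right mult.assoc
    by (intro sum_norm_le) (simp only: nv, intro mult_left_mono l norm_ge_zero)
  show "norm (\<Sum>i\<in>A. \<theta> i * M i x) \<le> (\<Sum>i\<in>A. norm (\<theta> i)) * B"
    unfolding sum_distrib_right mult.assoc
    by (intro sum_norm_le) (auto simp: norm_mult intro!: mult_left_mono l)
  show "norm (\<Sum>i\<in>A. \<theta> i *s grad (M i) x) \<le> (\<Sum>i\<in>A. norm (\<theta> i)) * B"
    unfolding sum_distrib_right mult.assoc
    by (intro sum_norm_le) (simp only: nv, intro mult_left_mono l norm_ge_zero)
qed

text \<open>
  The nodes \<open>Z\<close> of \<open>g\<close>, the functions \<open>L\<close> that show that they impose independent conditions, and the
  functions \<open>M\<close> that perturb \<open>g\<close>.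
\<close>

locale nodal_function =
  fixes g :: "complex^3 \<Rightarrow> complex" and Z :: "(complex^3) set" and L :: "complex^3 \<Rightarrow> complex^3 \<Rightarrow> complex"
    and M :: "'a \<Rightarrow> complex^3 \<Rightarrow> complex" and A :: "'a set" and N :: nat
  assumes g_polyfn: "polyfn N g"
    and finite_Z: "finite Z" and finite_A: "finite A"
    and g_sing: "z \<in> Z \<Longrightarrow> g z = 0" "z \<in> Z \<Longrightarrow> grad g z = 0"
    and g_hess: "z \<in> Z \<Longrightarrow> hess g z h = 0 \<Longrightarrow> h = 0"
    and L_polyfn: "w \<in> Z \<Longrightarrow> polyfn N (L w)"
    and L_interpolates: "w \<in> Z \<Longrightarrow> z \<in> Z \<Longrightarrow> L w z = of_bool (w = z)"
    and M_polyfn: "i \<in> A \<Longrightarrow> polyfn N (M i)"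
begin

definition perturbed :: "('a \<Rightarrow> complex) \<Rightarrow> (complex^3 \<Rightarrow> complex) \<Rightarrow> complex^3 \<Rightarrow> complex" where
  "perturbed \<theta> c v = g v + (\<Sum>i\<in>A. \<theta> i * M i v) + (\<Sum>w\<in>Z. c w * L w v)"

lemma grad_perturbed: "grad (perturbed \<theta> c) v =
  grad g v + (\<Sum>i\<in>A. \<theta> i *s grad (M i) v) + (\<Sum>w\<in>Z. c w *s grad (L w) v)"
proof -
  have 1: "polyfn N (\<lambda>v. \<Sum>i\<in>A. \<theta> i * M i v)" "polyfn N (\<lambda>v. \<Sum>w\<in>Z. c w * L w v)"
    by (intro polyfn_sum polyfn_cmult L_polyfn M_polyfn; assumption)+
  have "grad (\<lambda>v. \<Sum>i\<in>A. \<theta> i * M i v) v = (\<Sum>i\<in>A. \<theta> i *s grad (M i) v)"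
    by (subst grad_sum[where N = N]) (auto intro!: polyfn_cmult M_polyfn sum.cong grad_cmult)
  moreover have "grad (\<lambda>v. \<Sum>w\<in>Z. c w * L w v) v = (\<Sum>w\<in>Z. c w *s grad (L w) v)"
    by (subst grad_sum[where N = N]) (auto intro!: polyfn_cmult L_polyfn sum.cong grad_cmult)
  ultimately show ?thesis
    unfolding perturbed_def[abs_def]
    by (simp add: grad_add[OF polyfn_add[OF g_polyfn 1(1)] 1(2)] grad_add[OF g_polyfn 1(1)])
qed

lemma hess_inverse:
  assumes "z \<in> Z"
  shows "\<exists>J. linear J \<and> (\<forall>h. J (hess g z h) = h) \<and> (\<forall>h. J h = 0 \<longrightarrow> h = 0)"
proof -
  have inj: "inj (hess g z)"
    using linear_injective_0[OF linear_hess, of g z] g_hess[OF assms] by blast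
  from linear_injective_left_inverse[OF linear_hess inj] obtain J where J: "linear J" "J \<circ> hess g z = id" by blast
  have 1: "J (hess g z h) = h" for h using fun_cong[OF J(2), of h] by simp
  have "surj (hess g z)" by (rule linear_injective_imp_surjective[OF linear_hess inj]) simp
  then have "h = 0" if "J h = 0" for h
    using that 1 linear_0[OF linear_hess, of g z] by (metis surjE)
  with J(1) 1 show ?thesis by blast
qed

lemma uniform_constants:
  obtains B J r where "B \<ge> 1" "r > 0"
    "\<And>z. z \<in> Z \<Longrightarrow> linear (J z)" "\<And>z h. z \<in> Z \<Longrightarrow> J z (hess g z h) = h"
    "\<And>z h. z \<in> Z \<Longrightarrow> J z h = 0 \<Longrightarrow> h = 0" "\<And>z h. z \<in> Z \<Longrightarrow> norm (J z h) \<le> B * norm h"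
    "\<And>z i. z \<in> Z \<Longrightarrow> i \<in> A \<Longrightarrow> lipschitz_at B r z (M i)"
    "\<And>z w. z \<in> Z \<Longrightarrow> w \<in> Z \<Longrightarrow> lipschitz_at B r z (L w)"
proof -
  obtain J where J: "\<And>z. z \<in> Z \<Longrightarrow> linear (J z)" "\<And>z h. z \<in> Z \<Longrightarrow> J z (hess g z h) = h"
    "\<And>z h. z \<in> Z \<Longrightarrow> J z h = 0 \<Longrightarrow> h = 0" using hess_inverse by metis
  have "\<exists>K. \<forall>h. norm (J z h) \<le> norm h * K" if "z \<in> Z" for z
    using J(1)[OF that] by (meson bounded_linear.bounded linear_conv_bounded_linear)
  then obtain K where K: "\<And>z h. z \<in> Z \<Longrightarrow> norm (J z h) \<le> norm h * K z" by metis
  let ?S = "(M ` A \<union> L ` Z) \<times> Z"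
  have "\<exists>B r. r > 0 \<and> (\<forall>(\<phi>, p)\<in>?S. lipschitz_at B r p \<phi>)"
    by (rule uniform_lipschitz_at[where N = N]) (use finite_A finite_Z M_polyfn L_polyfn in auto)
  then obtain B0 r where Br: "r > 0" "\<forall>(\<phi>, p)\<in>?S. lipschitz_at B0 r p \<phi>" by blast
  define B where "B = max 1 (max B0 (\<Sum>z\<in>Z. \<bar>K z\<bar>))"
  have "K z \<le> B" if "z \<in> Z" for z
  proof -
    have "\<bar>K z\<bar> \<le> (\<Sum>z\<in>Z. \<bar>K z\<bar>)" by (rule member_le_sum) (use that finite_Z in auto)
    then show ?thesis by (simp add: B_def)
  qed
  then have JB: "norm (J z h) \<le> B * norm h" if "z \<in> Z" for z h
    using order_trans[OF K[OF that, of h] mult_left_mono[of "K z" B "norm h"]] that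
    by (simp add: mult.commute)
  have MB: "lipschitz_at B r z (M i)" if "z \<in> Z" "i \<in> A" for z i
    by (rule lipschitz_at_mono[of B0 r]) (use Br that in \<open>auto simp: B_def\<close>)
  have LB: "lipschitz_at B r z (L w)" if "z \<in> Z" "w \<in> Z" for z w
    by (rule lipschitz_at_mono[of B0 r]) (use Br that in \<open>auto simp: B_def\<close>)
  have "B \<ge> 1" by (simp add: B_def)
  from that[OF this Br(1) J JB MB LB] show ?thesis .
qed

text \<open>
  Near a node the gradient of \<open>g\<close> is close to the Hessian, which is injective and hence bounded below,
  and the perturbations change it by little. So near a node there is at most one critical
  point of the perturbed function, and it is nondegenerate.
\<close>

lemma grad_perturbed_expanding:
  "\<exists>\<kappa>>0. \<exists>r>0. \<exists>\<sigma>>0. \<forall>\<theta> c. (\<Sum>i\<in>A. norm (\<theta> i)) \<le> \<sigma> \<longrightarrow> (\<Sum>w\<in>Z. norm (c w)) \<le> \<sigma> \<longrightarrow>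
     (\<forall>z\<in>Z. \<forall>x\<in>ball z r. \<forall>y\<in>ball z r.
       norm (grad (perturbed \<theta> c) x - grad (perturbed \<theta> c) y) \<ge> \<kappa> * norm (x - y))"
proof -
  obtain B J r0 where B: "B \<ge> 1" "r0 > 0"
    "\<And>z. z \<in> Z \<Longrightarrow> linear (J z)" "\<And>z h. z \<in> Z \<Longrightarrow> J z (hess g z h) = h"
    "\<And>z h. z \<in> Z \<Longrightarrow> J z h = 0 \<Longrightarrow> h = 0" "\<And>z h. z \<in> Z \<Longrightarrow> norm (J z h) \<le> B * norm h"
    "\<And>z i. z \<in> Z \<Longrightarrow> i \<in> A \<Longrightarrow> lipschitz_at B r0 z (M i)"
    "\<And>z w. z \<in> Z \<Longrightarrow> w \<in> Z \<Longrightarrow> lipschitz_at B r0 z (L w)" by (rule uniform_constants) (blast intro: that)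
  have "\<forall>z. \<exists>r>0. \<forall>x\<in>ball z r. \<forall>y\<in>ball z r.
    norm (grad g x - grad g y - hess g z (x - y)) \<le> 1 / (4 * B) * norm (x - y)"
    using grad_strict[OF g_polyfn, of "1 / (4 * B)"] B(1) by (auto simp del: mem_ball)
  then obtain \<rho> where \<rho>: "\<And>z. \<rho> z > 0" "\<And>z x y. x \<in> ball z (\<rho> z) \<Longrightarrow> y \<in> ball z (\<rho> z) \<Longrightarrow>
    norm (grad g x - grad g y - hess g z (x - y)) \<le> 1 / (4 * B) * norm (x - y)" by metis
  define r where "r = Min (insert r0 (\<rho> ` Z))"
  have r: "r > 0" "r \<le> r0" "\<And>z. z \<in> Z \<Longrightarrow> r \<le> \<rho> z" using finite_Z B(2) \<rho>(1) by (auto simp: r_def)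
  define \<sigma> where "\<sigma> = 1 / (8 * B\<^sup>2)"
  have main: "norm (grad (perturbed \<theta> c) x - grad (perturbed \<theta> c) y) \<ge> 1 / (2 * B) * norm (x - y)"
    if \<theta>: "(\<Sum>i\<in>A. norm (\<theta> i)) \<le> \<sigma>" and c: "(\<Sum>w\<in>Z. norm (c w)) \<le> \<sigma>" and z: "z \<in> Z"
      and x: "x \<in> ball z r" and y: "y \<in> ball z r" for \<theta> c z x y
  proof -
    let ?D = "\<Sum>i\<in>A. \<theta> i *s (grad (M i) x - grad (M i) y)"
    let ?E = "\<Sum>w\<in>Z. c w *s (grad (L w) x - grad (L w) y)"
    have x0: "x \<in> ball z r0" "y \<in> ball z r0" "x \<in> ball z (\<rho> z)" "y \<in> ball z (\<rho> z)" using x y r(2) r(3)[OF z] by auto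
    have "norm ?D \<le> (\<Sum>i\<in>A. norm (\<theta> i)) * B * norm (x - y)"
      by (rule lipschitz_at_combination) (use B z x0 in auto)
    also have "\<dots> \<le> \<sigma> * B * norm (x - y)" using \<theta> B(1) by (intro mult_right_mono) auto
    finally have D: "norm ?D \<le> 1 / (8 * B) * norm (x - y)" using B(1) by (simp add: \<sigma>_def power2_eq_square)
    have "norm ?E \<le> (\<Sum>w\<in>Z. norm (c w)) * B * norm (x - y)"
      by (rule lipschitz_at_combination) (use B z x0 in auto)
    also have "\<dots> \<le> \<sigma> * B * norm (x - y)" using c B(1) by (intro mult_right_mono) auto
    finally have E: "norm ?E \<le> 1 / (8 * B) * norm (x - y)" using B(1) by (simp add: \<sigma>_def power2_eq_square)
    have "norm (x - y) = norm (J z (hess g z (x - y)))" using B(4)[OF z] by simp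
    also have "\<dots> \<le> B * norm (hess g z (x - y))" by (rule B(6)[OF z])
    finally have H: "1 / B * norm (x - y) \<le> norm (hess g z (x - y))" using B(1) by (simp add: field_simps)
    have eq: "grad (perturbed \<theta> c) x - grad (perturbed \<theta> c) y =
       hess g z (x - y) + ((grad g x - grad g y - hess g z (x - y)) + ?D + ?E)"
      unfolding grad_perturbed by (simp add: vec_eq_iff sum_subtractf algebra_simps)
    have "norm ((grad g x - grad g y - hess g z (x - y)) + ?D + ?E) \<le>
        1 / (4 * B) * norm (x - y) + 1 / (8 * B) * norm (x - y) + 1 / (8 * B) * norm (x - y)"
      using \<rho>(2)[OF x0(3,4)] D E by (intro norm_triangle_le add_mono) auto
    also have "\<dots> = 1 / B * norm (x - y) - 1 / (2 * B) * norm (x - y)" by (simp add: field_simps)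
    finally show ?thesis unfolding eq using H
      norm_diff_ineq[of "hess g z (x - y)" "(grad g x - grad g y - hess g z (x - y)) + ?D + ?E"] by linarith
  qed
  have "1 / (2 * B) > 0" "\<sigma> > 0" using B(1) by (auto simp: \<sigma>_def)
  with main r(1) show ?thesis by blast
qed

text \<open>
  The unknowns are the positions \<open>q z\<close> and the coefficients \<open>c z\<close>. They are found by the iteration
  \<open>q z - J z (grad K (q z))\<close>, \<open>c z - K (q z)\<close> for the perturbed function \<open>K\<close>, where \<open>J z\<close> inverts
  the Hessian at \<open>z\<close>. At the unperturbed solution its linear part ignores the positions and sends a
  change of the coefficients to a change of the positions only: the Hessian cancels in the
  first component, and in the second one \<open>L w z = of_bool (w = z)\<close> and \<open>grad g z = 0\<close> do. A nilpotent
  linear part becomes a contraction when the positions are measured in a large unit \<open>\<Lambda>\<close>.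
\<close>

theorem nodes_persist:
  assumes "\<eta> > 0"
  shows "\<exists>\<sigma>>0. \<forall>\<theta>. (\<Sum>i\<in>A. norm (\<theta> i)) \<le> \<sigma> \<longrightarrow>
    (\<exists>c q. \<forall>z\<in>Z. norm (c z) < \<eta> \<and> norm (q z - z) < \<eta> \<and>
       perturbed \<theta> c (q z) = 0 \<and> grad (perturbed \<theta> c) (q z) = 0)"
proof -
  obtain B J r0 where B: "B \<ge> 1" and r0: "r0 > 0" and
    J: "\<And>z. z \<in> Z \<Longrightarrow> linear (J z)" "\<And>z h. z \<in> Z \<Longrightarrow> J z (hess g z h) = h"
    "\<And>z h. z \<in> Z \<Longrightarrow> J z h = 0 \<Longrightarrow> h = 0" "\<And>z h. z \<in> Z \<Longrightarrow> norm (J z h) \<le> B * norm h" and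
    lipM: "\<And>z i. z \<in> Z \<Longrightarrow> i \<in> A \<Longrightarrow> lipschitz_at B r0 z (M i)" and
    lipL: "\<And>z w. z \<in> Z \<Longrightarrow> w \<in> Z \<Longrightarrow> lipschitz_at B r0 z (L w)" by (rule uniform_constants) (blast intro: that)
  define n where "n = real (card Z)"
  define \<Lambda> where "\<Lambda> = 16 * (n + 1) * B\<^sup>2"
  have n: "n \<ge> 0" by (simp add: n_def)
  have B2: "B \<le> B\<^sup>2" using B by (simp add: power2_eq_square)
  have \<Lambda>: "\<Lambda> \<ge> 16 * (n * B\<^sup>2)" "\<Lambda> \<ge> 1" "\<Lambda> \<ge> B"
  proof -
    have "n * B\<^sup>2 \<ge> 0" using n by simp
    moreover have "\<Lambda> = 16 * (n * B\<^sup>2) + 16 * B\<^sup>2" by (simp add: \<Lambda>_def distrib_right)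
    ultimately show "\<Lambda> \<ge> 16 * (n * B\<^sup>2)" "\<Lambda> \<ge> 1" "\<Lambda> \<ge> B"
      using B B2 by linarith+
  qed
  define \<epsilon> where "\<epsilon> = 1 / (16 * \<Lambda> * B)"
  have \<epsilon>: "\<epsilon> > 0" "\<epsilon> * \<Lambda> * B = 1 / 16" using \<Lambda>(2) B by (auto simp: \<epsilon>_def)
  have "\<forall>z. \<exists>r>0. \<forall>x\<in>ball z r. \<forall>y\<in>ball z r.
    norm (grad g x - grad g y - hess g z (x - y)) \<le> \<epsilon> * norm (x - y)"
    using grad_strict[OF g_polyfn] \<epsilon>(1) by simp
  from choice[OF this] obtain \<rho>1 where "\<forall>z. \<rho>1 z > 0 \<and> (\<forall>x\<in>ball z (\<rho>1 z). \<forall>y\<in>ball z (\<rho>1 z).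
    norm (grad g x - grad g y - hess g z (x - y)) \<le> \<epsilon> * norm (x - y))" by (rule exE)
  then have \<rho>1: "\<And>z. \<rho>1 z > 0" "\<And>z x y. x \<in> ball z (\<rho>1 z) \<Longrightarrow> y \<in> ball z (\<rho>1 z) \<Longrightarrow>
    norm (grad g x - grad g y - hess g z (x - y)) \<le> \<epsilon> * norm (x - y)" by auto
  have "\<forall>z. \<exists>r>0. \<forall>x\<in>ball z r. \<forall>y\<in>ball z r.
    norm (g x - g y - (\<Sum>j\<in>UNIV. grad g z $ j * (x - y) $ j)) \<le> \<epsilon> * norm (x - y)"
    using polyfn_strict[OF g_polyfn] \<epsilon>(1) by simp
  from choice[OF this] obtain \<rho>2 where "\<forall>z. \<rho>2 z > 0 \<and> (\<forall>x\<in>ball z (\<rho>2 z). \<forall>y\<in>ball z (\<rho>2 z).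
    norm (g x - g y - (\<Sum>j\<in>UNIV. grad g z $ j * (x - y) $ j)) \<le> \<epsilon> * norm (x - y))" by (rule exE)
  then have \<rho>2: "\<And>z. \<rho>2 z > 0" "\<And>z x y. x \<in> ball z (\<rho>2 z) \<Longrightarrow> y \<in> ball z (\<rho>2 z) \<Longrightarrow>
    norm (g x - g y - (\<Sum>j\<in>UNIV. grad g z $ j * (x - y) $ j)) \<le> \<epsilon> * norm (x - y)" by auto
  define r where "r = Min (insert r0 (\<rho>1 ` Z \<union> \<rho>2 ` Z))"
  have r: "r > 0" "r \<le> r0" "\<And>z. z \<in> Z \<Longrightarrow> r \<le> \<rho>1 z" "\<And>z. z \<in> Z \<Longrightarrow> r \<le> \<rho>2 z"
    using finite_Z r0 \<rho>1(1) \<rho>2(1) by (auto simp: r_def)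
  \<comment> \<open>The radius of the ball of iterates: the three bounds keep the positions in the region of the
    estimates, keep them within \<open>\<eta>\<close>, and make all terms quadratic in the unknowns small.\<close>
  define \<rho> where "\<rho> = min (min (r / (2 * \<Lambda>)) (\<eta> / (2 * \<Lambda>))) (1 / (32 * (n + 1) * B * \<Lambda>))"
  have \<rho>: "\<rho> > 0" using r(1) assms \<Lambda>(2) B n by (auto simp: \<rho>_def)
  have \<rho>r: "\<Lambda> * \<rho> < r"
  proof -
    have "\<Lambda> * \<rho> \<le> \<Lambda> * (r / (2 * \<Lambda>))" using \<Lambda>(2) by (intro mult_left_mono) (auto simp: \<rho>_def)
    also have "\<dots> < r" using \<Lambda>(2) r(1) by simp
    finally show ?thesis .
  qed
  have \<rho>\<eta>: "\<Lambda> * \<rho> < \<eta>"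
  proof -
    have "\<Lambda> * \<rho> \<le> \<Lambda> * (\<eta> / (2 * \<Lambda>))" using \<Lambda>(2) by (intro mult_left_mono) (auto simp: \<rho>_def)
    also have "\<dots> < \<eta>" using \<Lambda>(2) assms by simp
    finally show ?thesis .
  qed
  have \<rho>n: "n * \<rho> * B * \<Lambda> \<le> 1 / 32"
  proof -
    have "n * \<rho> * B * \<Lambda> \<le> (n + 1) * (1 / (32 * (n + 1) * B * \<Lambda>)) * B * \<Lambda>"
      using n B \<Lambda>(2) \<rho> by (intro mult_right_mono mult_mono) (auto simp: \<rho>_def)
    also have "\<dots> = 1 / 32" using n B \<Lambda>(2) by simp
    finally show ?thesis .
  qed
  define \<sigma> where "\<sigma> = min (1 / (32 * B * \<Lambda>)) (\<rho> / (4 * B))"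
  have \<sigma>: "\<sigma> > 0" using \<rho> B \<Lambda>(2) by (auto simp: \<sigma>_def)
  have \<sigma>1: "\<sigma> * B * \<Lambda> \<le> 1 / 32"
  proof -
    have "\<sigma> * B * \<Lambda> \<le> (1 / (32 * B * \<Lambda>)) * B * \<Lambda>"
      using B \<Lambda>(2) by (intro mult_right_mono) (auto simp: \<sigma>_def)
    also have "\<dots> = 1 / 32" using B \<Lambda>(2) by simp
    finally show ?thesis .
  qed
  have \<sigma>2: "\<sigma> * B \<le> \<rho> / 4"
  proof -
    have "\<sigma> * B \<le> (\<rho> / (4 * B)) * B" using B by (intro mult_right_mono) (auto simp: \<sigma>_def)
    then show ?thesis using B by simp
  qed
  have "\<exists>c q. \<forall>z\<in>Z. norm (c z) < \<eta> \<and> norm (q z - z) < \<eta> \<and>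
       perturbed \<theta> c (q z) = 0 \<and> grad (perturbed \<theta> c) (q z) = 0"
    if \<theta>: "(\<Sum>i\<in>A. norm (\<theta> i)) \<le> \<sigma>" for \<theta>
  proof -
    define Q where "Q x z = z + \<Lambda> *\<^sub>R fst (x z)" for x :: "complex^3 \<Rightarrow> (complex^3) \<times> complex" and z
    define K where "K x = perturbed \<theta> (\<lambda>z. snd (x z))" for x :: "complex^3 \<Rightarrow> (complex^3) \<times> complex"
    define T where "T x z = (fst (x z) - (1 / \<Lambda>) *\<^sub>R J z (grad (K x) (Q x z)), snd (x z) - K x (Q x z))" for x z
    define x0 where "x0 = (\<lambda>z :: complex^3. (0, 0) :: (complex^3) \<times> complex)"
    have nfst: "norm (fst p) \<le> norm p" and nsnd: "norm (snd p) \<le> norm p" for p :: "(complex^3) \<times> complex"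
      using norm_fst_le[of "fst p" "snd p"] norm_snd_le[of "snd p" "fst p"] by simp_all
    have dist_parts: "norm (fst p - fst p') \<le> dist p p'" "norm (snd p - snd p') \<le> dist p p'"
      for p p' :: "(complex^3) \<times> complex"
      using nfst[of "p - p'"] nsnd[of "p - p'"] by (simp_all add: dist_norm)
    have x0_parts: "norm (fst (x z)) \<le> \<rho>" "norm (snd (x z)) \<le> \<rho>" if "\<forall>z\<in>Z. dist (x z) (x0 z) \<le> \<rho>" "z \<in> Z" for x z
      using order_trans[OF dist_parts(1)[of "x z" "x0 z"]] order_trans[OF dist_parts(2)[of "x z" "x0 z"]] that
      by (auto simp: x0_def)
    have Q_ball: "Q x z \<in> ball z r" if "\<forall>z\<in>Z. dist (x z) (x0 z) \<le> \<rho>" "z \<in> Z" for x z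
    proof -
      have "norm (fst (x z)) \<le> \<rho>"
        using x0_parts that by blast
      then have "\<Lambda> * norm (fst (x z)) \<le> \<Lambda> * \<rho>" using \<Lambda>(2) by (intro mult_left_mono) auto
      then have "\<Lambda> * norm (fst (x z)) < r" using \<rho>r by simp
      then show ?thesis using \<rho>r \<Lambda>(2) by (simp add: Q_def dist_norm)
    qed
    have snd_le: "(\<Sum>z\<in>Z. norm (snd (x z))) \<le> n * \<rho>" if "\<forall>z\<in>Z. dist (x z) (x0 z) \<le> \<rho>" for x
    proof -
      have "(\<Sum>z\<in>Z. norm (snd (x z))) \<le> (\<Sum>z\<in>Z. \<rho>)"
        using x0_parts that by (intro sum_mono) blast
      then show ?thesis by (simp add: n_def)
    qed
    have pair: "dist a b \<le> norm (fst a - fst b) + norm (snd a - snd b)" for a b :: "(complex^3) \<times> complex"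
      using norm_Pair_le[of "fst a - fst b" "snd a - snd b"] by (simp add: dist_norm minus_prod_def)
    have contr: "\<forall>z\<in>Z. dist (T x z) (T y z) \<le> e / 2"
      if x: "\<forall>z\<in>Z. dist (x z) (x0 z) \<le> \<rho>" and y: "\<forall>z\<in>Z. dist (y z) (x0 z) \<le> \<rho>"
        and xy: "\<forall>z\<in>Z. dist (x z) (y z) \<le> e" for x y e
    proof
      fix z assume z: "z \<in> Z"
      let ?q = "Q x z" and ?q' = "Q y z" and ?c = "\<lambda>w. snd (x w)" and ?c' = "\<lambda>w. snd (y w)"
      have e: "e \<ge> 0" using xy z zero_le_dist order_trans by blast
      have qb: "?q \<in> ball z r" "?q' \<in> ball z r" using Q_ball x y z by auto
      have qb0: "?q \<in> ball z r0" "?q' \<in> ball z r0" using qb r(2) by auto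
      have zb: "z \<in> ball z r0" using r0 by simp
      have dq: "norm (?q - ?q') \<le> \<Lambda> * e"
      proof -
        have "norm (fst (x z) - fst (y z)) \<le> e"
          using xy z dist_parts(1)[of "x z" "y z"] by fastforce
        then have "\<Lambda> * norm (fst (x z) - fst (y z)) \<le> \<Lambda> * e" using \<Lambda>(2) by simp
        then show ?thesis using \<Lambda>(2) by (simp add: Q_def scaleR_diff_right[symmetric])
      qed
      have qz: "norm (?q' - z) \<le> \<Lambda> * \<rho>"
      proof -
        have "norm (fst (y z)) \<le> \<rho>"
          using x0_parts y z by blast
        then show ?thesis using \<Lambda>(2) by (simp add: Q_def)
      qed
      have dc: "(\<Sum>w\<in>Z. norm (?c w - ?c' w)) \<le> n * e"
      proof -
        have "(\<Sum>w\<in>Z. norm (?c w - ?c' w)) \<le> (\<Sum>w\<in>Z. e)"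
          using xy by (intro sum_mono order_trans[OF dist_parts(2)]) blast
        then show ?thesis by (simp add: n_def)
      qed
      define sp where "sp = (\<sigma> + n * \<rho>) * B * (\<Lambda> * e)"
      have sp: "sp \<le> e / 16"
      proof -
        have "sp = (\<sigma> * B * \<Lambda> + n * \<rho> * B * \<Lambda>) * e" by (simp add: sp_def algebra_simps)
        also have "\<dots> \<le> (1 / 32 + 1 / 32) * e" using \<sigma>1 \<rho>n e by (intro mult_right_mono add_mono)
        finally show ?thesis by simp
      qed
      have pert: "(\<Sum>i\<in>A. norm (\<theta> i)) * B * norm (?q - ?q') + (\<Sum>w\<in>Z. norm (?c w)) * B * norm (?q - ?q') \<le> sp"
      proof -
        have "(\<Sum>i\<in>A. norm (\<theta> i)) * B * norm (?q - ?q') \<le> \<sigma> * B * (\<Lambda> * e)"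
          using \<theta> B dq \<sigma> by (intro mult_mono) auto
        moreover have "(\<Sum>w\<in>Z. norm (?c w)) * B * norm (?q - ?q') \<le> n * \<rho> * B * (\<Lambda> * e)"
          using snd_le[OF x] B dq \<rho> n by (intro mult_mono) auto
        ultimately show ?thesis by (simp add: sp_def distrib_right)
      qed
      have 1: "norm (fst (T x z) - fst (T y z)) \<le> e / 4"
      proof -
        let ?R = "grad g ?q - grad g ?q' - hess g z (?q - ?q')"
        let ?D = "\<Sum>i\<in>A. \<theta> i *s (grad (M i) ?q - grad (M i) ?q')"
        let ?E = "\<Sum>w\<in>Z. ?c w *s (grad (L w) ?q - grad (L w) ?q')"
        let ?F = "\<Sum>w\<in>Z. (?c w - ?c' w) *s grad (L w) ?q'"
        have gK: "grad (K x) ?q - grad (K y) ?q' = hess g z (?q - ?q') + (?R + ?D + ?E + ?F)"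
          unfolding K_def grad_perturbed
          by (simp add: vec_eq_iff sum_subtractf algebra_simps)
        have "fst (T x z) - fst (T y z) = (1 / \<Lambda>) *\<^sub>R (?q - ?q') - (1 / \<Lambda>) *\<^sub>R (J z (grad (K x) ?q - grad (K y) ?q'))"
        proof -
          have "(1 / \<Lambda>) *\<^sub>R (?q - ?q') = fst (x z) - fst (y z)"
            using \<Lambda>(2) by (simp add: Q_def scaleR_diff_right[symmetric])
          then show ?thesis
            unfolding T_def linear_diff[OF J(1)[OF z]] fst_conv by (simp only: scaleR_diff_right) simp
        qed
        also have "\<dots> = - ((1 / \<Lambda>) *\<^sub>R J z (?R + ?D + ?E + ?F))"
          unfolding gK linear_add[OF J(1)[OF z], of "hess g z (?q - ?q')"] J(2)[OF z] by (simp add: algebra_simps)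
        finally have "norm (fst (T x z) - fst (T y z)) = 1 / \<Lambda> * norm (J z (?R + ?D + ?E + ?F))"
          using \<Lambda>(2) by simp
        also have "\<dots> \<le> 1 / \<Lambda> * (B * norm (?R + ?D + ?E + ?F))"
          using \<Lambda>(2) J(4)[OF z] by (intro mult_left_mono) auto
        also have "\<dots> \<le> 1 / \<Lambda> * (B * (\<epsilon> * (\<Lambda> * e) + sp + n * e * B))"
        proof -
          have "norm ?R \<le> \<epsilon> * norm (?q - ?q')" by (rule \<rho>1(2)) (use qb r(3)[OF z] in auto)
          also have "\<dots> \<le> \<epsilon> * (\<Lambda> * e)" using dq \<epsilon>(1) by simp
          finally have R: "norm ?R \<le> \<epsilon> * (\<Lambda> * e)" .
          have D: "norm ?D \<le> (\<Sum>i\<in>A. norm (\<theta> i)) * B * norm (?q - ?q')"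
            by (rule lipschitz_at_combination) (use lipM z qb0 in auto)
          have E: "norm ?E \<le> (\<Sum>w\<in>Z. norm (?c w)) * B * norm (?q - ?q')"
            by (rule lipschitz_at_combination) (use lipL z qb0 in auto)
          have "norm ?F \<le> (\<Sum>w\<in>Z. norm (?c w - ?c' w)) * B"
            by (rule lipschitz_at_combination) (use lipL z qb0 in auto)
          also have "\<dots> \<le> n * e * B" using dc B by (intro mult_right_mono) auto
          finally have F: "norm ?F \<le> n * e * B" .
          have "norm (?R + ?D + ?E + ?F) \<le> norm ?R + norm ?D + norm ?E + norm ?F"
            by (intro norm_triangle_le add_mono order_refl)
          with R D E F pert have "norm (?R + ?D + ?E + ?F) \<le> \<epsilon> * (\<Lambda> * e) + sp + n * e * B" by linarith
          then show ?thesis using B \<Lambda>(2) by (intro mult_left_mono) auto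
        qed
        also have "\<dots> = (\<epsilon> * \<Lambda> * B) * e / \<Lambda> + B / \<Lambda> * sp + (n * B\<^sup>2) / \<Lambda> * e"
          using \<Lambda>(2) by (simp add: field_simps power2_eq_square)
        also have "\<dots> \<le> e / 16 + e / 16 + e / 16"
        proof (intro add_mono)
          show "(\<epsilon> * \<Lambda> * B) * e / \<Lambda> \<le> e / 16" unfolding \<epsilon>(2) using \<Lambda>(2) mult_right_mono[OF \<Lambda>(2) e] by (simp add: field_simps)
          have "0 \<le> sp" using \<sigma> n \<rho> B \<Lambda>(2) e by (simp add: sp_def)
          then have "B / \<Lambda> * sp \<le> 1 * sp" using B \<Lambda>(2,3) by (intro mult_right_mono) auto
          with sp show "B / \<Lambda> * sp \<le> e / 16" by linarith
          have "(n * B\<^sup>2) / \<Lambda> \<le> 1 / 16" using \<Lambda>(1,2) by (simp add: field_simps)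
          from mult_right_mono[OF this e] show "(n * B\<^sup>2) / \<Lambda> * e \<le> e / 16" by simp
        qed
        also have "\<dots> \<le> e / 4" using e by simp
        finally show ?thesis .
      qed
      \<comment> \<open>In the second component the linear parts cancel, because \<open>L\<close> interpolates and \<open>g\<close> is critical at \<open>z\<close>.\<close>
      have 2: "norm (snd (T x z) - snd (T y z)) \<le> e / 4"
      proof -
        let ?R = "g ?q - g ?q'"
        let ?D = "\<Sum>i\<in>A. \<theta> i * (M i ?q - M i ?q')"
        let ?E = "\<Sum>w\<in>Z. ?c w * (L w ?q - L w ?q')"
        let ?F = "\<Sum>w\<in>Z. (?c w - ?c' w) * (L w ?q' - L w z)"
        have "(\<Sum>w\<in>Z. (?c w - ?c' w) * L w z) = (\<Sum>w\<in>{z}. (?c w - ?c' w) * L w z)"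
          by (rule sum.mono_neutral_right) (use finite_Z z L_interpolates in auto)
        then have Lz: "(\<Sum>w\<in>Z. (?c w - ?c' w) * L w z) = ?c z - ?c' z" using L_interpolates z by simp
        have gK: "K x ?q - K y ?q' = (?c z - ?c' z) + (?R + ?D + ?E + ?F)"
          unfolding K_def perturbed_def Lz[symmetric]
          by (simp add: sum_subtractf sum.distrib algebra_simps)
        have "snd (T x z) - snd (T y z) = (?c z - ?c' z) - (K x ?q - K y ?q')"
          by (simp add: T_def)
        then have "snd (T x z) - snd (T y z) = - (?R + ?D + ?E + ?F)"
          unfolding gK by simp
        then have "norm (snd (T x z) - snd (T y z)) = norm (?R + ?D + ?E + ?F)"
          by (simp only: norm_minus_cancel)
        also have "\<dots> \<le> \<epsilon> * (\<Lambda> * e) + sp + n * e * B * (\<Lambda> * \<rho>)"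
        proof -
          have "norm ?R \<le> \<epsilon> * norm (?q - ?q')"
            using \<rho>2(2)[of ?q z ?q'] qb r(4)[OF z] g_sing(2)[OF z] by auto
          also have "\<dots> \<le> \<epsilon> * (\<Lambda> * e)" using dq \<epsilon>(1) by simp
          finally have R: "norm ?R \<le> \<epsilon> * (\<Lambda> * e)" .
          have D: "norm ?D \<le> (\<Sum>i\<in>A. norm (\<theta> i)) * B * norm (?q - ?q')"
            by (rule lipschitz_at_combination) (use lipM z qb0 in auto)
          have E: "norm ?E \<le> (\<Sum>w\<in>Z. norm (?c w)) * B * norm (?q - ?q')"
            by (rule lipschitz_at_combination) (use lipL z qb0 in auto)
          have "norm ?F \<le> (\<Sum>w\<in>Z. norm (?c w - ?c' w)) * B * norm (?q' - z)"
            by (rule lipschitz_at_combination) (use lipL z qb0 zb in auto)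
          also have "\<dots> \<le> n * e * B * (\<Lambda> * \<rho>)" using dc B qz n e by (intro mult_mono) auto
          finally have F: "norm ?F \<le> n * e * B * (\<Lambda> * \<rho>)" .
          have "norm (?R + ?D + ?E + ?F) \<le> norm ?R + norm ?D + norm ?E + norm ?F"
            by (intro norm_triangle_le add_mono order_refl)
          with R D E F pert show ?thesis by linarith
        qed
        also have "\<dots> \<le> e / 16 + e / 16 + e / 32"
        proof (intro add_mono sp)
          have "\<epsilon> * \<Lambda> * 1 \<le> \<epsilon> * \<Lambda> * B" using \<epsilon>(1) \<Lambda>(2) B by (intro mult_left_mono) auto
          with \<epsilon>(2) have "\<epsilon> * \<Lambda> \<le> 1 / 16" by simp
          from mult_right_mono[OF this e] show "\<epsilon> * (\<Lambda> * e) \<le> e / 16" by (simp add: mult.assoc)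
          from mult_right_mono[OF \<rho>n e] show "n * e * B * (\<Lambda> * \<rho>) \<le> e / 32" by (simp add: mult_ac)
        qed
        also have "\<dots> \<le> e / 4" using e by simp
        finally show ?thesis .
      qed
      show "dist (T x z) (T y z) \<le> e / 2" using pair[of "T x z" "T y z"] 1 2 by simp
    qed
    have init: "\<forall>z\<in>Z. dist (T x0 z) (x0 z) \<le> \<rho> / 2"
    proof
      fix z assume z: "z \<in> Z"
      have zb: "z \<in> ball z r0" using r0 by simp
      have K0: "K x0 = (\<lambda>v. perturbed \<theta> (\<lambda>_. 0) v)" by (simp add: K_def x0_def)
      have "norm (K x0 z) \<le> (\<Sum>i\<in>A. norm (\<theta> i)) * B"
        unfolding K0 using lipschitz_at_combination(3)[of A B r0 z M z z \<theta>] lipM z zb g_sing(1)[OF z]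
        by (simp add: perturbed_def)
      also have le: "\<dots> \<le> \<sigma> * B" using \<theta> B by (intro mult_right_mono) auto
      finally have k1: "norm (K x0 z) \<le> \<rho> / 4" using \<sigma>2 by simp
      have "norm (grad (K x0) z) \<le> (\<Sum>i\<in>A. norm (\<theta> i)) * B"
        unfolding K0 using lipschitz_at_combination(4)[of A B r0 z M z z \<theta>] lipM z zb g_sing(2)[OF z]
        by (simp add: grad_perturbed)
      then have k2: "norm (grad (K x0) z) \<le> \<rho> / 4" using \<sigma>2 le by simp
      have "1 / \<Lambda> * norm (J z (grad (K x0) z)) \<le> 1 / \<Lambda> * (B * (\<rho> / 4))"
        using order_trans[OF J(4)[OF z, of "grad (K x0) z"] mult_left_mono[OF k2, of B]] B \<Lambda>(2)
        by (intro mult_left_mono) auto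
      also have "\<dots> = B / \<Lambda> * (\<rho> / 4)" by simp
      also have "\<dots> \<le> 1 * (\<rho> / 4)" using B \<Lambda>(2,3) \<rho> by (intro mult_right_mono) auto
      finally have k3: "1 / \<Lambda> * norm (J z (grad (K x0) z)) \<le> \<rho> / 4" by simp
      have Qz: "Q x0 z = z" by (simp add: Q_def x0_def)
      have "dist (T x0 z) (x0 z) \<le> 1 / \<Lambda> * norm (J z (grad (K x0) z)) + norm (K x0 z)"
        using pair[of "T x0 z" "x0 z"] \<Lambda>(2) unfolding T_def Qz by (simp add: x0_def)
      with k1 k3 show "dist (T x0 z) (x0 z) \<le> \<rho> / 2" by linarith
    qed
    have "\<exists>x. (\<forall>z\<in>Z. dist (x z) (x0 z) \<le> \<rho>) \<and> (\<forall>z\<in>Z. T x z = x z)"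
    proof (rule contraction_fixed_point)
      show "0 \<le> \<rho>" using \<rho> by simp
    qed (fact contr init)+
    then obtain x where x: "\<forall>z\<in>Z. dist (x z) (x0 z) \<le> \<rho>" "\<forall>z\<in>Z. T x z = x z" by blast
    have "norm (snd (x z)) < \<eta> \<and> norm (Q x z - z) < \<eta> \<and> K x (Q x z) = 0 \<and> grad (K x) (Q x z) = 0"
      if z: "z \<in> Z" for z
    proof -
      have b: "norm (x z) \<le> \<rho>" using x(1) z by (auto simp: x0_def dist_norm zero_prod_def[symmetric])
      have "norm (snd (x z)) \<le> \<rho>" "norm (fst (x z)) \<le> \<rho>"
        using nfst[of "x z"] nsnd[of "x z"] b by linarith+
      moreover have "\<rho> \<le> \<Lambda> * \<rho>" using \<Lambda>(2) \<rho> by simp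
      moreover have "norm (Q x z - z) = \<Lambda> * norm (fst (x z))" using \<Lambda>(2) by (simp add: Q_def)
      moreover have "\<Lambda> * norm (fst (x z)) \<le> \<Lambda> * \<rho>" using \<Lambda>(2) calculation(2) by simp
      moreover have eqs: "fst (x z) - (1 / \<Lambda>) *\<^sub>R J z (grad (K x) (Q x z)) = fst (x z)" "snd (x z) - K x (Q x z) = snd (x z)"
        using x(2) z by (simp_all add: T_def prod_eq_iff)
      moreover have "grad (K x) (Q x z) = 0" using eqs(1) \<Lambda>(2) J(3)[OF z] by simp
      ultimately show ?thesis using \<rho>\<eta> by auto
    qed
    then show ?thesis unfolding K_def by (intro exI[of _ "\<lambda>z. snd (x z)"] exI[of _ "Q x"]) blast
  qed
  with \<sigma> show ?thesis by blast
qed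

end

section \<open>Affine surfaces with many nodes and diagonal leading form\<close>

definition linear_factors :: "nat \<Rightarrow> complex poly" where
  "linear_factors n = (\<Prod>i<n. [:- of_nat i, 1:])"

lemma degree_linear_factors [simp]: "degree (linear_factors n) = n"
  by (simp add: linear_factors_def degree_prod_sum_eq)

lemma lead_coeff_linear_factors: "lead_coeff (linear_factors n) = 1"
  unfolding linear_factors_def by (subst lead_coeff_prod) auto

lemma poly_linear_factors: "poly (linear_factors n) x = 0 \<longleftrightarrow> x \<in> of_nat ` {..<n}"
  by (auto simp: linear_factors_def poly_prod)

lemma pderiv_linear_factors:
  assumes "poly (linear_factors n) x = 0" shows "poly (pderiv (linear_factors n)) x \<noteq> 0"
proof -
  from assms obtain i where i: "i < n" "x = of_nat i" by (auto simp: poly_linear_factors)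
  define Q where "Q = (\<Prod>j\<in>{..<n} - {i}. [:- of_nat j, 1:] :: complex poly)"
  have "linear_factors n = [:- of_nat i, 1:] * Q"
    unfolding linear_factors_def Q_def by (rule prod.remove) (use i in auto)
  then have "poly (pderiv (linear_factors n)) x = poly Q x"
    unfolding \<open>linear_factors n = _\<close> pderiv_mult using i by (simp add: pderiv_pCons del: mult_pCons_left)
  also have "\<dots> \<noteq> 0" using i by (auto simp: Q_def poly_prod)
  finally show ?thesis .
qed

text \<open>
  The roots \<open>0, ..., n - 1\<close> occur in both factors and are double; the others are simple.
\<close>
definition double_root_poly :: "nat \<Rightarrow> nat \<Rightarrow> complex poly" where
  "double_root_poly m n = linear_factors n * linear_factors (m - n)"

text \<open>
  Write \<open>p = S R\<close>, where every root of \<open>S\<close> is a root of \<open>R\<close> and both have simple roots. At a root of \<open>R\<close>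
  the derivative of \<open>p\<close> is \<open>S R'\<close>, which vanishes only with \<open>S\<close>, and there \<open>p'' = 2 S' R' \<noteq> 0\<close>.
\<close>

lemma double_root_poly:
  assumes "2 * n \<le> m"
  shows "poly (double_root_poly m n) x = 0 \<and> poly (pderiv (double_root_poly m n)) x = 0 \<longleftrightarrow> x \<in> of_nat ` {..<n}"
    and "x \<in> of_nat ` {..<n} \<Longrightarrow> poly (pderiv (pderiv (double_root_poly m n))) x \<noteq> 0"
    and "degree (double_root_poly m n) = m" "lead_coeff (double_root_poly m n) = 1"
proof -
  let ?S = "linear_factors n" and ?R = "linear_factors (m - n)"
  have nz: "?S \<noteq> 0" "?R \<noteq> 0" using lead_coeff_linear_factors[of n] lead_coeff_linear_factors[of "m - n"] by auto
  have SR: "poly ?R x = 0" if "poly ?S x = 0" for x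
    using that assms by (auto simp: poly_linear_factors)
  have p: "poly (double_root_poly m n) x = poly ?S x * poly ?R x" for x
    by (simp add: double_root_poly_def)
  have p': "poly (pderiv (double_root_poly m n)) x = poly ?S x * poly (pderiv ?R) x + poly ?R x * poly (pderiv ?S) x" for x
    by (simp add: double_root_poly_def pderiv_mult)
  show "poly (double_root_poly m n) x = 0 \<and> poly (pderiv (double_root_poly m n)) x = 0 \<longleftrightarrow> x \<in> of_nat ` {..<n}"
    unfolding poly_linear_factors[symmetric] p p'
    using SR[of x] pderiv_linear_factors[of "m - n" x] by auto
  show "poly (pderiv (pderiv (double_root_poly m n))) x \<noteq> 0" if "x \<in> of_nat ` {..<n}"
  proof -
    have S: "poly ?S x = 0" using that by (simp add: poly_linear_factors)
    then have "poly (pderiv (pderiv (double_root_poly m n))) x = 2 * (poly (pderiv ?S) x * poly (pderiv ?R) x)"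
      using SR[OF S] by (simp add: double_root_poly_def pderiv_mult pderiv_add algebra_simps)
    then show ?thesis using pderiv_linear_factors[OF S] pderiv_linear_factors[OF SR[OF S]] by simp
  qed
  show "degree (double_root_poly m n) = m"
    using nz assms by (simp add: double_root_poly_def degree_mult_eq)
  show "lead_coeff (double_root_poly m n) = 1"
    unfolding double_root_poly_def lead_coeff_mult lead_coeff_linear_factors by simp
qed

lemma polyfn_poly: "degree p \<le> N \<Longrightarrow> polyfn N (\<lambda>v. poly p (v $ j))"
  unfolding poly_altdef
  by (intro polyfn_sum polyfn_cmult polyfn_hform[OF hform_coord_power]) auto

lemma poly_nth_has_derivative:
  "((\<lambda>v. poly p (v $ j)) has_derivative (\<lambda>h. poly (pderiv p) (v $ j) * h $ j)) (at (v :: complex^3))"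
proof -
  have "((\<lambda>v::complex^3. v $ j) has_derivative (\<lambda>h. h $ j)) (at v)"
    by (rule bounded_linear_imp_has_derivative[OF bounded_linear_vec_nth])
  from has_derivative_compose[OF this poly_DERIV[unfolded has_field_derivative_def]]
  show ?thesis by (simp add: mult.commute)
qed

lemma grad_separable: "grad (\<lambda>v. \<Sum>j\<in>UNIV. poly (P j) (v $ j)) v = (\<chi> j. poly (pderiv (P j)) (v $ j))"
  by (rule grad_eqI) (intro has_derivative_sum poly_nth_has_derivative)

lemma hess_separable:
  "hess (\<lambda>v. \<Sum>j\<in>UNIV. poly (P j) (v $ j)) z h = (\<chi> j. poly (pderiv (pderiv (P j))) (z $ j) * h $ j)"
proof -
  have "grad (\<lambda>v. poly (pderiv (P j)) (v $ j)) z = (\<chi> l. if l = j then poly (pderiv (pderiv (P j))) (z $ j) else 0)" for j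
    by (rule grad_eqI, rule has_derivative_eq_rhs[OF poly_nth_has_derivative])
       (simp add: if_distrib[of "\<lambda>x. x * _"] cong: if_cong)
  then show ?thesis
    by (simp add: hess_def grad_separable vec_eq_iff if_distrib[of "\<lambda>x. x * _"] cong: if_cong)
qed

lemma card_vec_box:
  fixes A :: "'n::finite \<Rightarrow> 'b set"
  assumes "\<And>j. finite (A j)"
  shows "finite {v :: 'b^'n. \<forall>j. v $ j \<in> A j}" "card {v :: 'b^'n. \<forall>j. v $ j \<in> A j} = (\<Prod>j\<in>UNIV. card (A j))"
proof -
  have "bij_betw vec_nth {v :: 'b^'n. \<forall>j. v $ j \<in> A j} (PiE UNIV A)"
    by (rule bij_betwI[where g = vec_lambda]) (auto simp: vec_lambda_inverse)
  moreover have "finite (PiE UNIV A)" using assms by (simp add: finite_PiE)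
  ultimately show "finite {v :: 'b^'n. \<forall>j. v $ j \<in> A j}" "card {v :: 'b^'n. \<forall>j. v $ j \<in> A j} = (\<Prod>j\<in>UNIV. card (A j))"
    using assms by (auto simp: bij_betw_finite bij_betw_same_card card_PiE)
qed

definition nodal_model :: "nat \<Rightarrow> (complex^3 \<Rightarrow> complex) \<Rightarrow> (3 \<Rightarrow> complex) \<Rightarrow> (complex^3) set \<Rightarrow>
    (complex^3 \<Rightarrow> complex^3 \<Rightarrow> complex) \<Rightarrow> bool" where
  "nodal_model m g \<alpha> Z L \<longleftrightarrow> (\<forall>j. \<alpha> j \<noteq> 0) \<and> polyfn (m - 1) (\<lambda>v. g v - (\<Sum>j\<in>UNIV. \<alpha> j * v $ j ^ m)) \<and>
     finite Z \<and> (\<forall>v. g v = 0 \<and> grad g v = 0 \<longleftrightarrow> v \<in> Z) \<and> (\<forall>z\<in>Z. \<forall>h. hess g z h = 0 \<longrightarrow> h = 0) \<and>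
     (\<forall>w\<in>Z. polyfn (m - 1) (L w) \<and> (\<forall>z\<in>Z. L w z = of_bool (w = z)))"

text \<open>
  Each weight has to avoid \<open>0\<close> and finitely many quotients.
\<close>

lemma weights_without_cancellation:
  fixes V :: "3 \<Rightarrow> complex set"
  assumes "\<And>j. finite (V j)"
  shows "\<exists>\<alpha>. (\<forall>j. \<alpha> j \<noteq> 0) \<and> (\<forall>v. (\<forall>j. v j \<in> V j) \<longrightarrow> (\<Sum>j\<in>UNIV. \<alpha> j * v j) = 0 \<longrightarrow> (\<forall>j. v j = 0))"
proof -
  obtain b where b: "b \<notin> insert 0 ((\<lambda>(u, w). - u / w) ` (V 1 \<times> V 2))"
    using ex_new_if_finite[OF infinite_UNIV_char_0[where 'a = complex], of "insert 0 ((\<lambda>(u, w). - u / w) ` (V 1 \<times> V 2))"] assms by blast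
  obtain c where c: "c \<notin> insert 0 ((\<lambda>(u, w, t). - (u + b * w) / t) ` (V 1 \<times> V 2 \<times> V 3))"
    using ex_new_if_finite[OF infinite_UNIV_char_0[where 'a = complex], of "insert 0 ((\<lambda>(u, w, t). - (u + b * w) / t) ` (V 1 \<times> V 2 \<times> V 3))"] assms by blast
  define \<alpha> :: "3 \<Rightarrow> complex" where "\<alpha> j = (if j = 1 then 1 else if j = 2 then b else c)" for j
  have "\<forall>j. v j = 0" if v: "\<forall>j. v j \<in> V j" and s: "(\<Sum>j\<in>UNIV. \<alpha> j * v j) = 0" for v
  proof -
    have s': "v 1 + b * v 2 + c * v 3 = 0" using s by (simp add: sum_3 \<alpha>_def)
    have 3: "v 3 = 0"
    proof (rule ccontr)
      assume "v 3 \<noteq> 0"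
      then have "c = - (v 1 + b * v 2) / v 3" using s' by (simp add: field_simps eq_neg_iff_add_eq_0)
      then have "c = (\<lambda>(u, w, t). - (u + b * w) / t) (v 1, v 2, v 3)" by simp
      then show False using c v by blast
    qed
    have 2: "v 2 = 0"
    proof (rule ccontr)
      assume "v 2 \<noteq> 0"
      then have "b = - v 1 / v 2" using s' 3 by (simp add: field_simps eq_neg_iff_add_eq_0)
      then have "b = (\<lambda>(u, w). - u / w) (v 1, v 2)" by simp
      then show False using b v by blast
    qed
    show ?thesis unfolding forall_3 using s' 2 3 by simp
  qed
  then show ?thesis using b c by (intro exI[of _ \<alpha>]) (auto simp: \<alpha>_def)
qed

text \<open>
  A singular point of \<open>g\<close> has critical points of the three polynomials as coordinates. With weights that
  prevent a cancellation of the critical values it lies on the surface only if all three critical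
  values vanish, that is, only at the triples of double roots. Lagrange interpolation on this
  grid takes degree \<open>n 1 + n 2 + n 3 - 3\<close>, which is at most \<open>m - 1\<close>.
\<close>

lemma grid_model:
  fixes n :: "3 \<Rightarrow> nat"
  assumes n: "\<And>j. 1 \<le> n j" "\<And>j. 2 * n j \<le> m" "(\<Sum>j\<in>UNIV. n j) \<le> m + 2"
  shows "\<exists>g \<alpha> Z L. nodal_model m g \<alpha> Z L \<and> card Z = (\<Prod>j\<in>UNIV. n j)"
proof -
  define p where "p j = double_root_poly m (n j)" for j
  note p = double_root_poly[OF n(2), folded p_def]
  have m: "1 \<le> m" using n(1,2)[of 1] by simp
  define V where "V j = poly (p j) ` {x. poly (pderiv (p j)) x = 0}" for j
  have "pderiv (p j) \<noteq> 0" for j using p(3)[of j] m by (auto simp: pderiv_eq_0_iff)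
  then have fV: "finite (V j)" for j by (simp add: V_def poly_roots_finite)
  from weights_without_cancellation[of V, OF fV] obtain \<alpha> where "\<forall>j. \<alpha> j \<noteq> 0"
    "\<forall>v. (\<forall>j. v j \<in> V j) \<longrightarrow> (\<Sum>j\<in>UNIV. \<alpha> j * v j) = 0 \<longrightarrow> (\<forall>j. v j = 0)" by (elim exE conjE)
  then have \<alpha>: "\<And>j. \<alpha> j \<noteq> 0"
    "\<And>v j. (\<And>j. v j \<in> V j) \<Longrightarrow> (\<Sum>j\<in>UNIV. \<alpha> j * v j) = 0 \<Longrightarrow> v j = 0" by simp_all
  define P where "P j = smult (\<alpha> j) (p j)" for j
  define g where "g v = (\<Sum>j\<in>UNIV. poly (P j) (v $ j))" for v :: "complex^3"
  define A where "A j = (of_nat ` {..<n j} :: complex set)" for j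
  define Z where "Z = {v :: complex^3. \<forall>j. v $ j \<in> A j}"
  define L where "L w v = (\<Prod>j\<in>UNIV. \<Prod>i\<in>A j - {w $ j}. 1 / (w $ j - i) * (v $ j - i))" for w v :: "complex^3"
  have fA: "finite (A j)" for j by (simp add: A_def)
  have cA: "card (A j) = n j" for j by (simp add: A_def card_image inj_on_def)
  have gg: "grad g v = (\<chi> j. \<alpha> j * poly (pderiv (p j)) (v $ j))" for v
    unfolding g_def[abs_def] grad_separable by (simp add: P_def pderiv_smult)
  have gh: "hess g z h = (\<chi> j. \<alpha> j * poly (pderiv (pderiv (p j))) (z $ j) * h $ j)" for z h
    unfolding g_def[abs_def] hess_separable by (simp add: P_def pderiv_smult)
  have gv: "g v = (\<Sum>j\<in>UNIV. \<alpha> j * poly (p j) (v $ j))" for v by (simp add: g_def P_def)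
  have sing: "g v = 0 \<and> grad g v = 0 \<longleftrightarrow> v \<in> Z" for v
  proof
    assume gr: "g v = 0 \<and> grad g v = 0"
    then have cr: "poly (pderiv (p j)) (v $ j) = 0" for j using \<alpha>(1)[of j] by (auto simp: gg vec_eq_iff)
    then have "poly (p j) (v $ j) = 0" for j
      by (intro \<alpha>(2)[of "\<lambda>j. poly (p j) (v $ j)"]) (use gr in \<open>auto simp: V_def gv\<close>)
    with cr have "v $ j \<in> of_nat ` {..<n j}" for j using p(1)[of j "v $ j"] by blast
    then show "v \<in> Z" by (simp add: Z_def A_def)
  next
    assume "v \<in> Z"
    then have "poly (p j) (v $ j) = 0 \<and> poly (pderiv (p j)) (v $ j) = 0" for j
      using p(1)[of j "v $ j"] by (auto simp: Z_def A_def)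
    then show "g v = 0 \<and> grad g v = 0" by (simp add: gg gv vec_eq_iff)
  qed
  have "h = 0" if "z \<in> Z" "hess g z h = 0" for z h
  proof -
    have "poly (pderiv (pderiv (p j))) (z $ j) \<noteq> 0" for j
      using that(1) p(2)[of "z $ j" j] by (auto simp: Z_def A_def)
    then show ?thesis using that(2) \<alpha>(1) by (simp add: gh vec_eq_iff)
  qed
  moreover have "polyfn (m - 1) (\<lambda>v. g v - (\<Sum>j\<in>UNIV. \<alpha> j * v $ j ^ m))"
  proof -
    have "degree (p j - monom 1 m) \<le> m - 1" for j
    proof (rule degree_le, intro allI impI)
      fix i assume "m - 1 < i"
      then show "coeff (p j - monom 1 m) i = 0" using m p(3)[of j] p(4)[of j] coeff_eq_0[of "p j" i]
        by (cases "i = m") auto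
    qed
    then have "polyfn (m - 1) (\<lambda>v. \<Sum>j\<in>UNIV. \<alpha> j * poly (p j - monom 1 m) (v $ j))"
      by (intro polyfn_sum polyfn_cmult polyfn_poly)
    then show ?thesis by (simp add: gv poly_monom sum_subtractf[symmetric] right_diff_distrib)
  qed
  moreover have "polyfn (m - 1) (L w)" if "w \<in> Z" for w
  proof -
    have "polyfn (\<Sum>j\<in>UNIV. \<Sum>i\<in>A j - {w $ j}. 1) (L w)"
      unfolding L_def[abs_def]
      by (intro polyfn_prod polyfn_cmult polyfn_diff polyfn_coord polyfn_const) auto
    moreover have "(\<Sum>j\<in>UNIV. \<Sum>i\<in>A j - {w $ j}. 1) \<le> m - 1"
    proof -
      have "card (A j - {w $ j}) = n j - 1" for j using that cA fA by (simp add: Z_def)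
      then have "(\<Sum>j\<in>UNIV. \<Sum>i\<in>A j - {w $ j}. 1) = (\<Sum>j\<in>UNIV. n j - 1)" by simp
      then show ?thesis using n(3) n(1)[of 1] n(1)[of 2] n(1)[of 3] by (simp add: sum_3)
    qed
    ultimately show ?thesis by (rule polyfn_mono)
  qed
  moreover have "L w z = of_bool (w = z)" if "w \<in> Z" "z \<in> Z" for w z
  proof (cases "w = z")
    case True
    have "(\<Prod>i\<in>A j - {w $ j}. 1 / (w $ j - i) * (w $ j - i)) = 1" for j
      by (rule prod.neutral) auto
    then show ?thesis using True by (simp add: L_def)
  next
    case False
    then obtain j where j: "w $ j \<noteq> z $ j" by (auto simp: vec_eq_iff)
    then have "z $ j \<in> A j - {w $ j}" using that by (auto simp: Z_def)
    then have "(\<Prod>i\<in>A j - {w $ j}. 1 / (w $ j - i) * (z $ j - i)) = 0"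
      using fA by (intro prod_zero bexI[of _ "z $ j"]) auto
    then have "L w z = 0" unfolding L_def by (intro prod_zero[OF _ bexI[of _ j]]) simp_all
    then show ?thesis using False by simp
  qed
  moreover have "finite Z" "card Z = (\<Prod>j\<in>UNIV. n j)"
    using card_vec_box[of A, OF fA] cA by (simp_all add: Z_def)
  ultimately have "nodal_model m g \<alpha> Z L" unfolding nodal_model_def using \<alpha>(1) sing by blast
  with \<open>card Z = _\<close> show ?thesis by blast
qed

text \<open>
  A grid of nodes on a cubic consists of a single point, so \<open>m = 3\<close> needs another surface. The curve
  \<open>x^3 + y^3 - 3 x y\<close> has the critical value \<open>0\<close> at the origin and \<open>-1\<close> at the three points
  \<open>(u, u^2)\<close> with \<open>u^3 = 1\<close>. The polynomial \<open>2 z^3 - 3 z^2 + 1\<close> has the critical values \<open>1\<close> at \<open>0\<close> and \<open>0\<close> at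
  \<open>1\<close>. So critical values of the sum cancel at three points with \<open>z = 0\<close> and at one with \<open>z = 1\<close>. These four
  points are not coplanar, and affine functions interpolate on them.
\<close>

lemma cubic_model: "\<exists>g \<alpha> Z L. nodal_model 3 g \<alpha> Z L \<and> card Z = 4"
proof -
  define g :: "complex^3 \<Rightarrow> complex"
    where "g v = v $ 1 ^ 3 + v $ 2 ^ 3 - 3 * (v $ 1 * v $ 2) + 2 * v $ 3 ^ 3 - 3 * v $ 3 ^ 2 + 1" for v
  define \<alpha> :: "3 \<Rightarrow> complex" where "\<alpha> j = (if j = 3 then 2 else 1)" for j
  define node_at :: "complex \<Rightarrow> complex^3" where "node_at u = vector [u, u\<^sup>2, 0]" for u
  define apex :: "complex^3" where "apex = vector [0, 0, 1]"
  define U where "U = {u :: complex. u ^ 3 = 1}"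
  define Z where "Z = insert apex (node_at ` U)"
  define L :: "complex^3 \<Rightarrow> complex^3 \<Rightarrow> complex"
    where "L w v = (if w = apex then v $ 3 else 1 / 3 * (1 - v $ 3 + (w $ 2 * v $ 1 + w $ 1 * v $ 2)))" for w v
  have U: "finite U" "card U = 3" using card_roots_unity_eq[of 3] finite_roots_unity[of 3] by (auto simp: U_def)
  have nth: "((\<lambda>v::complex^3. v $ j) has_derivative (\<lambda>h. h $ j)) (at v)" for j v
    by (rule bounded_linear_imp_has_derivative[OF bounded_linear_vec_nth])
  have gg: "grad g v = vector [3 * v $ 1 ^ 2 - 3 * v $ 2, 3 * v $ 2 ^ 2 - 3 * v $ 1, 6 * v $ 3 ^ 2 - 6 * v $ 3]" for v
  proof -
    let ?D = "\<lambda>j. (vector [3 * v $ 1 ^ 2 - 3 * v $ 2, 3 * v $ 2 ^ 2 - 3 * v $ 1, 6 * v $ 3 ^ 2 - 6 * v $ 3] :: complex^3) $ j"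
    have "(g has_derivative (\<lambda>h. \<Sum>j\<in>UNIV. ?D j * h $ j)) (at v)"
      unfolding g_def[abs_def]
      by (rule derivative_eq_intros nth refl)+ (simp add: sum_3 algebra_simps power2_eq_square)
    from grad_eqI[OF this] show ?thesis by simp
  qed
  have g1: "grad (\<lambda>v. grad g v $ 1) z = vector [6 * z $ 1, -3, 0]" for z
  proof -
    have "((\<lambda>v. grad g v $ 1) has_derivative (\<lambda>h. \<Sum>j\<in>UNIV. (vector [6 * z $ 1, -3, 0] :: complex^3) $ j * h $ j)) (at z)"
      unfolding gg vector_3
      by (rule derivative_eq_intros nth refl)+ (simp add: sum_3 algebra_simps)
    from grad_eqI[OF this] show ?thesis by simp
  qed
  have g2: "grad (\<lambda>v. grad g v $ 2) z = vector [-3, 6 * z $ 2, 0]" for z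
  proof -
    have "((\<lambda>v. grad g v $ 2) has_derivative (\<lambda>h. \<Sum>j\<in>UNIV. (vector [-3, 6 * z $ 2, 0] :: complex^3) $ j * h $ j)) (at z)"
      unfolding gg vector_3
      by (rule derivative_eq_intros nth refl)+ (simp add: sum_3 algebra_simps)
    from grad_eqI[OF this] show ?thesis by simp
  qed
  have g3: "grad (\<lambda>v. grad g v $ 3) z = vector [0, 0, 12 * z $ 3 - 6]" for z
  proof -
    have "((\<lambda>v. grad g v $ 3) has_derivative (\<lambda>h. \<Sum>j\<in>UNIV. (vector [0, 0, 12 * z $ 3 - 6] :: complex^3) $ j * h $ j)) (at z)"
      unfolding gg vector_3
      by (rule derivative_eq_intros nth refl)+ (simp add: sum_3 algebra_simps)
    from grad_eqI[OF this] show ?thesis by simp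
  qed
  have gh: "hess g z h $ 1 = 6 * z $ 1 * h $ 1 - 3 * h $ 2" "hess g z h $ 2 = 6 * z $ 2 * h $ 2 - 3 * h $ 1"
    "hess g z h $ 3 = (12 * z $ 3 - 6) * h $ 3" for z h
    by (simp_all add: hess_def g1 g2 g3 sum_3)
  have Z_iff: "v \<in> Z \<longleftrightarrow> v $ 1 = 0 \<and> v $ 2 = 0 \<and> v $ 3 = 1 \<or> v $ 1 ^ 3 = 1 \<and> v $ 2 = v $ 1 ^ 2 \<and> v $ 3 = 0" for v
    by (auto simp: Z_def apex_def node_at_def U_def vec_eq_iff forall_3 image_iff)
  have sing: "g v = 0 \<and> grad g v = 0 \<longleftrightarrow> v \<in> Z" for v
  proof
    assume a: "g v = 0 \<and> grad g v = 0"
    then have e: "v $ 1 ^ 2 = v $ 2" "v $ 2 ^ 2 = v $ 1" "v $ 3 ^ 2 = v $ 3" by (simp_all add: gg vec_eq_iff forall_3)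
    have e3: "v $ 3 = 0 \<or> v $ 3 = 1" using e(3) by (auto simp: power2_eq_square)
    have c1: "v $ 1 ^ 3 = v $ 1 * v $ 2" "v $ 2 ^ 3 = v $ 1 * v $ 2"
      using e(1,2) by (simp_all add: power3_eq_cube power2_eq_square)
    have val: "1 - v $ 1 * v $ 2 = v $ 3" using a e3 by (auto simp: g_def c1 power2_eq_square)
    show "v \<in> Z"
    proof (cases "v $ 3 = 0")
      case True
      then show ?thesis using val c1 e by (simp add: Z_iff)
    next
      case False
      then have 3: "v $ 3 = 1" "v $ 1 * v $ 2 = 0" using e3 val by auto
      then have "v $ 1 = 0 \<and> v $ 2 = 0" using e by auto
      then show ?thesis using 3 by (simp add: Z_iff)
    qed
  next
    assume "v \<in> Z"
    then show "g v = 0 \<and> grad g v = 0" unfolding Z_iff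
    proof (elim disjE conjE)
      assume v: "v $ 1 ^ 3 = 1" "v $ 2 = v $ 1 ^ 2" "v $ 3 = 0"
      have "v $ 1 * v $ 2 = 1" "v $ 2 ^ 3 = 1" "v $ 2 ^ 2 = v $ 1"
      proof -
        show "v $ 1 * v $ 2 = 1" using v by (simp add: power3_eq_cube power2_eq_square mult.assoc)
        have "v $ 2 ^ 3 = (v $ 1 ^ 3) ^ 2" unfolding v(2) by (simp add: power_mult[symmetric] mult.commute)
        then show "v $ 2 ^ 3 = 1" using v(1) by simp
        have "v $ 2 ^ 2 = v $ 1 ^ 3 * v $ 1" unfolding v(2) by (simp add: power2_eq_square power3_eq_cube)
        then show "v $ 2 ^ 2 = v $ 1" using v(1) by simp
      qed
      with v show ?thesis by (simp add: g_def gg vec_eq_iff forall_3)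
    qed (simp add: g_def gg vec_eq_iff forall_3)
  qed
  have hess0: "h = 0" if z: "z \<in> Z" and h: "hess g z h = 0" for z h
  proof -
    have h': "6 * z $ 1 * h $ 1 - 3 * h $ 2 = 0" "6 * z $ 2 * h $ 2 - 3 * h $ 1 = 0" "(12 * z $ 3 - 6) * h $ 3 = 0"
      using h by (simp_all add: gh[symmetric])
    from z show ?thesis unfolding Z_iff
    proof (elim disjE conjE)
      assume v: "z $ 1 ^ 3 = 1" "z $ 2 = z $ 1 ^ 2" "z $ 3 = 0"
      have h2: "h $ 2 = 2 * z $ 1 * h $ 1" using h'(1) by (simp add: algebra_simps)
      have "6 * z $ 1 ^ 2 * (2 * z $ 1 * h $ 1) - 3 * h $ 1 = 0" using h'(2) unfolding v(2) h2 .
      moreover have "6 * z $ 1 ^ 2 * (2 * z $ 1 * h $ 1) = 12 * z $ 1 ^ 3 * h $ 1"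
        by (simp add: power2_eq_square power3_eq_cube)
      ultimately have "h $ 1 = 0" using v(1) by simp
      then show ?thesis using h'(3) h2 v(3) by (simp add: vec_eq_iff forall_3)
    qed (use h' in \<open>simp add: vec_eq_iff forall_3\<close>)
  qed
  have poly: "polyfn (3 - 1) (\<lambda>v. g v - (\<Sum>j\<in>UNIV. \<alpha> j * v $ j ^ 3))"
  proof -
    have "polyfn (1 + 1) (\<lambda>v. (-3) * (v $ 1 * v $ 2) + (-3) * (v $ 3 * v $ 3) + 1)"
      by (intro polyfn_add polyfn_cmult polyfn_mult polyfn_coord polyfn_const) auto
    moreover have "(\<lambda>v. (-3) * (v $ 1 * v $ 2) + (-3) * (v $ 3 * v $ 3) + 1) = (\<lambda>v. g v - (\<Sum>j\<in>UNIV. \<alpha> j * v $ j ^ 3))"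
      by (auto simp: fun_eq_iff g_def \<alpha>_def sum_3 power2_eq_square)
    ultimately show ?thesis by (simp add: numeral_2_eq_2)
  qed
  have L_poly: "polyfn (3 - 1) (L w)" for w
  proof (cases "w = apex")
    case True
    then show ?thesis unfolding L_def[abs_def] by (simp add: polyfn_coord)
  next
    case False
    have "polyfn 2 (\<lambda>v. 1 / 3 * (1 - v $ 3 + (w $ 2 * v $ 1 + w $ 1 * v $ 2)))"
      by (intro polyfn_add polyfn_diff polyfn_cmult polyfn_coord polyfn_const) auto
    then show ?thesis using False unfolding L_def[abs_def] by simp
  qed
  have L_val: "L w z = of_bool (w = z)" if w: "w \<in> Z" and z: "z \<in> Z" for w z
  proof (cases "w = apex")
    case True
    then show ?thesis using z by (auto simp: L_def Z_def apex_def node_at_def vec_eq_iff forall_3)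
  next
    case False
    then obtain u where u: "w = node_at u" "u ^ 3 = 1" using w by (auto simp: Z_def U_def)
    show ?thesis
    proof (cases "z = apex")
      case True
      then show ?thesis using False by (auto simp: L_def apex_def)
    next
      case nz: False
      then obtain s where s: "z = node_at s" "s ^ 3 = 1" using z by (auto simp: Z_def U_def)
      have L: "L w z = 1 / 3 * (1 + (u\<^sup>2 * s + u * s\<^sup>2))"
        using False by (simp add: L_def u(1) s(1)) (simp add: node_at_def)
      show ?thesis
      proof (cases "u = s")
        case True
        have "u\<^sup>2 * s + u * s\<^sup>2 = s ^ 3 + s ^ 3" unfolding True by (simp add: power2_eq_square power3_eq_cube)
        with L s(2) have "L w z = 1 / 3 * (1 + (1 + 1))" by (simp only:)
        then show ?thesis using u(1) s(1) True by simp
      next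
        case ne: False
        \<comment> \<open>Two different cube roots of unity satisfy \<open>u^2 s + u s^2 = -1\<close>.\<close>
        have "(u - s) * (u\<^sup>2 + u * s + s\<^sup>2) = u ^ 3 - s ^ 3" by (simp add: power2_eq_square power3_eq_cube algebra_simps)
        then have "u\<^sup>2 + u * s + s\<^sup>2 = 0" using ne u s by simp
        then have "s * (u\<^sup>2 + u * s + s\<^sup>2) = 0" by simp
        then have "u\<^sup>2 * s + u * s\<^sup>2 + s ^ 3 = 0" by (simp add: power2_eq_square power3_eq_cube algebra_simps)
        then have "L w z = 0" using L s(2) by (simp add: add.commute)
        moreover have "w \<noteq> z"
        proof
          assume "w = z"
          then have "w $ 1 = z $ 1" by simp
          then show False using ne by (simp add: u(1) s(1) node_at_def)
        qed
        ultimately show ?thesis by simp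
      qed
    qed
  qed
  have inj: "inj_on node_at U"
  proof (rule inj_onI)
    fix x y assume "node_at x = node_at y"
    then have "node_at x $ 1 = node_at y $ 1" by simp
    then show "x = y" by (simp add: node_at_def)
  qed
  have "apex \<notin> node_at ` U"
  proof
    assume "apex \<in> node_at ` U"
    then obtain u where "apex = node_at u" by blast
    then have "apex $ 3 = node_at u $ 3" by simp
    then show False by (simp add: apex_def node_at_def)
  qed
  then have "card Z = 4" "finite Z" using U inj by (simp_all add: Z_def card_image)
  moreover have "nodal_model 3 g \<alpha> Z L"
    unfolding nodal_model_def using \<open>finite Z\<close> sing hess0 poly L_poly L_val by (auto simp: \<alpha>_def)
  ultimately show ?thesis by blast
qed

lemma nodal_model_exists:
  assumes "1 < m" "\<delta> = (if 3 dvd m then (m div 3) * (m div 3 + 1)\<^sup>2 else (m div 3 + 1) ^ 3)"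
  shows "\<exists>g \<alpha> Z L. nodal_model m g \<alpha> Z L \<and> card Z = \<delta>"
proof (cases "m = 3")
  case True
  then have "\<delta> = 4" using assms(2) by (simp add: power2_eq_square)
  then show ?thesis using cubic_model True by simp
next
  case False
  define k where "k = m div 3"
  show ?thesis
  proof (cases "3 dvd m")
    case True
    then have m: "m = 3 * k" by (simp add: k_def)
    with assms(1) False have k: "k \<ge> 2" by auto
    define n :: "3 \<Rightarrow> nat" where "n j = (if j = 1 then k else k + 1)" for j
    have "\<exists>g \<alpha> Z L. nodal_model m g \<alpha> Z L \<and> card Z = (\<Prod>j\<in>UNIV. n j)"
      by (rule grid_model) (use m k in \<open>auto simp: n_def sum_3\<close>)
    moreover have "(\<Prod>j\<in>UNIV. n j) = \<delta>"
    proof -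
      have "\<delta> = k * (k + 1)\<^sup>2" using True assms(2) by (simp only: if_True k_def)
      moreover have "(\<Prod>j\<in>(UNIV :: 3 set). f j) = f 1 * (f 2 * f 3)" for f :: "3 \<Rightarrow> nat"
        unfolding UNIV_3 by simp
      ultimately show ?thesis by (simp only: n_def power2_eq_square) simp
    qed
    ultimately show ?thesis by simp
  next
    case ndvd: False
    then have m: "m = 3 * k + 1 \<or> m = 3 * k + 2" unfolding k_def by presburger
    with assms(1) have k: "2 * (k + 1) \<le> m" "3 * k \<le> m - 1" by presburger+
    have "\<exists>g \<alpha> Z L. nodal_model m g \<alpha> Z L \<and> card Z = (\<Prod>j\<in>(UNIV::3 set). k + 1)"
    proof (rule grid_model)
      show "(\<Sum>j\<in>(UNIV::3 set). k + 1) \<le> m + 2" using k(2) assms(1) by (simp add: sum_3)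
    qed (use k in simp_all)
    then show ?thesis using ndvd assms(2) by (simp add: k_def)
  qed
qed

section \<open>Singular points in an affine chart\<close>

lemma partial_deriv_forms:
  assumes "F \<in> forms I d" shows "partial_deriv i F \<in> forms I (d - 1)"
  unfolding partial_deriv_def
proof (rule forms_sum)
  fix e assume e: "e \<in> Poly_Mapping.keys F"
  then have eI: "Poly_Mapping.keys e \<subseteq> I" "total_degree e = d" using assms by (auto simp: forms_def monomials_def)
  show "Poly_Mapping.single (e - Poly_Mapping.single i 1) (of_nat (Poly_Mapping.lookup e i) * Poly_Mapping.lookup F e) \<in> forms I (d - 1)"
  proof (cases "Poly_Mapping.lookup e i = 0")
    case False
    have "e = (e - Poly_Mapping.single i 1) + Poly_Mapping.single i 1"
      using False by (intro poly_mapping_eqI) (auto simp: lookup_add lookup_minus lookup_single when_def)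
    then have "total_degree e = total_degree (e - Poly_Mapping.single i 1) + 1"
      by (metis total_degree_add total_degree_single)
    moreover have "Poly_Mapping.keys (e - Poly_Mapping.single i 1) \<subseteq> Poly_Mapping.keys e"
      by (auto simp: in_keys_iff lookup_minus)
    ultimately show ?thesis using eI by (auto simp: forms_def monomials_def)
  qed simp
qed

lemma proj_point_self: "a \<in> proj_point a"
  by (auto simp: proj_point_def intro: exI[of _ 1])

lemma proj_point_scale:
  assumes "c \<noteq> 0" shows "proj_point (\<lambda>i. c * a i) = proj_point a"
proof -
  have "\<exists>c'. (\<lambda>i. e * (c * a i)) = (\<lambda>i. c' * a i) \<and> c' \<noteq> 0" if "e \<noteq> 0" for e
    using that assms by (intro exI[of _ "e * c"]) (auto simp: mult.assoc)
  moreover have "\<exists>c'. (\<lambda>i. e * a i) = (\<lambda>i. c' * (c * a i)) \<and> c' \<noteq> 0" if "e \<noteq> 0" for e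
    using that assms by (intro exI[of _ "e / c"]) auto
  ultimately show ?thesis unfolding proj_point_def by auto
qed

lemma proj_space_point: "x \<in> proj_space I \<Longrightarrow> a \<in> x \<Longrightarrow> x = proj_point a \<and> (\<forall>i. i \<notin> I \<longrightarrow> a i = 0) \<and> (\<exists>i\<in>I. a i \<noteq> 0)"
proof -
  assume "x \<in> proj_space I" "a \<in> x"
  then obtain b where b: "x = proj_point b" "\<forall>i. i \<notin> I \<longrightarrow> b i = 0" "\<exists>i\<in>I. b i \<noteq> 0" by (auto simp: proj_space_def)
  with \<open>a \<in> x\<close> obtain c where "c \<noteq> 0" "a = (\<lambda>i. c * b i)" by (auto simp: proj_point_def)
  with b proj_point_scale[of c b] show ?thesis by auto
qed

lemma proj_point_in_space: "\<forall>i. i \<notin> I \<longrightarrow> a i = 0 \<Longrightarrow> \<exists>i\<in>I. a i \<noteq> 0 \<Longrightarrow> proj_point a \<in> proj_space I"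
  by (auto simp: proj_space_def)

lemma proj_point_in_singular_points:
  assumes "F \<in> forms I d" "\<forall>i. i \<notin> I \<longrightarrow> a i = 0" "\<exists>i\<in>I. a i \<noteq> 0"
  shows "proj_point a \<in> singular_points I F \<longleftrightarrow>
    eval_at a F = 0 \<and> (\<forall>i\<in>I. eval_at a (partial_deriv i F) = 0)"
proof
  assume "proj_point a \<in> singular_points I F"
  then show "eval_at a F = 0 \<and> (\<forall>i\<in>I. eval_at a (partial_deriv i F) = 0)"
    using proj_point_self[of a] by (auto simp: singular_points_def)
next
  assume *: "eval_at a F = 0 \<and> (\<forall>i\<in>I. eval_at a (partial_deriv i F) = 0)"
  have "eval_at b F = 0 \<and> (\<forall>i\<in>I. eval_at b (partial_deriv i F) = 0)" if "b \<in> proj_point a" for b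
  proof -
    from that obtain c where "b = (\<lambda>i. c * a i)" by (auto simp: proj_point_def)
    then show ?thesis using * by (simp add: eval_at_scale[OF assms(1)] eval_at_scale[OF partial_deriv_forms[OF assms(1)]])
  qed
  then show "proj_point a \<in> singular_points I F"
    using proj_point_in_space[OF assms(2,3)] by (auto simp: singular_points_def)
qed

lemma singular_point_representative:
  assumes "x \<in> singular_points I F" "a \<in> x"
  shows "x = proj_point a" "\<forall>i. i \<notin> I \<longrightarrow> a i = 0" "\<exists>i\<in>I. a i \<noteq> 0"
    "eval_at a F = 0" "\<And>i. i \<in> I \<Longrightarrow> eval_at a (partial_deriv i F) = 0"
  using assms proj_space_point[of x I a] by (auto simp: singular_points_def)

text \<open>Finite sets are Zariski closed: a product of linear forms separates a point from them.\<close>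

lemma finite_not_in_proj_closure:
  assumes "finite T" "T \<subseteq> proj_space I" "x \<in> proj_space I" "x \<notin> T"
  shows "x \<notin> proj_closure I T"
proof -
  from assms(3) obtain a where a: "x = proj_point a" "\<forall>i. i \<notin> I \<longrightarrow> a i = 0" "\<exists>i\<in>I. a i \<noteq> 0" by (auto simp: proj_space_def)
  have "\<exists>P. P \<in> forms I 1 \<and> (\<forall>b\<in>y. eval_at b P = 0) \<and> eval_at a P \<noteq> 0" if y: "y \<in> T" for y
  proof -
    from y assms(2) have "y \<in> proj_space I" by blast
    then obtain b where b: "y = proj_point b" "\<forall>i. i \<notin> I \<longrightarrow> b i = 0" "\<exists>i\<in>I. b i \<noteq> 0" by (auto simp: proj_space_def)
    have "\<exists>i\<in>I. \<exists>j\<in>I. a i * b j \<noteq> a j * b i"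
    proof (rule ccontr)
      assume "\<not> ?thesis"
      then have eq: "a i * b j = a j * b i" if "i \<in> I" "j \<in> I" for i j using that by blast
      from b(3) obtain j where j: "j \<in> I" "b j \<noteq> 0" by blast
      have ab: "a i = a j / b j * b i" for i
        using eq[of i j] j a(2) b(2) by (cases "i \<in> I") (auto simp: field_simps)
      then have "a j \<noteq> 0" using a(3) by fastforce
      then have "proj_point a = proj_point b" using proj_point_scale[of "a j / b j" b] ab j(2) by (metis (no_types, lifting) divide_eq_0_iff ext)
      then show False using y assms(4) a b by simp
    qed
    then obtain i j where ij: "i \<in> I" "j \<in> I" "a i * b j \<noteq> a j * b i" by blast
    define P where "P = const_poly (b j) * var_poly i - const_poly (b i) * var_poly j"
    have "P \<in> forms I 1" unfolding P_def by (intro forms_diff forms_const_mult forms_var ij)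
    moreover have "eval_at c P = 0" if "c \<in> y" for c
      using that by (auto simp: P_def b(1) proj_point_def eval_at_diff eval_at_mult)
    moreover have "eval_at a P \<noteq> 0" using ij(3) by (simp add: P_def eval_at_diff eval_at_mult mult.commute)
    ultimately show ?thesis by blast
  qed
  then obtain P where P: "\<And>y. y \<in> T \<Longrightarrow> P y \<in> forms I 1" "\<And>y b. y \<in> T \<Longrightarrow> b \<in> y \<Longrightarrow> eval_at b (P y) = 0"
    "\<And>y. y \<in> T \<Longrightarrow> eval_at a (P y) \<noteq> 0" by metis
  have "prod P T \<in> forms I (\<Sum>y\<in>T. 1)" using P(1) by (rule forms_prod)
  moreover have "eval_at b (prod P T) = 0" if "y \<in> T" "b \<in> y" for y b
    unfolding eval_at_prod by (rule prod_zero[OF assms(1)]) (use P that in auto)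
  moreover have "eval_at a (prod P T) \<noteq> 0" using P(3) assms(1) by (simp add: eval_at_prod)
  moreover have "a \<in> x" by (simp add: a(1) proj_point_self)
  ultimately show ?thesis unfolding proj_closure_def by blast
qed

section \<open>Homogeneous parts\<close>

lemma hom_part_forms:
  assumes "\<And>e. e \<in> Poly_Mapping.keys q \<Longrightarrow> Poly_Mapping.keys e \<subseteq> J"
  shows "hom_part k q \<in> forms J k"
  unfolding hom_part_def
  by (rule forms_sum) (use assms in \<open>auto simp: forms_def monomials_def\<close>)

lemma eval_at_hom_parts:
  obtains N where "\<And>b. eval_at b q = (\<Sum>k\<le>N. eval_at b (hom_part k q))" "M \<le> N"
proof -
  define N where "N = Max (insert M (total_degree ` Poly_Mapping.keys q))"
  have N: "total_degree e \<le> N" if "e \<in> Poly_Mapping.keys q" for e using that by (simp add: N_def)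
  have MN: "M \<le> N" by (simp add: N_def)
  have "eval_at b q = (\<Sum>k\<le>N. eval_at b (hom_part k q))" for b
  proof -
    have "eval_at b q = (\<Sum>k\<le>N. \<Sum>e | e \<in> Poly_Mapping.keys q \<and> total_degree e = k. Poly_Mapping.lookup q e * monomial_value b e)"
      unfolding eval_at_eq by (rule sum.group[symmetric]) (use N in auto)
    then show ?thesis by (simp add: hom_part_def eval_at_sum eval_at_single)
  qed
  with MN that show ?thesis by blast
qed

definition variables_in :: "'v set \<Rightarrow> 'v cpoly \<Rightarrow> bool" where
  "variables_in J P \<longleftrightarrow> (\<forall>e\<in>Poly_Mapping.keys P. Poly_Mapping.keys e \<subseteq> J)"

lemma variables_in_add: "variables_in J P \<Longrightarrow> variables_in J Q \<Longrightarrow> variables_in J (P + Q)"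
  using keys_add[of P Q] by (auto simp: variables_in_def)

lemma variables_in_mult:
  assumes "variables_in J P" "variables_in J Q" shows "variables_in J (P * Q)"
  unfolding variables_in_def
proof
  fix e assume "e \<in> Poly_Mapping.keys (P * Q)"
  with keys_mult[of P Q] obtain f g where
    fg: "e = f + g" "f \<in> Poly_Mapping.keys P" "g \<in> Poly_Mapping.keys Q" by blast
  then have "Poly_Mapping.keys f \<subseteq> J" "Poly_Mapping.keys g \<subseteq> J" using assms by (auto simp: variables_in_def)
  then show "Poly_Mapping.keys e \<subseteq> J" using keys_add[of f g] unfolding fg by blast
qed

lemma variables_in_const: "variables_in J (const_poly c)"
  by (cases "c = 0") (auto simp: variables_in_def const_poly_def)

lemma variables_in_var: "j \<in> J \<Longrightarrow> variables_in J (var_poly j)"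
  by (auto simp: variables_in_def var_poly_def)

lemma variables_in_sum: "(\<And>x. x \<in> A \<Longrightarrow> variables_in J (f x)) \<Longrightarrow> variables_in J (sum f A)"
  by (induction A rule: infinite_finite_induct) (auto intro: variables_in_add simp: variables_in_def[of _ 0])

lemma variables_in_power: "variables_in J P \<Longrightarrow> variables_in J (P ^ n)"
  by (induction n) (auto intro: variables_in_mult variables_in_const[of J 1, unfolded const_poly_def single_one])

lemma variables_in_prod: "(\<And>x. x \<in> A \<Longrightarrow> variables_in J (f x)) \<Longrightarrow> variables_in J (prod f A)"
  by (induction A rule: infinite_finite_induct)
     (auto intro: variables_in_mult variables_in_const[of J 1, unfolded const_poly_def single_one])

lemma local_equation_variables:
  assumes "F \<in> forms I d" shows "variables_in (I - {i}) (local_equation i a F)"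
proof -
  have one: "variables_in (I - {i}) 1"
    using variables_in_const[of "I - {i}" 1] by (simp add: const_poly_def)
  have "Poly_Mapping.keys e \<subseteq> I" if "e \<in> Poly_Mapping.keys F" for e
    using that assms by (auto simp: forms_def monomials_def)
  then show ?thesis unfolding local_equation_def substitute_def
    by (intro variables_in_sum variables_in_mult variables_in_const variables_in_prod variables_in_power)
       (auto intro: one variables_in_add variables_in_const variables_in_var)
qed

lemma hform_eval_at:
  assumes "P \<in> forms I k" "\<And>j. hform 1 (\<lambda>v. b v j)" shows "hform k (\<lambda>v. eval_at (b v) P)"
proof -
  have "hform k (\<lambda>v. Poly_Mapping.lookup P e * monomial_value (b v) e)" if e: "e \<in> Poly_Mapping.keys P" for e
  proof -
    have "hform (\<Sum>i\<in>Poly_Mapping.keys e. 1 * Poly_Mapping.lookup e i) (\<lambda>v. monomial_value (b v) e)"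
      unfolding monomial_value_def by (intro hform_prod hform_power assms(2))
    moreover have "(\<Sum>i\<in>Poly_Mapping.keys e. 1 * Poly_Mapping.lookup e i) = k"
      using e assms(1) by (auto simp: forms_def monomials_def total_degree_def)
    ultimately show ?thesis by (auto intro: hform_cmult)
  qed
  then show ?thesis unfolding eval_at_eq by (intro hform_sum)
qed

lemma hform_euler:
  assumes "hform k \<phi>" shows "of_nat k * \<phi> v = (\<Sum>j\<in>UNIV. grad \<phi> v $ j * v $ j)"
proof -
  have "((\<lambda>r::real. \<phi> (r *\<^sub>R v)) has_derivative (\<lambda>h. \<Sum>j\<in>UNIV. grad \<phi> (1 *\<^sub>R v) $ j * (h *\<^sub>R v) $ j)) (at 1)"
    by (rule has_derivative_compose[OF _ polyfn_has_derivative[OF hform_polyfn[OF assms]]]) (auto intro!: derivative_eq_intros)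
  moreover have "((\<lambda>r::real. \<phi> (r *\<^sub>R v)) has_derivative (\<lambda>h. of_nat k * of_real h * \<phi> v)) (at 1)"
    unfolding hform_scale[OF assms] by (auto intro!: derivative_eq_intros)
  ultimately have "(\<lambda>h. \<Sum>j\<in>UNIV. grad \<phi> (1 *\<^sub>R v) $ j * (h *\<^sub>R v) $ j) = (\<lambda>h. of_nat k * of_real h * \<phi> v)"
    by (rule has_derivative_unique)
  from fun_cong[OF this, of 1] show ?thesis by simp
qed

section \<open>The chart at a point\<close>

text \<open>
  The chart \<open>x_i = 1\<close> centred at the point \<open>a\<close>. The bijection \<open>idx\<close> names the other three coordinates by the
  type \<open>3\<close>, so that the chart is the normed space \<open>complex^3\<close>. A vector of homogeneous coordinates is written
  as \<open>pt l v\<close>, which is the multiple \<open>l\<close> of \<open>a\<close> plus a vector \<open>v\<close> with zero \<open>i\<close>-th coordinate.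
\<close>

locale chart =
  fixes i :: nat and a :: "nat \<Rightarrow> complex" and idx :: "3 \<Rightarrow> nat"
  assumes i: "i \<in> {0..3}" and idx: "bij_betw idx UNIV ({0..3} - {i})"
    and a_i: "a i = 1" and a_support: "j \<notin> {0..3} \<Longrightarrow> a j = 0"
begin

definition direction :: "complex^3 \<Rightarrow> nat \<Rightarrow> complex" where
  "direction v j = (if j \<in> {0..3} - {i} then v $ (inv_into UNIV idx j) else 0)"

definition pt :: "complex \<Rightarrow> complex^3 \<Rightarrow> nat \<Rightarrow> complex" where
  "pt l v j = l * a j + direction v j"

definition fn :: "nat cpoly \<Rightarrow> complex^3 \<Rightarrow> complex" where
  "fn F v = eval_at (pt 1 v) F"

lemma idx_in: "idx k \<in> {0..3}" "idx k \<noteq> i"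
proof -
  have "idx k \<in> {0..3} - {i}" using idx bij_betwE by blast
  then show "idx k \<in> {0..3}" "idx k \<noteq> i" by auto
qed

lemma inv_idx [simp]: "inv_into UNIV idx (idx k) = k"
  using idx by (auto simp: bij_betw_def)

lemma direction_idx [simp]: "direction v (idx k) = v $ k"
  using idx_in[of k] by (simp add: direction_def)

lemma direction_i [simp]: "direction v i = 0" by (simp add: direction_def)

lemma direction_out: "j \<notin> {0..3} - {i} \<Longrightarrow> direction v j = 0" by (auto simp: direction_def)

lemma pt_i [simp]: "pt l v i = l" by (simp add: pt_def a_i)

lemma pt_out: "j \<notin> {0..3} \<Longrightarrow> pt l v j = 0"
  using a_support[of j] direction_out[of j v] by (auto simp: pt_def)

lemma idx_cases: "j \<in> {0..3} - {i} \<Longrightarrow> \<exists>k. j = idx k"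
  using idx by (auto simp: bij_betw_def image_iff set_eq_iff)

lemma direction_surj:
  assumes "\<And>j. j \<notin> {0..3} - {i} \<Longrightarrow> b j = 0" shows "b = direction (\<chi> k. b (idx k))"
proof
  fix j show "b j = direction (\<chi> k. b (idx k)) j"
    using assms[of j] idx_cases[of j] by (cases "j \<in> {0..3} - {i}") (auto simp: direction_out)
qed

lemma pt_surj:
  assumes "\<And>j. j \<notin> {0..3} \<Longrightarrow> b j = 0" shows "\<exists>v. b = pt (b i) v"
proof -
  have "(\<lambda>j. b j - b i * a j) = direction (\<chi> k. b (idx k) - b i * a (idx k))"
  proof (rule direction_surj)
    fix j assume "j \<notin> {0..3} - {i}"
    then show "b j - b i * a j = 0" using assms[of j] a_support[of j] a_i by (cases "j = i") auto
  qed
  then have *: "b j - b i * a j = direction (\<chi> k. b (idx k) - b i * a (idx k)) j" for j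
    by (rule fun_cong)
  have "b j = pt (b i) (\<chi> k. b (idx k) - b i * a (idx k)) j" for j
    unfolding pt_def *[symmetric] by simp
  then have "b = pt (b i) (\<chi> k. b (idx k) - b i * a (idx k))" by (rule ext)
  then show ?thesis by (rule exI)
qed

lemma direction_scale: "direction (c *s v) j = c * direction v j"
  by (simp add: direction_def)

lemma pt_scale: "pt (c * l) (c *s v) = (\<lambda>j. c * pt l v j)"
  by (auto simp: pt_def direction_scale algebra_simps)

lemma pt_inject:
  assumes "pt l v = pt l' v'" shows "l = l'" "v = v'"
proof -
  show l: "l = l'" using fun_cong[OF assms, of i] by simp
  have "v $ k = v' $ k" for k using fun_cong[OF assms, of "idx k"] l by (simp add: pt_def)
  then show "v = v'" by (simp add: vec_eq_iff)
qed

lemma proj_point_pt_inject: "proj_point (pt 1 v) = proj_point (pt 1 v') \<Longrightarrow> v = v'"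
proof -
  assume "proj_point (pt 1 v) = proj_point (pt 1 v')"
  with proj_point_self[of "pt 1 v"] obtain c where c: "pt 1 v = (\<lambda>j. c * pt 1 v' j)" by (auto simp: proj_point_def)
  from fun_cong[OF this, of i] have "c = 1" by simp
  with c show ?thesis using pt_inject(2) by simp
qed

lemma hform_direction: "hform 1 (\<lambda>v. direction v j)"
proof (cases "j \<in> {0..3} - {i}")
  case True
  then show ?thesis using hform_coord[of "inv_into UNIV idx j"] by (simp add: direction_def)
next
  case False
  then have "(\<lambda>v. direction v j) = (\<lambda>_. 0)" by (simp add: direction_out)
  then show ?thesis by simp
qed

lemma direction_has_derivative: "((\<lambda>v. direction v j) has_derivative (\<lambda>h. direction h j)) (at v)"
proof (cases "j \<in> {0..3} - {i}")
  case True
  then obtain k where "j = idx k" using idx_cases by blast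
  then show ?thesis by (simp add: bounded_linear_imp_has_derivative[OF bounded_linear_vec_nth])
qed (simp add: direction_out)

lemma sum_directions: "(\<Sum>j\<in>{0..3}. direction h j * f j) = (\<Sum>k\<in>UNIV. f (idx k) * h $ k)"
proof -
  have "(\<Sum>j\<in>{0..3}. direction h j * f j) = (\<Sum>j\<in>{0..3} - {i}. direction h j * f j)"
    by (rule sum.mono_neutral_right) (auto simp: direction_out)
  also have "\<dots> = (\<Sum>k\<in>UNIV. direction h (idx k) * f (idx k))"
    by (rule sum.reindex_bij_betw[OF idx, symmetric])
  finally show ?thesis by (simp add: mult.commute)
qed

lemma eval_pt_has_derivative:
  assumes "F \<in> forms {0..3} d"
  shows "((\<lambda>v. eval_at (pt l v) F) has_derivative
     (\<lambda>h. \<Sum>k\<in>UNIV. eval_at (pt l v) (partial_deriv (idx k) F) * h $ k)) (at v)"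
proof -
  have "((\<lambda>v. pt l v j) has_derivative (\<lambda>h. direction h j)) (at v)" for j
    unfolding pt_def using has_derivative_add[OF has_derivative_const direction_has_derivative] by simp
  then have "((\<lambda>v. eval_at (pt l v) F) has_derivative
     (\<lambda>h. \<Sum>j\<in>{0..3}. direction h j * eval_at (pt l v) (partial_deriv j F))) (at v)"
    by (intro eval_at_has_derivative[OF _ assms]) auto
  then show ?thesis by (simp add: sum_directions)
qed

lemma grad_eval_pt:
  assumes "F \<in> forms {0..3} d"
  shows "grad (\<lambda>v. eval_at (pt l v) F) v = (\<chi> k. eval_at (pt l v) (partial_deriv (idx k) F))"
  by (rule grad_eqI[OF eval_pt_has_derivative[OF assms]])

lemma grad_fn: "F \<in> forms {0..3} d \<Longrightarrow> grad (fn F) v = (\<chi> k. eval_at (pt 1 v) (partial_deriv (idx k) F))"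
  unfolding fn_def[abs_def] by (rule grad_eval_pt)

text \<open>
  By Euler's formula the partial derivative in the direction of \<open>x_i\<close> vanishes with the other three
  and the value.
\<close>

lemma singular_point_iff:
  assumes "F \<in> forms {0..3} d"
  shows "proj_point (pt 1 v) \<in> singular_points {0..3} F \<longleftrightarrow> fn F v = 0 \<and> grad (fn F) v = 0"
proof -
  let ?b = "pt 1 v"
  have b: "\<forall>j. j \<notin> {0..3} \<longrightarrow> ?b j = 0" "\<exists>j\<in>{0..3}. ?b j \<noteq> 0" using pt_out i by (auto intro: bexI[of _ i])
  have "(\<forall>j\<in>{0..3}. eval_at ?b (partial_deriv j F) = 0) \<longleftrightarrow> grad (fn F) v = 0" if F0: "fn F v = 0"
  proof
    assume "grad (fn F) v = 0"
    then have g: "eval_at ?b (partial_deriv j F) = 0" if "j \<in> {0..3} - {i}" for j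
      using idx_cases[OF that] by (auto simp: grad_fn[OF assms] vec_eq_iff)
    have "(\<Sum>j\<in>{0..3}. ?b j * eval_at ?b (partial_deriv j F)) = (\<Sum>j\<in>{i}. ?b j * eval_at ?b (partial_deriv j F))"
      by (rule sum.mono_neutral_right) (use g i in auto)
    with euler_formula[OF _ assms, of ?b] F0 have "eval_at ?b (partial_deriv i F) = 0" by (simp add: fn_def)
    with g show "\<forall>j\<in>{0..3}. eval_at ?b (partial_deriv j F) = 0" by blast
  next
    assume "\<forall>j\<in>{0..3}. eval_at ?b (partial_deriv j F) = 0"
    then show "grad (fn F) v = 0" using idx_in by (simp add: grad_fn[OF assms] vec_eq_iff)
  qed
  then show ?thesis unfolding proj_point_in_singular_points[OF assms b] by (auto simp: fn_def)
qed

lemma eval_local_equation: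
  "eval_at (direction v) (local_equation i a F) = fn F v"
proof -
  have "eval_at (direction v) (local_equation i a F) =
     eval_at (\<lambda>j. eval_at (direction v) (if j = i then 1 else const_poly (a j) + var_poly j)) F"
    by (simp add: local_equation_def eval_at_substitute)
  also have "(\<lambda>j. eval_at (direction v) (if j = i then 1 else const_poly (a j) + var_poly j)) = pt 1 v"
    by (auto simp: eval_at_add pt_def a_i)
  finally show ?thesis by (simp add: fn_def)
qed

definition fn_part :: "nat cpoly \<Rightarrow> nat \<Rightarrow> complex^3 \<Rightarrow> complex" where
  "fn_part F k v = eval_at (direction v) (hom_part k (local_equation i a F))"

lemma local_hom_part_forms:
  "F \<in> forms {0..3} d \<Longrightarrow> hom_part k (local_equation i a F) \<in> forms ({0..3} - {i}) k"
  using local_equation_variables[of F "{0..3}" d i a] by (intro hom_part_forms) (auto simp: variables_in_def)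

lemma fn_part_hform: "F \<in> forms {0..3} d \<Longrightarrow> hform k (fn_part F k)"
  unfolding fn_part_def[abs_def]
  by (rule hform_eval_at[OF local_hom_part_forms hform_direction])

lemma fn_decompose: obtains N where "\<And>v. fn F v = (\<Sum>k\<le>N. fn_part F k v)" "M \<le> N"
proof -
  obtain N where N: "\<And>b. eval_at b (local_equation i a F) = (\<Sum>k\<le>N. eval_at b (hom_part k (local_equation i a F)))" "M \<le> N"
    using eval_at_hom_parts by blast
  show ?thesis by (rule that[of N]) (use N in \<open>auto simp: fn_part_def eval_local_equation[symmetric]\<close>)
qed

text \<open>The linear forms \<open>x_j - a_j x_i\<close> restrict to the coordinate functions of the chart.\<close>

lemma hform_lift:
  "hform k \<phi> \<Longrightarrow> \<exists>P\<in>forms {0..3} k. \<forall>l v. eval_at (pt l v) P = \<phi> v"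
proof (induction k \<phi> rule: hform.induct)
  case (hform_const c)
  show ?case by (rule bexI[of _ "const_poly c"]) (auto intro: forms_const)
next
  case (hform_coord j)
  show ?case
  proof (rule bexI[of _ "var_poly (idx j) - const_poly (a (idx j)) * var_poly i"])
    show "\<forall>l v. eval_at (pt l v) (var_poly (idx j) - const_poly (a (idx j)) * var_poly i) = v $ j"
      by (simp add: eval_at_diff eval_at_mult) (simp add: pt_def)
  qed (intro forms_diff forms_const_mult forms_var idx_in i)
next
  case (hform_add k \<phi> \<psi>)
  then obtain P Q where "P \<in> forms {0..3} k" "\<forall>l v. eval_at (pt l v) P = \<phi> v"
     "Q \<in> forms {0..3} k" "\<forall>l v. eval_at (pt l v) Q = \<psi> v" by blast
  then show ?case by (intro bexI[of _ "P + Q"]) (auto simp: eval_at_add intro: forms_add)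
next
  case (hform_mult k \<phi> l \<psi>)
  then obtain P Q where "P \<in> forms {0..3} k" "\<forall>l v. eval_at (pt l v) P = \<phi> v"
     "Q \<in> forms {0..3} l" "\<forall>l v. eval_at (pt l v) Q = \<psi> v" by blast
  then show ?case by (intro bexI[of _ "P * Q"]) (auto simp: eval_at_mult intro: forms_mult)
qed

lemma hform_homogenize:
  assumes "hform k \<phi>" "k \<le> d"
  shows "\<exists>P\<in>forms {0..3} d. \<forall>l v. eval_at (pt l v) P = l ^ (d - k) * \<phi> v"
proof -
  from hform_lift[OF assms(1)] obtain P where P: "P \<in> forms {0..3} k" "\<forall>l v. eval_at (pt l v) P = \<phi> v" by blast
  have "var_poly i ^ (d - k) * P \<in> forms {0..3} (1 * (d - k) + k)"
    by (intro forms_mult forms_power forms_var i P)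
  then show ?thesis using P(2) assms(2)
    by (intro bexI[of _ "var_poly i ^ (d - k) * P"]) (auto simp: eval_at_mult eval_at_power)
qed

end

section \<open>A criterion for nodes\<close>

lemma form_of_degree_0_eq_0:
  assumes "P \<in> forms J 0" "eval_at b P = 0" shows "P = 0"
proof -
  have "e = 0" if "e \<in> Poly_Mapping.keys P" for e
  proof -
    from that assms(1) have "total_degree e = 0" by (auto simp: forms_def monomials_def)
    then show ?thesis by (auto simp: total_degree_def in_keys_iff intro!: poly_mapping_eqI)
  qed
  then have "Poly_Mapping.keys P \<subseteq> {0}" by blast
  from eval_at_superset[OF _ this, of b] assms(2) have "Poly_Mapping.lookup P 0 = 0" by simp
  with \<open>Poly_Mapping.keys P \<subseteq> {0}\<close> have "Poly_Mapping.lookup P e = 0" for e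
    by (metis in_keys_iff insertE empty_iff subsetD)
  then show ?thesis by (intro poly_mapping_eqI) simp
qed

lemma total_degree_1:
  assumes "total_degree e = 1" obtains j where "e = Poly_Mapping.single j 1"
proof -
  from assms obtain j where j: "j \<in> Poly_Mapping.keys e" "Poly_Mapping.lookup e j = 1"
     "\<forall>b\<in>Poly_Mapping.keys e. j \<noteq> b \<longrightarrow> Poly_Mapping.lookup e b = 0"
    unfolding total_degree_def sum_eq_1_iff[OF finite_keys] by blast
  have "e = Poly_Mapping.single j 1"
  proof (rule poly_mapping_eqI)
    fix k show "Poly_Mapping.lookup e k = Poly_Mapping.lookup (Poly_Mapping.single j 1) k"
      using j by (cases "k \<in> Poly_Mapping.keys e") (auto simp: lookup_single when_def in_keys_iff)
  qed
  then show ?thesis by (rule that)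
qed

context chart
begin

lemma form_of_degree_1_eq_0:
  assumes P: "P \<in> forms ({0..3} - {i}) 1" and e: "\<And>k. eval_at (direction (axis k 1)) P = 0"
  shows "P = 0"
proof (rule ccontr)
  assume "P \<noteq> 0"
  then obtain e0 where e0: "e0 \<in> Poly_Mapping.keys P" by (metis ex_in_conv keys_eq_empty)
  have single: "\<exists>k. e = Poly_Mapping.single (idx k) 1" if "e \<in> Poly_Mapping.keys P" for e
  proof -
    from that P have t: "total_degree e = 1" "Poly_Mapping.keys e \<subseteq> {0..3} - {i}" by (auto simp: forms_def monomials_def)
    from t(1) obtain j where j: "e = Poly_Mapping.single j 1" by (rule total_degree_1)
    with t(2) idx_cases[of j] show ?thesis by auto
  qed
  from single[OF e0] obtain k where k: "e0 = Poly_Mapping.single (idx k) 1" by blast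
  have "eval_at (direction (axis k 1)) P = (\<Sum>e\<in>{e0}. Poly_Mapping.lookup P e * monomial_value (direction (axis k 1)) e)"
    unfolding eval_at_eq
  proof (rule sum.mono_neutral_right)
    show "\<forall>e\<in>Poly_Mapping.keys P - {e0}. Poly_Mapping.lookup P e * monomial_value (direction (axis k 1)) e = 0"
    proof
      fix e assume e: "e \<in> Poly_Mapping.keys P - {e0}"
      then obtain k' where k': "e = Poly_Mapping.single (idx k') 1" using single by blast
      with e k have "k \<noteq> k'" by auto
      then show "Poly_Mapping.lookup P e * monomial_value (direction (axis k 1)) e = 0"
        by (simp add: k' axis_def)
    qed
  qed (use e0 in auto)
  then have "Poly_Mapping.lookup P e0 = 0" using e[of k] by (simp add: k axis_def)
  with e0 show False by (simp add: in_keys_iff)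
qed

lemma pt_1_0: "pt 1 0 = a"
  by (rule ext) (simp add: pt_def direction_def)

lemma base_point: "\<forall>j. j \<notin> {0..3} \<longrightarrow> a j = 0" "\<exists>j\<in>{0..3}. a j \<noteq> 0"
  using a_support i a_i by (auto intro: bexI[of _ i])

text \<open>
  The quadratic part of the local equation is determined by the linear part of the gradient, so a
  linear lower bound on the gradient makes the tangent cone smooth.
\<close>

lemma node_at_base:
  assumes F: "F \<in> forms {0..3} d" and fin: "finite (singular_points {0..3} F)"
    and f0: "fn F 0 = 0" "grad (fn F) 0 = 0"
    and exp: "\<kappa> > 0" "r > 0" "\<And>y. norm y < r \<Longrightarrow> \<kappa> * norm y \<le> norm (grad (fn F) y)"
  shows "node {0..3} F (proj_point a)"
proof -
  let ?q = "local_equation i a F" and ?\<Phi> = "fn_part F"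
  have hf: "hform k (?\<Phi> k)" for k by (rule fn_part_hform[OF F])
  obtain N where N: "\<And>v. fn F v = (\<Sum>k\<le>N. ?\<Phi> k v)" "2 \<le> N" using fn_decompose by blast
  have "polyfn N (?\<Phi> k)" if "k \<le> N" for k using hf that by (rule polyfn_hform)
  then have "grad (\<lambda>v. \<Sum>k\<le>N. ?\<Phi> k v) v = (\<Sum>k\<le>N. grad (?\<Phi> k) v)" for v
    by (intro grad_sum) auto
  then have gN: "grad (fn F) v = (\<Sum>k\<le>N. grad (?\<Phi> k) v)" for v
    by (subst (asm) N(1)[symmetric])
  have val0: "?\<Phi> k 0 = 0" if "k \<noteq> 0" for k using hform_scale[OF hf, of k 0 0] that by (simp add: power_0_left)
  have g0: "grad (?\<Phi> 0) v = 0" for v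
  proof -
    have "?\<Phi> 0 v = ?\<Phi> 0 0" for v using hform_scale[OF hf[of 0], of 0 v] by simp
    then have "?\<Phi> 0 = (\<lambda>_. ?\<Phi> 0 0)" by (rule ext)
    from arg_cong[OF this, of grad] show ?thesis using grad_const[of "?\<Phi> 0 0" v] by (rule fun_cong[THEN trans])
  qed
  have g00: "grad (?\<Phi> k) 0 = 0" if k: "k \<ge> 2" for k
  proof -
    have "grad (?\<Phi> k) 0 = 2 ^ (k - 1) *\<^sub>R grad (?\<Phi> k) 0" using grad_hform_scale[OF hf[of k], of 2 0] by simp
    then have "(2 ^ (k - 1) - 1) *\<^sub>R grad (?\<Phi> k) 0 = 0" by (simp add: scaleR_diff_left)
    moreover have "(2::real) ^ (k - 1) > 1" using k by (intro one_less_power) auto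
    ultimately show ?thesis by simp
  qed
  have "?\<Phi> 0 0 = (\<Sum>k\<le>N. ?\<Phi> k 0)"
    using sum.mono_neutral_right[of "{..N}" "{0}" "\<lambda>k. ?\<Phi> k 0"] val0 by auto
  then have \<Phi>0: "?\<Phi> 0 0 = 0" using f0(1) N(1) by simp
  have q0: "hom_part 0 ?q = 0"
    by (rule form_of_degree_0_eq_0[OF local_hom_part_forms[OF F]]) (rule \<Phi>0[unfolded fn_part_def])
  have "grad (?\<Phi> 1) 0 = (\<Sum>k\<le>N. grad (?\<Phi> k) 0)"
  proof -
    have "grad (?\<Phi> k) 0 = 0" if "k \<in> {..N} - {1}" for k
      using that g0 g00[of k] by (cases "k = 0") auto
    then show ?thesis using N(2) sum.mono_neutral_right[of "{..N}" "{1}" "\<lambda>k. grad (?\<Phi> k) 0"] by auto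
  qed
  then have \<Phi>10: "grad (?\<Phi> 1) 0 = 0" using f0(2) gN by simp
  \<comment> \<open>The gradient of a linear form is constant, so it suffices to compare it with its value at \<open>0\<close>.\<close>
  have \<Phi>1: "grad (?\<Phi> 1) v = 0" for v
  proof -
    have "(\<lambda>n. inverse (real (Suc n)) *\<^sub>R v) \<longlonglongrightarrow> 0 *\<^sub>R v"
      by (intro tendsto_scaleR LIMSEQ_inverse_real_of_nat tendsto_const)
    from grad_tendsto[OF hform_polyfn[OF hf[of 1]] this]
    have "(\<lambda>n. grad (?\<Phi> 1) (inverse (real (Suc n)) *\<^sub>R v)) \<longlonglongrightarrow> 0"
      unfolding scaleR_zero_left \<Phi>10 .
    moreover have "grad (?\<Phi> 1) (inverse (real (Suc n)) *\<^sub>R v) = grad (?\<Phi> 1) v" for n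
      using grad_hform_scale[OF hf[of 1], of "inverse (real (Suc n))" v] by simp
    ultimately show ?thesis by (simp only: LIMSEQ_const_iff)
  qed
  have q1: "hom_part 1 ?q = 0"
  proof (rule form_of_degree_1_eq_0[OF local_hom_part_forms[OF F]])
    fix k show "eval_at (direction (axis k 1)) (hom_part 1 ?q) = 0"
      using hform_euler[OF hf[of 1], of "axis k 1"] \<Phi>1 by (simp add: fn_part_def)
  qed
  have nondeg: "u = 0" if u: "grad (?\<Phi> 2) u = 0" for u
  proof (rule ccontr)
    assume u0: "u \<noteq> 0"
    define C where "C = (\<Sum>k\<le>N. norm (grad (?\<Phi> k) u))"
    \<comment> \<open>If the quadratic part were critical at \<open>u\<close>, the gradient at \<open>\<rho> u\<close> would be of order \<open>\<rho>^2\<close>.\<close>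
    have bound: "\<kappa> * norm u \<le> \<rho> * C" if \<rho>: "0 < \<rho>" "\<rho> \<le> 1" "\<rho> * norm u < r" for \<rho>
    proof -
      have "norm (grad (?\<Phi> k) (\<rho> *\<^sub>R u)) \<le> \<rho>\<^sup>2 * norm (grad (?\<Phi> k) u)" for k
      proof -
        consider "k = 0" | "k = 1" | "k = 2" | "k \<ge> 3" by linarith
        then show ?thesis
        proof cases
          case 4
          then have "\<rho> ^ (k - 1) \<le> \<rho> ^ 2" using \<rho> by (intro power_decreasing) auto
          then show ?thesis using \<rho> by (simp add: grad_hform_scale[OF hf] mult_right_mono)
        next
          case 3
          then show ?thesis using \<rho> u by (simp add: grad_hform_scale[OF hf])
        qed (use g0 \<Phi>1 in auto)
      qed
      then have "norm (grad (fn F) (\<rho> *\<^sub>R u)) \<le> \<rho>\<^sup>2 * C"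
        unfolding gN C_def sum_distrib_left by (intro sum_norm_le)
      moreover have "\<kappa> * norm (\<rho> *\<^sub>R u) \<le> norm (grad (fn F) (\<rho> *\<^sub>R u))"
        by (rule exp(3)) (use \<rho> in auto)
      ultimately have "\<kappa> * norm (\<rho> *\<^sub>R u) \<le> \<rho>\<^sup>2 * C" by linarith
      then have "\<rho> * (\<kappa> * norm u) \<le> \<rho> * (\<rho> * C)"
        unfolding norm_scaleR abs_of_pos[OF \<rho>(1)] power2_eq_square by (simp only: mult_ac)
      then show ?thesis using \<rho>(1) by simp
    qed
    have C: "C \<ge> 0" by (simp add: C_def sum_nonneg)
    define \<rho> where "\<rho> = min 1 (min (r / (2 * norm u)) (\<kappa> * norm u / (2 * (C + 1))))"
    have \<rho>: "0 < \<rho>" "\<rho> \<le> 1" using exp u0 C by (auto simp: \<rho>_def)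
    have "\<rho> * norm u \<le> r / (2 * norm u) * norm u" by (intro mult_right_mono) (auto simp: \<rho>_def)
    also have "\<dots> < r" using u0 exp(2) by simp
    finally have "\<kappa> * norm u \<le> \<rho> * C" using bound \<rho> by blast
    also have "\<dots> \<le> \<kappa> * norm u / (2 * (C + 1)) * C" using C by (intro mult_right_mono) (auto simp: \<rho>_def)
    also have "\<dots> < \<kappa> * norm u"
    proof -
      have "\<kappa> * norm u * C < \<kappa> * norm u * (2 * (C + 1))"
        using C exp(1) u0 by (intro mult_strict_left_mono) auto
      then show ?thesis using C by (simp add: field_simps)
    qed
    finally show False by simp
  qed
  have sing2: "singular_points ({0..3} - {i}) (hom_part 2 ?q) = {}"
  proof (rule ccontr)
    assume "singular_points ({0..3} - {i}) (hom_part 2 ?q) \<noteq> {}"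
    then obtain x where x: "x \<in> singular_points ({0..3} - {i}) (hom_part 2 ?q)" by blast
    then have "x \<in> proj_space ({0..3} - {i})" by (simp add: singular_points_def)
    then obtain b where "x = proj_point b" unfolding proj_space_def by blast
    then have b0: "b \<in> x" by (simp add: proj_point_self)
    note b = singular_point_representative[OF x b0]
    define u :: "complex^3" where "u = (\<chi> k. b (idx k))"
    have bu: "b = direction u" unfolding u_def by (rule direction_surj) (use b(2) in auto)
    have "((\<lambda>v. eval_at (direction v) (hom_part 2 ?q)) has_derivative
      (\<lambda>h. \<Sum>j\<in>{0..3} - {i}. direction h j * eval_at (direction u) (partial_deriv j (hom_part 2 ?q)))) (at u)"
      by (rule eval_at_has_derivative[OF _ local_hom_part_forms[OF F] direction_has_derivative]) auto
    then have "(?\<Phi> 2 has_derivative (\<lambda>h. \<Sum>k\<in>UNIV. 0 * h $ k)) (at u)"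
      using b(5) unfolding fn_part_def[abs_def] bu by simp
    from grad_eqI[OF this] have "grad (?\<Phi> 2) u = 0" by (simp add: vec_eq_iff)
    then have "u = 0" by (rule nondeg)
    then have "b = (\<lambda>_. 0)" unfolding bu by (auto simp: direction_def)
    with b(3) show False by simp
  qed
  have q2: "hom_part 2 ?q \<noteq> 0"
  proof
    assume *: "hom_part 2 ?q = 0"
    let ?b = "direction (axis 1 1)"
    have "?b (idx 1) \<noteq> 0" by (simp add: axis_def)
    then have "proj_point ?b \<in> singular_points ({0..3} - {i}) 0"
      by (subst proj_point_in_singular_points[where d = 0])
        (use idx_in direction_out in \<open>auto simp: partial_deriv_def intro!: bexI[of _ "idx 1"]\<close>)
    with sing2 * show False by simp
  qed
  have "proj_point a \<in> singular_points {0..3} F" using singular_point_iff[OF F, of 0] f0 by (simp add: pt_1_0)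
  moreover have "proj_point a \<notin> proj_closure {0..3} (singular_points {0..3} F - {proj_point a})"
    by (rule finite_not_in_proj_closure) (use fin base_point in \<open>auto simp: singular_points_def intro: proj_point_in_space\<close>)
  moreover have "hom_part k ?q = 0" if "k < 2" for k
  proof -
    have "k = 0 \<or> k = 1" using that by auto
    then show ?thesis using q0 q1 by auto
  qed
  ultimately show ?thesis unfolding ordinary_point_def
    using i a_i q2 sing2 proj_point_self[of a] by blast
qed

lemma chart_shift: "chart i (pt 1 p) idx"
  by standard (use i idx pt_out in auto)

lemma node_at:
  assumes F: "F \<in> forms {0..3} d" and fin: "finite (singular_points {0..3} F)"
    and f0: "fn F p = 0" "grad (fn F) p = 0"
    and exp: "\<kappa> > 0" "r > 0" "\<And>y. norm (y - p) < r \<Longrightarrow> \<kappa> * norm (y - p) \<le> norm (grad (fn F) y)"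
  shows "node {0..3} F (proj_point (pt 1 p))"
proof -
  interpret shifted: chart i "pt 1 p" idx by (rule chart_shift)
  have fn: "shifted.fn F = (\<lambda>v. fn F (p + v))"
  proof
    fix v
    have "shifted.pt 1 v = pt 1 (p + v)"
      by (rule ext) (simp add: shifted.pt_def pt_def shifted.direction_def[abs_def] direction_def[abs_def])
    then show "shifted.fn F v = fn F (p + v)" by (simp add: shifted.fn_def fn_def)
  qed
  have gr: "grad (shifted.fn F) v = grad (fn F) (p + v)" for v
    by (simp add: fn grad_def add.assoc)
  show ?thesis
    by (rule shifted.node_at_base[OF F fin _ _ exp(1,2)]) (use f0 exp(3)[of "p + _"] in \<open>auto simp: fn gr[unfolded fn]\<close>)
qed

end

section \<open>Convergence of functions together with their gradients\<close>

text \<open>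
  Continuous convergence, that is, along every convergent sequence of arguments. In this form it
  passes to sums and to products with convergent scalars, so limits of long formulas can be composed
  from those of their constituents.
\<close>
definition converges_with_grad :: "nat \<Rightarrow> (nat \<Rightarrow> complex^3 \<Rightarrow> complex) \<Rightarrow> (complex^3 \<Rightarrow> complex) \<Rightarrow> bool" where
  "converges_with_grad D E E' \<longleftrightarrow> (\<forall>n. polyfn D (E n)) \<and> polyfn D E' \<and>
     (\<forall>u l. u \<longlonglongrightarrow> l \<longrightarrow> (\<lambda>n. E n (u n)) \<longlonglongrightarrow> E' l \<and> (\<lambda>n. grad (E n) (u n)) \<longlonglongrightarrow> grad E' l)"

lemma converges_const: "polyfn D \<phi> \<Longrightarrow> converges_with_grad D (\<lambda>_. \<phi>) \<phi>"
  by (auto simp: converges_with_grad_def intro: polyfn_tendsto grad_tendsto)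

lemma converges_add:
  assumes "converges_with_grad D E E'" "converges_with_grad D G G'"
  shows "converges_with_grad D (\<lambda>n v. E n v + G n v) (\<lambda>v. E' v + G' v)"
proof -
  have p: "polyfn D (E n)" "polyfn D (G n)" "polyfn D E'" "polyfn D G'" for n
    using assms by (auto simp: converges_with_grad_def)
  have "(\<lambda>n. grad (\<lambda>v. E n v + G n v) (u n)) \<longlonglongrightarrow> grad (\<lambda>v. E' v + G' v) l" if "u \<longlonglongrightarrow> l" for u l
    unfolding grad_add[OF p(1,2)] grad_add[OF p(3,4)]
    using assms that by (intro tendsto_add) (auto simp: converges_with_grad_def)
  then show ?thesis using assms p by (auto simp: converges_with_grad_def intro!: polyfn_add tendsto_add)
qed

lemma tendsto_vector_smult:
  fixes f :: "nat \<Rightarrow> complex" and v :: "nat \<Rightarrow> complex^3"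
  assumes "f \<longlonglongrightarrow> c" "v \<longlonglongrightarrow> w" shows "(\<lambda>n. f n *s v n) \<longlonglongrightarrow> c *s w"
  by (rule vec_tendstoI) (simp, intro tendsto_mult assms(1) tendsto_vec_nth assms(2))

lemma converges_cmult:
  assumes "c \<longlonglongrightarrow> c'" "converges_with_grad D E E'"
  shows "converges_with_grad D (\<lambda>n v. c n * E n v) (\<lambda>v. c' * E' v)"
proof -
  have p: "polyfn D (E n)" "polyfn D E'" for n
    using assms by (auto simp: converges_with_grad_def)
  have "(\<lambda>n. grad (\<lambda>v. c n * E n v) (u n)) \<longlonglongrightarrow> grad (\<lambda>v. c' * E' v) l" if "u \<longlonglongrightarrow> l" for u l
    unfolding grad_cmult[OF p(1)] grad_cmult[OF p(2)]
    using assms that by (intro tendsto_vector_smult) (auto simp: converges_with_grad_def)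
  then show ?thesis using assms p by (auto simp: converges_with_grad_def intro!: polyfn_cmult tendsto_mult)
qed

lemma converges_sum:
  assumes "\<And>x. x \<in> A \<Longrightarrow> converges_with_grad D (E x) (E' x)"
  shows "converges_with_grad D (\<lambda>n v. \<Sum>x\<in>A. E x n v) (\<lambda>v. \<Sum>x\<in>A. E' x v)"
  using assms
  by (induction A rule: infinite_finite_induct)
     (auto intro: converges_const[OF polyfn_const] converges_add)

lemma converges_with_gradD:
  assumes "converges_with_grad D E E'" "u \<longlonglongrightarrow> l"
  shows "(\<lambda>n. E n (u n)) \<longlonglongrightarrow> E' l" "(\<lambda>n. grad (E n) (u n)) \<longlonglongrightarrow> grad E' l"
  using assms by (auto simp: converges_with_grad_def)

lemma grad_rescale:
  assumes "polyfn N \<phi>" shows "grad (\<lambda>v. \<phi> (\<rho> *\<^sub>R v)) u = \<rho> *\<^sub>R grad \<phi> (\<rho> *\<^sub>R u)"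
proof -
  have "((\<lambda>v. \<phi> (\<rho> *\<^sub>R v)) has_derivative (\<lambda>h. \<Sum>j\<in>UNIV. grad \<phi> (\<rho> *\<^sub>R u) $ j * (\<rho> *\<^sub>R h) $ j)) (at u)"
    by (rule has_derivative_compose[OF _ polyfn_has_derivative[OF assms]]) (auto intro!: derivative_eq_intros)
  then have "((\<lambda>v. \<phi> (\<rho> *\<^sub>R v)) has_derivative (\<lambda>h. \<Sum>j\<in>UNIV. (of_real \<rho> * grad \<phi> (\<rho> *\<^sub>R u) $ j) * h $ j)) (at u)"
    by (rule has_derivative_eq_rhs) (simp add: scaleR_conv_of_real[where 'a = complex] mult_ac)
  from grad_eqI[OF this] show ?thesis by (simp add: vec_eq_iff scaleR_conv_of_real[where 'a = complex])
qed

lemma polyfn_eval_at: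
  assumes "P \<in> forms I k" "\<And>j. polyfn 1 (\<lambda>v. b v j)" shows "polyfn k (\<lambda>v. eval_at (b v) P)"
proof -
  have pw: "polyfn (1 * n) (\<lambda>v. b v j ^ n)" for j n
    using polyfn_prod[of "{..<n}" "\<lambda>_. 1" "\<lambda>_ v. b v j"] assms(2) by simp
  have "polyfn k (\<lambda>v. Poly_Mapping.lookup P e * monomial_value (b v) e)" if e: "e \<in> Poly_Mapping.keys P" for e
  proof -
    have "polyfn (\<Sum>i\<in>Poly_Mapping.keys e. 1 * Poly_Mapping.lookup e i) (\<lambda>v. monomial_value (b v) e)"
      unfolding monomial_value_def by (intro polyfn_prod pw)
    moreover have "(\<Sum>i\<in>Poly_Mapping.keys e. 1 * Poly_Mapping.lookup e i) = k"
      using e assms(1) by (auto simp: forms_def monomials_def total_degree_def)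
    ultimately show ?thesis by (auto intro: polyfn_cmult)
  qed
  then show ?thesis unfolding eval_at_eq by (intro polyfn_sum)
qed

section \<open>The deformation and its limits at different scales\<close>

text \<open>
  The data of the deformation: \<open>F\<close> with its parts \<open>\<Phi> k\<close> in the chart, the polynomial \<open>g\<close> with its parts
  \<open>\<gamma> k\<close> for \<open>k < m\<close> and its leading form \<open>lead\<close>, the parts \<open>\<l> w k\<close> of the interpolating functions, and
  \<open>h\<close>, which makes the comparison surface \<open>G\<close> smooth away from the cone point. The polynomials
  \<open>c\<gamma> k\<close> and \<open>c\<l> w k\<close> homogenize \<open>\<gamma> k\<close> and \<open>\<l> w k\<close>. For \<open>d = m\<close> the cone itself is such a \<open>G\<close>, and \<open>h = 0\<close>.
\<close>

locale smoothing_family = chart i a idx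
  for i :: nat and a :: "nat \<Rightarrow> complex" and idx :: "3 \<Rightarrow> nat" +
  fixes F :: "nat cpoly" and d m N :: nat and \<Phi> :: "nat \<Rightarrow> complex^3 \<Rightarrow> complex"
    and Z :: "(complex^3) set" and \<gamma> :: "nat \<Rightarrow> complex^3 \<Rightarrow> complex"
    and \<l> :: "complex^3 \<Rightarrow> nat \<Rightarrow> complex^3 \<Rightarrow> complex"
    and lead h :: "complex^3 \<Rightarrow> complex"
    and c\<gamma> :: "nat \<Rightarrow> nat cpoly" and c\<l> :: "complex^3 \<Rightarrow> nat \<Rightarrow> nat cpoly" and G :: "nat cpoly"
  assumes F: "F \<in> forms {0..3} d" and m: "1 < m" "m \<le> d" "m \<le> N"
    and \<Phi>: "\<And>k. hform k (\<Phi> k)" and F_parts: "\<And>v. fn F v = (\<Sum>k=m..N. \<Phi> k v)"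
    and lead: "hform m lead" and lead_smooth: "\<And>v. grad lead v = 0 \<Longrightarrow> v = 0"
    and h: "hform d h" and h_trivial: "d = m \<Longrightarrow> h v = 0"
    and G_smooth: "\<And>l v. l ^ (d - m) *s grad lead v + grad h v = 0 \<Longrightarrow>
        of_nat (d - m) * l ^ (d - m - 1) * lead v = 0 \<Longrightarrow> v = 0"
    and \<gamma>: "\<And>k. hform k (\<gamma> k)" and \<l>: "\<And>w k. w \<in> Z \<Longrightarrow> hform k (\<l> w k)"
    and finite_Z: "finite Z"
    and Z_iff: "\<And>v. (\<Sum>k<m. \<gamma> k v) + lead v = 0 \<and> grad (\<lambda>v. (\<Sum>k<m. \<gamma> k v) + lead v) v = 0 \<longleftrightarrow> v \<in> Z"
    and c\<gamma>: "\<And>k. k < m \<Longrightarrow> c\<gamma> k \<in> forms {0..3} d"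
      "\<And>k l v. k < m \<Longrightarrow> eval_at (pt l v) (c\<gamma> k) = l ^ (d - k) * \<gamma> k v"
    and c\<l>: "\<And>w k. w \<in> Z \<Longrightarrow> k < m \<Longrightarrow> c\<l> w k \<in> forms {0..3} d"
      "\<And>w k l v. w \<in> Z \<Longrightarrow> k < m \<Longrightarrow> eval_at (pt l v) (c\<l> w k) = l ^ (d - k) * \<l> w k v"
    and G: "G \<in> forms {0..3} d" "\<And>l v. eval_at (pt l v) G = l ^ (d - m) * lead v + h v"
begin

definition surface :: "complex \<Rightarrow> real \<Rightarrow> (complex^3 \<Rightarrow> complex) \<Rightarrow> nat cpoly" where
  "surface s t c = (\<Sum>k<m. const_poly (of_real t ^ (m - k)) * (c\<gamma> k + (\<Sum>w\<in>Z. const_poly (c w) * c\<l> w k)))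
     + G + const_poly s * (F - G)"

text \<open>
  The equation of the surface with parameter \<open>t = \<rho> \<tau>\<close> at scale \<open>\<rho>\<close>, divided by \<open>\<rho>^m\<close>. For \<open>\<tau> = 1\<close> this is
  a perturbation of \<open>g\<close>; when \<open>\<tau>\<close> tends to \<open>0\<close> together with \<open>s\<close> and \<open>\<rho>\<close>, only the cone \<open>lead\<close> is left.
\<close>
definition rescaled :: "complex \<Rightarrow> (complex^3 \<Rightarrow> complex) \<Rightarrow> real \<Rightarrow> real \<Rightarrow> complex^3 \<Rightarrow> complex" where
  "rescaled s c \<rho> \<tau> v = (\<Sum>k<m. of_real \<tau> ^ (m - k) * (\<gamma> k v + (\<Sum>w\<in>Z. c w * \<l> w k v)))
     + (1 - s) * (lead v + of_real \<rho> ^ (d - m) * h v) + s * (\<Sum>k=m..N. of_real \<rho> ^ (k - m) * \<Phi> k v)"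

definition g :: "complex^3 \<Rightarrow> complex" where
  "g v = (\<Sum>k<m. \<gamma> k v) + lead v"

definition D :: nat where "D = N + d"

lemma polyfns: "k < m \<Longrightarrow> polyfn D (\<gamma> k)" "w \<in> Z \<Longrightarrow> k < m \<Longrightarrow> polyfn D (\<l> w k)"
  "polyfn D lead" "polyfn D h" "k \<le> N \<Longrightarrow> polyfn D (\<Phi> k)" "polyfn D g"
proof -
  show 1: "k < m \<Longrightarrow> polyfn D (\<gamma> k)" "w \<in> Z \<Longrightarrow> k < m \<Longrightarrow> polyfn D (\<l> w k)"
     "polyfn D lead" "polyfn D h" "k \<le> N \<Longrightarrow> polyfn D (\<Phi> k)" for k w
    using m by (auto simp: D_def intro: polyfn_hform[OF \<gamma>] polyfn_hform[OF \<l>] polyfn_hform[OF lead] polyfn_hform[OF h] polyfn_hform[OF \<Phi>])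
  show "polyfn D g" unfolding g_def[abs_def] by (intro polyfn_add polyfn_sum 1) auto
qed

lemma surface_forms: "surface s t c \<in> forms {0..3} d"
  unfolding surface_def
  by (intro forms_add forms_sum forms_const_mult forms_diff G F c\<gamma> c\<l>) auto

lemma eval_surface: "eval_at (pt l v) (surface s t c) =
    (\<Sum>k<m. of_real t ^ (m - k) * l ^ (d - k) * (\<gamma> k v + (\<Sum>w\<in>Z. c w * \<l> w k v)))
     + (1 - s) * (l ^ (d - m) * lead v + h v) + s * eval_at (pt l v) F"
proof -
  have "eval_at (pt l v) (surface s t c) =
    (\<Sum>k<m. of_real t ^ (m - k) * (eval_at (pt l v) (c\<gamma> k) + (\<Sum>w\<in>Z. c w * eval_at (pt l v) (c\<l> w k))))
     + (1 - s) * eval_at (pt l v) G + s * eval_at (pt l v) F"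
    unfolding surface_def by (simp add: eval_at_add eval_at_sum eval_at_mult eval_at_diff algebra_simps)
  moreover have "eval_at (pt l v) (c\<gamma> k) + (\<Sum>w\<in>Z. c w * eval_at (pt l v) (c\<l> w k)) =
     l ^ (d - k) * (\<gamma> k v + (\<Sum>w\<in>Z. c w * \<l> w k v))" if "k < m" for k
    using that by (simp add: c\<gamma> c\<l> distrib_left sum_distrib_left mult_ac cong: sum.cong)
  ultimately show ?thesis by (simp add: G mult.assoc)
qed

lemma fn_surface_scaled:
  "fn (surface s (\<rho> * \<tau>) c) (\<rho> *\<^sub>R v) = of_real \<rho> ^ m * rescaled s c \<rho> \<tau> v"
proof -
  have pw: "of_real \<rho> ^ k = (of_real \<rho> ^ m * of_real \<rho> ^ (k - m) :: complex)" if "m \<le> k" for k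
    using that by (simp add: power_add[symmetric])
  have pw': "(of_real \<rho> ^ (m - k) * of_real \<rho> ^ k :: complex) = of_real \<rho> ^ m" if "k < m" for k
    using that by (simp add: power_add[symmetric])
  have low: "of_real (\<rho> * \<tau>) ^ (m - k) * 1 ^ (d - k) * (\<gamma> k (\<rho> *\<^sub>R v) + (\<Sum>w\<in>Z. c w * \<l> w k (\<rho> *\<^sub>R v)))
    = of_real \<rho> ^ m * (of_real \<tau> ^ (m - k) * (\<gamma> k v + (\<Sum>w\<in>Z. c w * \<l> w k v)))" if k: "k < m" for k
  proof -
    have "\<gamma> k (\<rho> *\<^sub>R v) + (\<Sum>w\<in>Z. c w * \<l> w k (\<rho> *\<^sub>R v)) = of_real \<rho> ^ k * (\<gamma> k v + (\<Sum>w\<in>Z. c w * \<l> w k v))"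
      by (simp add: hform_scale[OF \<gamma>] hform_scale[OF \<l>] distrib_left sum_distrib_left mult_ac cong: sum.cong)
    then show ?thesis by (simp add: pw'[OF k, symmetric] power_mult_distrib mult_ac)
  qed
  have "fn (surface s (\<rho> * \<tau>) c) (\<rho> *\<^sub>R v) = (\<Sum>k<m. of_real \<rho> ^ m * (of_real \<tau> ^ (m - k) * (\<gamma> k v + (\<Sum>w\<in>Z. c w * \<l> w k v))))
     + (1 - s) * (of_real \<rho> ^ m * lead v + of_real \<rho> ^ d * h v) + s * (\<Sum>k=m..N. of_real \<rho> ^ k * \<Phi> k v)"
  proof -
    have fnF: "eval_at (pt 1 (\<rho> *\<^sub>R v)) F = (\<Sum>k=m..N. of_real \<rho> ^ k * \<Phi> k v)"
      using F_parts[of "\<rho> *\<^sub>R v"] unfolding fn_def hform_scale[OF \<Phi>] .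
    have "(\<Sum>k<m. of_real (\<rho> * \<tau>) ^ (m - k) * 1 ^ (d - k) * (\<gamma> k (\<rho> *\<^sub>R v) + (\<Sum>w\<in>Z. c w * \<l> w k (\<rho> *\<^sub>R v))))
      = (\<Sum>k<m. of_real \<rho> ^ m * (of_real \<tau> ^ (m - k) * (\<gamma> k v + (\<Sum>w\<in>Z. c w * \<l> w k v))))"
      by (intro sum.cong refl low) simp
    then show ?thesis unfolding fn_def eval_surface fnF hform_scale[OF lead] hform_scale[OF h] by simp
  qed
  also have "\<dots> = of_real \<rho> ^ m * rescaled s c \<rho> \<tau> v"
  proof -
    have "(\<Sum>k=m..N. of_real \<rho> ^ k * \<Phi> k v) = (\<Sum>k=m..N. of_real \<rho> ^ m * (of_real \<rho> ^ (k - m) * \<Phi> k v))"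
      by (intro sum.cong refl) (simp add: pw[symmetric] mult.assoc[symmetric])
    then show ?thesis unfolding rescaled_def
      by (simp add: sum_distrib_left distrib_left pw[OF m(2)] mult_ac)
  qed
  finally show ?thesis .
qed

lemma polyfn_surface: "polyfn d (fn (surface s t c))"
proof -
  have "polyfn 1 (\<lambda>v. pt 1 v j)" for j
    unfolding pt_def by (intro polyfn_add polyfn_const hform_polyfn hform_direction)
  then show ?thesis unfolding fn_def[abs_def] by (rule polyfn_eval_at[OF surface_forms])
qed

lemma polyfn_rescaled: "polyfn D (rescaled s c \<rho> \<tau>)"
  unfolding rescaled_def[abs_def]
  by (intro polyfn_add polyfn_cmult polyfn_sum polyfns) auto

lemma grad_surface_scaled:
  assumes "\<rho> > 0"
  shows "grad (fn (surface s (\<rho> * \<tau>) c)) (\<rho> *\<^sub>R v) = \<rho> ^ (m - 1) *\<^sub>R grad (rescaled s c \<rho> \<tau>) v"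
proof -
  have "\<rho> *\<^sub>R grad (fn (surface s (\<rho> * \<tau>) c)) (\<rho> *\<^sub>R v) = grad (\<lambda>v. fn (surface s (\<rho> * \<tau>) c) (\<rho> *\<^sub>R v)) v"
    by (rule grad_rescale[OF polyfn_surface, symmetric])
  also have "\<dots> = of_real \<rho> ^ m *s grad (rescaled s c \<rho> \<tau>) v"
    unfolding fn_surface_scaled by (rule grad_cmult[OF polyfn_rescaled])
  also have "\<dots> = \<rho> *\<^sub>R (\<rho> ^ (m - 1) *\<^sub>R grad (rescaled s c \<rho> \<tau>) v)"
    using m(1) by (cases m) (simp_all add: vec_eq_iff scaleR_conv_of_real[where 'a = complex])
  finally show ?thesis by (rule scaleR_left_imp_eq[rotated]) (use assms in simp)
qed

lemma surface_singular_scaled: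
  assumes "\<rho> > 0"
  shows "fn (surface s (\<rho> * \<tau>) c) (\<rho> *\<^sub>R v) = 0 \<and> grad (fn (surface s (\<rho> * \<tau>) c)) (\<rho> *\<^sub>R v) = 0
    \<longleftrightarrow> rescaled s c \<rho> \<tau> v = 0 \<and> grad (rescaled s c \<rho> \<tau>) v = 0"
  using assms by (simp add: fn_surface_scaled grad_surface_scaled)

lemma rescaled_converges:
  assumes s: "s \<longlonglongrightarrow> 0" and c: "\<And>w. w \<in> Z \<Longrightarrow> (\<lambda>n. c n w) \<longlonglongrightarrow> 0" and \<rho>: "\<rho> \<longlonglongrightarrow> 0" and \<tau>: "\<tau> \<longlonglongrightarrow> \<tau>'"
  shows "converges_with_grad D (\<lambda>n. rescaled (s n) (c n) (\<rho> n) (\<tau> n))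
    (\<lambda>v. (\<Sum>k<m. of_real \<tau>' ^ (m - k) * \<gamma> k v) + lead v)"
proof -
  have h: "converges_with_grad D (\<lambda>n v. of_real (\<rho> n) ^ (d - m) * h v) (\<lambda>v. 0)"
  proof (cases "d = m")
    case True
    then show ?thesis using h_trivial by (simp add: converges_const polyfn_const)
  next
    case False
    have "(\<lambda>n. of_real (\<rho> n) ^ (d - m) :: complex) \<longlonglongrightarrow> of_real 0 ^ (d - m)"
      by (intro tendsto_intros \<rho>)
    from converges_cmult[OF this converges_const[OF polyfns(4)]] False m(2) show ?thesis by (simp add: power_0_left)
  qed
  have "converges_with_grad D (\<lambda>n. rescaled (s n) (c n) (\<rho> n) (\<tau> n))
    (\<lambda>v. (\<Sum>k<m. of_real \<tau>' ^ (m - k) * (\<gamma> k v + (\<Sum>w\<in>Z. 0 * \<l> w k v)))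
     + (1 - 0) * (lead v + 0) + 0 * (\<Sum>k=m..N. of_real 0 ^ (k - m) * \<Phi> k v))"
    unfolding rescaled_def
    by (intro converges_add converges_sum converges_cmult converges_const h c tendsto_intros s \<rho> \<tau> polyfns) auto
  then show ?thesis by simp
qed

lemma eval_pt_l_deriv:
  assumes "P \<in> forms {0..3} d"
  shows "((\<lambda>l. eval_at (pt l v) P) has_field_derivative (\<Sum>j\<in>{0..3}. a j * eval_at (pt l v) (partial_deriv j P))) (at l)"
proof -
  have "((\<lambda>l. eval_at (pt l v) P) has_derivative (\<lambda>h. \<Sum>j\<in>{0..3}. (h * a j) * eval_at (pt l v) (partial_deriv j P))) (at l)"
    by (rule eval_at_has_derivative[OF _ assms]) (auto simp: pt_def intro!: derivative_eq_intros)
  then show ?thesis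
    unfolding has_field_derivative_def
    by (rule has_derivative_eq_rhs) (simp add: fun_eq_iff sum_distrib_left mult_ac)
qed

lemma tendsto_eval_pt:
  assumes "l \<longlonglongrightarrow> l'" "v \<longlonglongrightarrow> v'"
  shows "(\<lambda>n. eval_at (pt (l n) (v n)) P) \<longlonglongrightarrow> eval_at (pt l' v') P"
proof -
  have "continuous_on UNIV (\<lambda>x. eval_at (pt (fst x) (snd x)) P)"
    unfolding pt_def
    by (intro eval_at_continuous continuous_intros continuous_on_compose2[OF polyfn_continuous[OF hform_polyfn[OF hform_direction]]]) auto
  then have "isCont (\<lambda>x. eval_at (pt (fst x) (snd x)) P) (l', v')"
    by (simp add: continuous_on_eq_continuous_at)
  from isCont_tendsto_compose[OF this tendsto_Pair[OF assms]] show ?thesis by simp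
qed

text \<open>At unit scale the limit surface is \<open>G\<close>, and a limit of singular points is singular on it.\<close>

lemma limit_at_unit_scale:
  assumes s: "s \<longlonglongrightarrow> 0" and t: "t \<longlonglongrightarrow> 0" and c: "\<And>w. w \<in> Z \<Longrightarrow> (\<lambda>n. c n w) \<longlonglongrightarrow> 0"
    and l: "l \<longlonglongrightarrow> l'" and v: "v \<longlonglongrightarrow> v'"
    and sing: "\<And>n j. j \<in> {0..3} \<Longrightarrow> eval_at (pt (l n) (v n)) (partial_deriv j (surface (s n) (t n) (c n))) = 0"
  shows "v' = 0"
proof (rule G_smooth)
  define E where "E n v = eval_at (pt (l n) v) (surface (s n) (t n) (c n))" for n v
  have t0: "(\<lambda>n. of_real (t n) ^ (m - k) :: complex) \<longlonglongrightarrow> 0" if "k < m" for k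
  proof -
    have "(\<lambda>n. of_real (t n) ^ (m - k) :: complex) \<longlonglongrightarrow> of_real 0 ^ (m - k)" by (intro tendsto_intros t)
    then show ?thesis using that by (simp add: power_0_left)
  qed
  have pF: "polyfn D (\<lambda>v. eval_at (pt l v) F)" for l
  proof -
    have "polyfn 1 (\<lambda>v. pt l v j)" for j
      unfolding pt_def by (intro polyfn_add polyfn_const hform_polyfn hform_direction)
    then have "polyfn d (\<lambda>v. eval_at (pt l v) F)" by (rule polyfn_eval_at[OF F])
    then show ?thesis by (rule polyfn_mono) (simp add: D_def)
  qed
  have cF: "converges_with_grad D (\<lambda>n v. eval_at (pt (l n) v) F) (\<lambda>v. eval_at (pt l' v) F)"
    unfolding converges_with_grad_def
  proof (intro conjI allI impI pF)
    fix u u' assume u: "u \<longlonglongrightarrow> (u' :: complex^3)"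
    show "(\<lambda>n. eval_at (pt (l n) (u n)) F) \<longlonglongrightarrow> eval_at (pt l' u') F" by (rule tendsto_eval_pt[OF l u])
    show "(\<lambda>n. grad (\<lambda>v. eval_at (pt (l n) v) F) (u n)) \<longlonglongrightarrow> grad (\<lambda>v. eval_at (pt l' v) F) u'"
      unfolding grad_eval_pt[OF F] by (rule vec_tendstoI) (simp add: tendsto_eval_pt[OF l u])
  qed
  have "converges_with_grad D E (\<lambda>v. (\<Sum>k<m. (0 * l' ^ (d - k)) * (\<gamma> k v + (\<Sum>w\<in>Z. 0 * \<l> w k v)))
     + (1 - 0) * (l' ^ (d - m) * lead v + h v) + 0 * eval_at (pt l' v) F)"
    unfolding E_def[abs_def] eval_surface
    by (intro converges_add converges_sum converges_cmult converges_const cF c tendsto_intros s l t0 polyfns) auto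
  then have "converges_with_grad D E (\<lambda>v. l' ^ (d - m) * lead v + h v)" by simp
  from converges_with_gradD(2)[OF this v]
  have "(\<lambda>n. grad (E n) (v n)) \<longlonglongrightarrow> grad (\<lambda>v. l' ^ (d - m) * lead v + h v) v'" .
  moreover have "grad (E n) (v n) = 0" for n
    using sing idx_in unfolding E_def[abs_def] grad_eval_pt[OF surface_forms] by (simp add: vec_eq_iff)
  ultimately have "grad (\<lambda>v. l' ^ (d - m) * lead v + h v) v' = 0" by (simp add: LIMSEQ_const_iff)
  then show "l' ^ (d - m) *s grad lead v' + grad h v' = 0"
    by (simp add: grad_add[OF polyfn_cmult[OF polyfns(3)] polyfns(4)] grad_cmult[OF polyfns(3)])
  \<comment> \<open>The derivative in the direction of \<open>a\<close>, computed from the explicit equation.\<close>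
  have dl: "(\<Sum>j\<in>{0..3}. a j * eval_at (pt l v) (partial_deriv j (surface s t c))) =
     (\<Sum>k<m. of_real t ^ (m - k) * (of_nat (d - k) * l ^ (d - k - 1)) * (\<gamma> k v + (\<Sum>w\<in>Z. c w * \<l> w k v)))
     + (1 - s) * (of_nat (d - m) * l ^ (d - m - 1) * lead v) + s * (\<Sum>j\<in>{0..3}. a j * eval_at (pt l v) (partial_deriv j F))"
    for l v s t c
  proof (rule DERIV_unique[OF eval_pt_l_deriv[OF surface_forms]])
    show "((\<lambda>l. eval_at (pt l v) (surface s t c)) has_field_derivative
     (\<Sum>k<m. of_real t ^ (m - k) * (of_nat (d - k) * l ^ (d - k - 1)) * (\<gamma> k v + (\<Sum>w\<in>Z. c w * \<l> w k v)))
     + (1 - s) * (of_nat (d - m) * l ^ (d - m - 1) * lead v) + s * (\<Sum>j\<in>{0..3}. a j * eval_at (pt l v) (partial_deriv j F))) (at l)"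
      unfolding eval_surface
      by (rule derivative_eq_intros refl eval_pt_l_deriv[OF F])+ (simp add: mult_ac)
  qed
  have "(\<lambda>n. \<Sum>j\<in>{0..3}. a j * eval_at (pt (l n) (v n)) (partial_deriv j (surface (s n) (t n) (c n)))) \<longlonglongrightarrow>
     (\<Sum>k<m. 0 * (of_nat (d - k) * l' ^ (d - k - 1)) * (\<gamma> k v' + (\<Sum>w\<in>Z. 0 * \<l> w k v')))
     + (1 - 0) * (of_nat (d - m) * l' ^ (d - m - 1) * lead v') + 0 * (\<Sum>j\<in>{0..3}. a j * eval_at (pt l' v') (partial_deriv j F))"
    unfolding dl
    by (intro tendsto_intros s l t0 c tendsto_eval_pt[OF l v] polyfn_tendsto[OF _ v, where N = D] polyfns) auto
  then show "of_nat (d - m) * l' ^ (d - m - 1) * lead v' = 0"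
    by (simp add: sing LIMSEQ_const_iff)
qed

text \<open>
  The scale \<open>\<rho>\<close> is the larger one of \<open>t\<close> and the distance to \<open>a\<close>. If \<open>\<tau> = t / \<rho>\<close> tends to \<open>0\<close>, then the rescaled
  points have norm \<open>1\<close> and tend to a singular point of the smooth tangent cone, which is absurd.
  Otherwise they tend to a singular point of \<open>g\<close>, up to the factor \<open>\<tau>\<close>.
\<close>

lemma limit_at_small_scale:
  assumes s: "s \<longlonglongrightarrow> 0" and t: "t \<longlonglongrightarrow> 0" and c: "\<And>w. w \<in> Z \<Longrightarrow> (\<lambda>n. c n w) \<longlonglongrightarrow> 0"
    and tpos: "\<And>n. t n > 0" and w: "w \<longlonglongrightarrow> 0"
    and sing: "\<And>n. fn (surface (s n) (t n) (c n)) (w n) = 0 \<and> grad (fn (surface (s n) (t n) (c n))) (w n) = 0"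
  shows "\<exists>r z. strict_mono r \<and> z \<in> Z \<and> (\<lambda>n. (1 / t (r n)) *\<^sub>R w (r n)) \<longlonglongrightarrow> z"
proof -
  define \<rho> where "\<rho> n = max (t n) (norm (w n))" for n
  define \<tau> where "\<tau> n = t n / \<rho> n" for n
  define u where "u n = (1 / \<rho> n) *\<^sub>R w n" for n
  have \<rho>: "\<rho> n > 0" for n using tpos[of n] by (simp add: \<rho>_def)
  have \<tau>: "0 < \<tau> n" "\<tau> n \<le> 1" for n using tpos[of n] \<rho>[of n] by (auto simp: \<tau>_def \<rho>_def)
  have u: "norm (u n) \<le> 1" for n using \<rho>[of n] by (simp add: u_def \<rho>_def)
  have \<rho>0: "\<rho> \<longlonglongrightarrow> 0"
    using tendsto_max[OF t tendsto_norm[OF w]] by (simp add: \<rho>_def[abs_def])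
  have sc: "rescaled (s n) (c n) (\<rho> n) (\<tau> n) (u n) = 0 \<and> grad (rescaled (s n) (c n) (\<rho> n) (\<tau> n)) (u n) = 0" for n
    using surface_singular_scaled[OF \<rho>[of n], of "s n" "\<tau> n" "c n" "u n"] sing[of n] \<rho>[of n] by (simp add: \<tau>_def u_def)
  have "compact ({0..1::real} \<times> cball (0 :: complex^3) 1)" by (intro compact_Times) auto
  moreover have "\<forall>n. (\<tau> n, u n) \<in> {0..1::real} \<times> cball (0 :: complex^3) 1"
    using \<tau> u by (auto intro: less_imp_le)
  ultimately obtain p r where p: "p \<in> {0..1::real} \<times> cball (0 :: complex^3) 1" and r: "strict_mono r"
    and lim: "((\<lambda>n. (\<tau> n, u n)) \<circ> r) \<longlonglongrightarrow> p" unfolding compact_def by meson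
  obtain \<tau>' u' where p': "p = (\<tau>', u')" by force
  have \<tau>l: "(\<lambda>n. \<tau> (r n)) \<longlonglongrightarrow> \<tau>'" and ul: "(\<lambda>n. u (r n)) \<longlonglongrightarrow> u'"
    using tendsto_fst[OF lim] tendsto_snd[OF lim] by (simp_all add: p' o_def)
  have sub: "(\<lambda>n. x (r n)) \<longlonglongrightarrow> y" if "x \<longlonglongrightarrow> y" for x :: "nat \<Rightarrow> 'x::topological_space" and y
    using LIMSEQ_subseq_LIMSEQ[OF that r] by (simp add: o_def)
  let ?E = "\<lambda>v. (\<Sum>k<m. of_real \<tau>' ^ (m - k) * \<gamma> k v) + lead v"
  have conv: "converges_with_grad D (\<lambda>n. rescaled (s (r n)) (c (r n)) (\<rho> (r n)) (\<tau> (r n))) ?E"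
    by (rule rescaled_converges) (use LIMSEQ_subseq_LIMSEQ[OF s r] LIMSEQ_subseq_LIMSEQ[OF \<rho>0 r]
       LIMSEQ_subseq_LIMSEQ[OF c r] \<tau>l in \<open>auto simp: o_def\<close>)
  have E0: "?E u' = 0" "grad ?E u' = 0"
    using converges_with_gradD[OF conv ul] sc by (simp_all add: LIMSEQ_const_iff)
  have \<tau>'0: "\<tau>' \<noteq> 0"
  proof
    assume \<tau>': "\<tau>' = 0"
    have "?E = lead" using \<tau>' by (simp add: fun_eq_iff power_0_left)
    then have "u' = 0" using E0(2) lead_smooth by simp
    moreover have "norm u' = 1"
    proof (rule LIMSEQ_unique[OF tendsto_norm[OF ul]])
      have "eventually (\<lambda>n. \<tau> (r n) < 1) sequentially"
        using order_tendstoD(2)[OF \<tau>l] \<tau>' by simp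
      then have "eventually (\<lambda>n. norm (u (r n)) = 1) sequentially"
      proof eventually_elim
        case (elim n)
        then have "t (r n) < \<rho> (r n)" using \<rho>[of "r n"] by (simp add: \<tau>_def)
        then have "\<rho> (r n) = norm (w (r n))" by (auto simp: \<rho>_def max_def split: if_splits)
        then show ?case using \<rho>[of "r n"] by (simp add: u_def)
      qed
      then show "(\<lambda>n. norm (u (r n))) \<longlonglongrightarrow> 1" by (rule tendsto_eventually)
    qed
    ultimately show False by simp
  qed
  have \<tau>'pos: "\<tau>' > 0" using p p' \<tau>'0 by auto
  define z where "z = (1 / \<tau>') *\<^sub>R u'"
  have Eg: "?E (\<tau>' *\<^sub>R v) = of_real \<tau>' ^ m * g v" for v
  proof -
    have "of_real \<tau>' ^ (m - k) * \<gamma> k (\<tau>' *\<^sub>R v) = of_real \<tau>' ^ m * \<gamma> k v" if "k < m" for k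
      using that by (simp add: hform_scale[OF \<gamma>] mult.assoc[symmetric] power_add[symmetric])
    then have "(\<Sum>k<m. of_real \<tau>' ^ (m - k) * \<gamma> k (\<tau>' *\<^sub>R v)) = (\<Sum>k<m. of_real \<tau>' ^ m * \<gamma> k v)"
      by (intro sum.cong refl) simp
    then show ?thesis by (simp add: g_def hform_scale[OF lead] distrib_left sum_distrib_left)
  qed
  have pE: "polyfn D ?E" using conv by (simp add: converges_with_grad_def)
  have u'z: "u' = \<tau>' *\<^sub>R z" using \<tau>'0 by (simp add: z_def)
  have "of_real \<tau>' ^ m *s grad g z = grad (\<lambda>v. ?E (\<tau>' *\<^sub>R v)) z"
    unfolding Eg by (rule grad_cmult[OF polyfns(6), symmetric])
  also have "\<dots> = 0" unfolding grad_rescale[OF pE] using E0(2) u'z by simp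
  finally have "grad g z = 0" using \<tau>'0 by (simp add: vec_eq_iff)
  moreover have "g z = 0" using Eg[of z] E0(1) u'z \<tau>'0 by simp
  ultimately have "z \<in> Z" using Z_iff[of z] by (simp add: g_def[abs_def])
  moreover have "(\<lambda>n. (1 / t (r n)) *\<^sub>R w (r n)) \<longlonglongrightarrow> z"
  proof -
    have "(\<lambda>n. (1 / \<tau> (r n)) *\<^sub>R u (r n)) \<longlonglongrightarrow> z"
      unfolding z_def by (intro tendsto_intros \<tau>l ul \<tau>'0)
    moreover have "(1 / \<tau> n) *\<^sub>R u n = (1 / t n) *\<^sub>R w n" for n
      using \<rho>[of n] by (simp add: \<tau>_def u_def)
    ultimately show ?thesis by simp
  qed
  ultimately show ?thesis using r by blast
qed

end

context smoothing_family
begin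

text \<open>
  Homogeneous coordinates of norm \<open>1\<close> have a convergent subsequence. Its limit is a multiple of \<open>a\<close>, so the
  points finally lie in the chart and tend to its origin.
\<close>

lemma singular_limit:
  assumes s: "s \<longlonglongrightarrow> 0" and t: "t \<longlonglongrightarrow> 0" and c: "\<And>w. w \<in> Z \<Longrightarrow> (\<lambda>n. c n w) \<longlonglongrightarrow> 0"
    and tpos: "\<And>n. t n > 0" and x: "\<And>n. x n \<in> singular_points {0..3} (surface (s n) (t n) (c n))"
  shows "\<exists>r y z. strict_mono r \<and> z \<in> Z \<and> y \<longlonglongrightarrow> z \<and> (\<forall>n. x (r n) = proj_point (pt 1 (t (r n) *\<^sub>R y n)))"
proof -
  have "\<exists>p. norm p = 1 \<and> x n = proj_point (pt (fst p) (snd p)) \<and>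
      (\<forall>j\<in>{0..3}. eval_at (pt (fst p) (snd p)) (partial_deriv j (surface (s n) (t n) (c n))) = 0)" for n
  proof -
    from x[of n] have "x n \<in> proj_space {0..3}" by (simp add: singular_points_def)
    then obtain b where b: "x n = proj_point b" "\<forall>j. j \<notin> {0..3} \<longrightarrow> b j = 0" "\<exists>j\<in>{0..3}. b j \<noteq> 0"
      unfolding proj_space_def by blast
    obtain v where v: "b = pt (b i) v" using pt_surj b(2) by blast
    define \<nu> where "\<nu> = norm (b i, v)"
    have "(b i, v) \<noteq> 0"
    proof
      assume "(b i, v) = 0"
      then have "b i = 0" "v = 0" by (simp_all add: zero_prod_def)
      then have "b j = 0" for j using fun_cong[OF v, of j] by (simp add: pt_def direction_def)
      with b(3) show False by blast
    qed
    then have \<nu>: "\<nu> > 0" by (simp add: \<nu>_def)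
    let ?c = "of_real (1 / \<nu>) :: complex"
    have p: "pt (?c * b i) (?c *s v) = (\<lambda>j. ?c * b j)" unfolding pt_scale using v by simp
    have xn: "x n = proj_point (pt (?c * b i) (?c *s v))"
      unfolding p b(1) by (rule proj_point_scale[symmetric]) (use \<nu> in simp)
    have "(?c * b i, ?c *s v) = (1 / \<nu>) *\<^sub>R (b i, v)"
      by (simp add: vec_eq_iff scaleR_conv_of_real[where 'a = complex])
    then have "norm (?c * b i, ?c *s v) = 1" using \<nu> by (simp only: norm_scaleR \<nu>_def[symmetric]) simp
    moreover have "eval_at (pt (?c * b i) (?c *s v)) (partial_deriv j (surface (s n) (t n) (c n))) = 0" if "j \<in> {0..3}" for j
    proof (rule singular_point_representative(5)[OF x[of n] _ that])
      show "pt (?c * b i) (?c *s v) \<in> x n" unfolding xn by (rule proj_point_self)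
    qed
    ultimately show ?thesis using xn
      by (intro exI[of _ "(?c * b i, ?c *s v)"] conjI ballI) (simp_all only: fst_conv snd_conv)
  qed
  then have "\<forall>n. \<exists>p. norm p = 1 \<and> x n = proj_point (pt (fst p) (snd p)) \<and>
      (\<forall>j\<in>{0..3}. eval_at (pt (fst p) (snd p)) (partial_deriv j (surface (s n) (t n) (c n))) = 0)" by blast
  from choice[OF this] obtain p where p: "\<forall>n. norm (p n) = 1 \<and> x n = proj_point (pt (fst (p n)) (snd (p n))) \<and>
      (\<forall>j\<in>{0..3}. eval_at (pt (fst (p n)) (snd (p n))) (partial_deriv j (surface (s n) (t n) (c n))) = 0)" by (rule exE)
  have cpt: "compact (sphere (0 :: complex \<times> (complex^3)) 1)" by simp
  have "\<forall>n. p n \<in> sphere 0 1" using p by simp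
  then have "\<exists>l\<in>sphere 0 1. \<exists>r. strict_mono r \<and> (p \<circ> r) \<longlonglongrightarrow> l"
    by (rule cpt[unfolded compact_def, THEN spec[of _ p], THEN mp])
  then obtain p' r1 where p': "p' \<in> sphere 0 1" and r1: "strict_mono r1" and lim: "(p \<circ> r1) \<longlonglongrightarrow> p'"
    by blast
  have lv: "(\<lambda>n. fst (p (r1 n))) \<longlonglongrightarrow> fst p'" "(\<lambda>n. snd (p (r1 n))) \<longlonglongrightarrow> snd p'"
    using tendsto_fst[OF lim] tendsto_snd[OF lim] by (simp_all add: o_def)
  have sub: "(\<lambda>n. s (r n)) \<longlonglongrightarrow> 0" "(\<lambda>n. t (r n)) \<longlonglongrightarrow> 0" "w \<in> Z \<Longrightarrow> (\<lambda>n. c (r n) w) \<longlonglongrightarrow> 0"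
    if "strict_mono r" for r :: "nat \<Rightarrow> nat" and w
    using LIMSEQ_subseq_LIMSEQ[OF s that] LIMSEQ_subseq_LIMSEQ[OF t that] LIMSEQ_subseq_LIMSEQ[OF c that]
    by (simp_all add: o_def)
  have v0: "snd p' = 0"
    by (rule limit_at_unit_scale[OF sub(1,2)[OF r1] sub(3)[OF r1] lv]) (use p in auto)
  have l0: "fst p' \<noteq> 0"
  proof
    assume "fst p' = 0"
    with v0 have "p' = 0" by (simp add: prod_eq_iff)
    with p' show False by simp
  qed
  have "eventually (\<lambda>n. fst (p (r1 n)) \<noteq> 0) sequentially"
    by (rule tendsto_imp_eventually_ne[OF lv(1) l0])
  then obtain n0 where n0: "\<And>n. n \<ge> n0 \<Longrightarrow> fst (p (r1 n)) \<noteq> 0" by (auto simp: eventually_sequentially)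
  define r2 where "r2 n = r1 (n + n0)" for n
  have r2: "strict_mono r2" using r1 by (auto simp: strict_mono_def r2_def)
  define w where "w n = (1 / fst (p (r2 n))) *s snd (p (r2 n))" for n
  have "w \<longlonglongrightarrow> (1 / fst p') *s snd p'"
    unfolding w_def[abs_def] r2_def
    by (intro tendsto_vector_smult tendsto_divide tendsto_const l0
        LIMSEQ_ignore_initial_segment[OF lv(1)] LIMSEQ_ignore_initial_segment[OF lv(2)])
  then have w0: "w \<longlonglongrightarrow> 0" by (simp add: v0)
  have xw: "x (r2 n) = proj_point (pt 1 (w n))" for n
  proof -
    have nz: "fst (p (r2 n)) \<noteq> 0" using n0 by (simp add: r2_def)
    have "pt 1 (w n) = (\<lambda>j. 1 / fst (p (r2 n)) * pt (fst (p (r2 n))) (snd (p (r2 n))) j)"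
      unfolding pt_scale[symmetric] w_def using nz by simp
    then have "proj_point (pt 1 (w n)) = proj_point (pt (fst (p (r2 n))) (snd (p (r2 n))))"
      using nz by (simp only: proj_point_scale divide_eq_0_iff one_neq_zero simp_thms)
    then show ?thesis using p by simp
  qed
  have sing: "fn (surface (s (r2 n)) (t (r2 n)) (c (r2 n))) (w n) = 0 \<and> grad (fn (surface (s (r2 n)) (t (r2 n)) (c (r2 n)))) (w n) = 0" for n
    using x[of "r2 n"] unfolding xw singular_point_iff[OF surface_forms] .
  from limit_at_small_scale[OF sub(1,2)[OF r2] sub(3)[OF r2] tpos w0 sing]
  obtain r3 z where r3: "strict_mono r3" "z \<in> Z" "(\<lambda>n. (1 / t (r2 (r3 n))) *\<^sub>R w (r3 n)) \<longlonglongrightarrow> z" by blast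
  have "x (r2 (r3 n)) = proj_point (pt 1 (t (r2 (r3 n)) *\<^sub>R ((1 / t (r2 (r3 n))) *\<^sub>R w (r3 n))))" for n
    using tpos[of "r2 (r3 n)"] xw by simp
  moreover have "strict_mono (\<lambda>n. r2 (r3 n))" using strict_mono_o[OF r2 r3(1)] by (simp add: o_def)
  ultimately show ?thesis using r3(2,3) by blast
qed

end

section \<open>The singular points of the deformed surfaces\<close>

locale nodal_smoothing = smoothing_family +
  assumes interpolation: "\<And>w z. w \<in> Z \<Longrightarrow> z \<in> Z \<Longrightarrow> (\<Sum>k<m. \<l> w k z) = of_bool (w = z)"
    and nondegenerate: "\<And>z u. z \<in> Z \<Longrightarrow> hess (\<lambda>v. (\<Sum>k<m. \<gamma> k v) + lead v) z u = 0 \<Longrightarrow> u = 0"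
begin

text \<open>
  All perturbations of \<open>g\<close> in one list: the parts of \<open>F\<close>, and \<open>h\<close> and \<open>lead\<close> at the two indices after \<open>N\<close>.
\<close>
definition pert :: "nat \<Rightarrow> complex^3 \<Rightarrow> complex" where
  "pert k = (if k \<le> N then \<Phi> k else if k = N + 1 then h else lead)"

text \<open>
  For \<open>d = m\<close> the power \<open>t^(d - m)\<close> is not small, but then \<open>h = 0\<close>.
\<close>
definition pert_coeff :: "complex \<Rightarrow> real \<Rightarrow> nat \<Rightarrow> complex" where
  "pert_coeff s t k = (if k \<le> N then s * of_real t ^ (k - m) else if k = N + 1 then
     (if d = m then 0 else (1 - s) * of_real t ^ (d - m)) else - s)"

interpretation nodal: nodal_function g Z "\<lambda>w v. \<Sum>k<m. \<l> w k v" pert "{m..N + 2}" D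
proof
  show "polyfn D g" by (rule polyfns)
  show "g z = 0" "grad g z = 0" if "z \<in> Z" for z
    using that Z_iff[of z] by (simp_all add: g_def[abs_def])
  show "u = 0" if "z \<in> Z" "hess g z u = 0" for z u
    using nondegenerate[OF that(1), of u] that(2) by (simp add: g_def[abs_def])
  show "polyfn D (\<lambda>v. \<Sum>k<m. \<l> w k v)" if "w \<in> Z" for w
    using that by (intro polyfn_sum polyfns) auto
  show "polyfn D (pert k)" if "k \<in> {m..N + 2}" for k
    by (simp add: pert_def polyfns)
qed (use finite_Z interpolation in auto)

lemma rescaled_eq_perturbed: "rescaled s c t 1 = nodal.perturbed (pert_coeff s t) c"
proof
  fix v
  have th: "(if d = m then 0 else (1 - s) * of_real t ^ (d - m)) * h v = (1 - s) * of_real t ^ (d - m) * h v"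
    using h_trivial by auto
  have "{m..N + 2} = insert (N + 2) (insert (N + 1) {m..N})" using m(3) by auto
  then have "(\<Sum>k=m..N + 2. pert_coeff s t k * pert k v) =
     - s * lead v + ((1 - s) * of_real t ^ (d - m) * h v + (\<Sum>k=m..N. pert_coeff s t k * pert k v))"
    by (simp add: pert_coeff_def pert_def th[simplified])
  moreover have "(\<Sum>k=m..N. pert_coeff s t k * pert k v) = s * (\<Sum>k=m..N. of_real t ^ (k - m) * \<Phi> k v)"
    unfolding sum_distrib_left by (intro sum.cong refl) (simp add: pert_coeff_def pert_def)
  moreover have "(\<Sum>k<m. \<Sum>w\<in>Z. c w * \<l> w k v) = (\<Sum>w\<in>Z. c w * (\<Sum>k<m. \<l> w k v))"
    unfolding sum_distrib_left by (rule sum.swap)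
  ultimately show "rescaled s c t 1 v = nodal.perturbed (pert_coeff s t) c v"
    unfolding rescaled_def nodal.perturbed_def g_def by (simp add: sum.distrib algebra_simps)
qed

lemma pert_coeff_small:
  assumes "norm s \<le> 1" "0 < t" "t \<le> 1"
  shows "(\<Sum>k=m..N + 2. norm (pert_coeff s t k)) \<le> real (N + 3) * (norm s + 2 * t)"
proof -
  have "norm (pert_coeff s t k) \<le> norm s + 2 * t" for k
  proof -
    have 1: "norm (s * of_real t ^ j) \<le> norm s + 2 * t" for j
    proof -
      have "norm s * t ^ j \<le> norm s * 1" using assms by (intro mult_left_mono power_le_one) auto
      then show ?thesis using assms by (simp add: norm_mult norm_power)
    qed
    have 2: "norm ((1 - s) * of_real t ^ (d - m)) \<le> norm s + 2 * t" if "d \<noteq> m"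
    proof -
      have "norm (1 - s) \<le> 2" using norm_triangle_ineq4[of 1 s] assms by simp
      moreover have "t ^ (d - m) \<le> t ^ 1" using that m(2) assms by (intro power_decreasing) auto
      ultimately have "norm (1 - s) * t ^ (d - m) \<le> 2 * t" using assms by (intro mult_mono) auto
      then show ?thesis using assms norm_ge_zero[of s] by (simp add: norm_mult norm_power del: norm_ge_zero)
    qed
    show ?thesis unfolding pert_coeff_def using 1 2 assms by auto
  qed
  then have "(\<Sum>k=m..N + 2. norm (pert_coeff s t k)) \<le> (\<Sum>k=m..N + 2. norm s + 2 * t)" by (intro sum_mono)
  also have "\<dots> = real (card {m..N + 2}) * (norm s + 2 * t)" by simp
  also have "\<dots> \<le> real (N + 3) * (norm s + 2 * t)" using assms by (intro mult_right_mono) auto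
  finally show ?thesis .
qed

lemma pert_coeff_eventually_small:
  assumes "\<sigma> > 0"
  shows "\<exists>\<epsilon>>0. \<forall>s t. norm s < \<epsilon> \<longrightarrow> 0 < t \<longrightarrow> t < \<epsilon> \<longrightarrow> (\<Sum>k=m..N + 2. norm (pert_coeff s t k)) \<le> \<sigma>"
proof -
  define \<epsilon> where "\<epsilon> = min 1 (\<sigma> / (3 * real (N + 3)))"
  have "(\<Sum>k=m..N + 2. norm (pert_coeff s t k)) \<le> \<sigma>" if st: "norm s < \<epsilon>" "0 < t" "t < \<epsilon>" for s t
  proof -
    have "(\<Sum>k=m..N + 2. norm (pert_coeff s t k)) \<le> real (N + 3) * (norm s + 2 * t)"
      by (rule pert_coeff_small) (use st in \<open>auto simp: \<epsilon>_def\<close>)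
    also have "\<dots> \<le> real (N + 3) * (3 * \<epsilon>)" using st by (intro mult_left_mono) auto
    also have "\<dots> \<le> real (N + 3) * (3 * (\<sigma> / (3 * real (N + 3))))" by (intro mult_left_mono) (auto simp: \<epsilon>_def)
    also have "\<dots> = \<sigma>" by (simp add: field_simps)
    finally show ?thesis .
  qed
  moreover have "\<epsilon> > 0" using assms by (simp add: \<epsilon>_def)
  ultimately show ?thesis by blast
qed

lemma surface_singular_iff:
  assumes "t > 0"
  shows "proj_point (pt 1 (t *\<^sub>R v)) \<in> singular_points {0..3} (surface s t c) \<longleftrightarrow>
    nodal.perturbed (pert_coeff s t) c v = 0 \<and> grad (nodal.perturbed (pert_coeff s t) c) v = 0"
  using surface_singular_scaled[OF assms, of s 1 c v]
  unfolding singular_point_iff[OF surface_forms] rescaled_eq_perturbed by simp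

text \<open>
  Otherwise there are parameters tending to \<open>0\<close> with singular points other than those at \<open>q\<close>. At scale
  \<open>t\<close> these tend to some node \<open>z\<close>, as do the points \<open>q z\<close>. Both are critical points of the same perturbed
  function, which has at most one near \<open>z\<close>.
\<close>

lemma all_singular_points:
  "\<exists>\<eta>>0. \<forall>s t c q. norm s < \<eta> \<longrightarrow> 0 < t \<longrightarrow> t < \<eta> \<longrightarrow>
     (\<forall>z\<in>Z. norm (c z) < \<eta> \<and> norm (q z - z) < \<eta> \<and> grad (nodal.perturbed (pert_coeff s t) c) (q z) = 0) \<longrightarrow>
     singular_points {0..3} (surface s t c) \<subseteq> (\<lambda>z. proj_point (pt 1 (t *\<^sub>R q z))) ` Z"
proof (rule ccontr)
  assume neg: "\<not> ?thesis"
  define bad where "bad n p \<longleftrightarrow> (case p of (s, t, c, q, x) \<Rightarrow> norm s < 1 / real (Suc n) \<and> 0 < t \<and> t < 1 / real (Suc n) \<and>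
     (\<forall>z\<in>Z. norm (c z) < 1 / real (Suc n) \<and> norm (q z - z) < 1 / real (Suc n) \<and>
        grad (nodal.perturbed (pert_coeff s t) c) (q z) = 0) \<and>
     x \<in> singular_points {0..3} (surface s t c) \<and> x \<notin> (\<lambda>z. proj_point (pt 1 (t *\<^sub>R q z))) ` Z)" for n p
  have "\<exists>p. bad n p" for n
  proof -
    have "1 / real (Suc n) > 0" by simp
    with neg obtain s t c q where stcq: "norm s < 1 / real (Suc n)" "0 < t" "t < 1 / real (Suc n)"
     "\<forall>z\<in>Z. norm (c z) < 1 / real (Suc n) \<and> norm (q z - z) < 1 / real (Suc n) \<and>
        grad (nodal.perturbed (pert_coeff s t) c) (q z) = 0"
     "\<not> singular_points {0..3} (surface s t c) \<subseteq> (\<lambda>z. proj_point (pt 1 (t *\<^sub>R q z))) ` Z" by metis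
    from stcq(5) obtain x where "x \<in> singular_points {0..3} (surface s t c)" "x \<notin> (\<lambda>z. proj_point (pt 1 (t *\<^sub>R q z))) ` Z"
      unfolding subset_iff by blast
    with stcq(1-4) have "bad n (s, t, c, q, x)" unfolding bad_def prod.case by blast
    then show ?thesis by (rule exI)
  qed
  then have "\<forall>n. \<exists>p. bad n p" by blast
  from choice[OF this] obtain p where p: "\<forall>n. bad n (p n)" by (rule exE)
  define s where "s n = fst (p n)" for n
  define t where "t n = fst (snd (p n))" for n
  define c where "c n = fst (snd (snd (p n)))" for n
  define q where "q n = fst (snd (snd (snd (p n))))" for n
  define x where "x n = snd (snd (snd (snd (p n))))" for n
  have "p n = (s n, t n, c n, q n, x n)" for n by (simp add: s_def t_def c_def q_def x_def)
  with p have "bad n (s n, t n, c n, q n, x n)" for n by metis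
  then have b: "norm (s n) < 1 / real (Suc n)" "0 < t n" "t n < 1 / real (Suc n)"
    "z \<in> Z \<Longrightarrow> norm (c n z) < 1 / real (Suc n)" "z \<in> Z \<Longrightarrow> norm (q n z - z) < 1 / real (Suc n)"
    "z \<in> Z \<Longrightarrow> grad (nodal.perturbed (pert_coeff (s n) (t n)) (c n)) (q n z) = 0"
    "x n \<in> singular_points {0..3} (surface (s n) (t n) (c n))"
    "x n \<notin> (\<lambda>z. proj_point (pt 1 (t n *\<^sub>R q n z))) ` Z" for n z
    by (auto simp: bad_def)
  have i0: "(\<lambda>n. 1 / real (Suc n)) \<longlonglongrightarrow> 0"
    using LIMSEQ_inverse_real_of_nat by (simp add: inverse_eq_divide)
  have s0: "s \<longlonglongrightarrow> 0" using b(1) by (intro Lim_null_comparison[OF always_eventually i0] allI less_imp_le)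
  have t0: "t \<longlonglongrightarrow> 0" by (intro Lim_null_comparison[OF always_eventually i0] allI less_imp_le)
    (simp only: real_norm_def abs_of_pos[OF b(2)] b(3))
  have c0: "(\<lambda>n. c n z) \<longlonglongrightarrow> 0" if "z \<in> Z" for z
    using b(4)[OF that] by (intro Lim_null_comparison[OF always_eventually i0] allI less_imp_le)
  have q0: "(\<lambda>n. q n z) \<longlonglongrightarrow> z" if "z \<in> Z" for z
  proof -
    have "(\<lambda>n. q n z - z) \<longlonglongrightarrow> 0"
      using b(5)[OF that] by (intro Lim_null_comparison[OF always_eventually i0] allI less_imp_le)
    then show ?thesis by (simp add: LIM_zero_iff)
  qed
  from singular_limit[OF s0 t0 c0 b(2,7)]
  obtain r y z where r: "strict_mono r" and z: "z \<in> Z" and y: "y \<longlonglongrightarrow> z"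
    and xy: "\<forall>n. x (r n) = proj_point (pt 1 (t (r n) *\<^sub>R y n))" by blast
  from nodal.grad_perturbed_expanding obtain \<kappa> r0 \<sigma> where \<kappa>: "\<kappa> > 0" "r0 > 0" "\<sigma> > 0" and
    expand: "\<forall>\<theta> c. (\<Sum>k=m..N + 2. norm (\<theta> k)) \<le> \<sigma> \<longrightarrow> (\<Sum>w\<in>Z. norm (c w)) \<le> \<sigma> \<longrightarrow>
     (\<forall>z\<in>Z. \<forall>x\<in>ball z r0. \<forall>y\<in>ball z r0.
       norm (grad (nodal.perturbed \<theta> c) x - grad (nodal.perturbed \<theta> c) y) \<ge> \<kappa> * norm (x - y))" by blast
  obtain \<epsilon> where \<epsilon>: "\<epsilon> > 0" "\<forall>s t. norm s < \<epsilon> \<longrightarrow> 0 < t \<longrightarrow> t < \<epsilon> \<longrightarrow> (\<Sum>k=m..N + 2. norm (pert_coeff s t k)) \<le> \<sigma>"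
    using pert_coeff_eventually_small[OF \<kappa>(3)] by blast
  have "(\<lambda>n. \<Sum>w\<in>Z. norm (c n w)) \<longlonglongrightarrow> (\<Sum>w\<in>Z. norm (0::complex))" by (intro tendsto_intros c0)
  then have csum: "(\<lambda>n. \<Sum>w\<in>Z. norm (c n w)) \<longlonglongrightarrow> 0" by simp
  have ev: "eventually (\<lambda>n. norm (s n) < \<epsilon> \<and> t n < \<epsilon> \<and> (\<Sum>w\<in>Z. norm (c n w)) < \<sigma> \<and> dist (q n z) z < r0) sequentially"
    using order_tendstoD(2)[OF tendsto_norm_zero[OF s0] \<epsilon>(1)] order_tendstoD(2)[OF t0 \<epsilon>(1)]
      order_tendstoD(2)[OF csum \<kappa>(3)] tendstoD[OF q0[OF z] \<kappa>(2)] by eventually_elim auto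
  have ev2: "eventually (\<lambda>n. dist (y n) z < r0) sequentially" by (rule tendstoD[OF y \<kappa>(2)])
  have "eventually (\<lambda>n. norm (s (r n)) < \<epsilon> \<and> t (r n) < \<epsilon> \<and> (\<Sum>w\<in>Z. norm (c (r n) w)) < \<sigma> \<and> dist (q (r n) z) z < r0) sequentially"
    by (rule eventually_compose_filterlim[OF ev filterlim_subseq[OF r]])
  with ev2 have "eventually (\<lambda>n. dist (y n) z < r0 \<and> norm (s (r n)) < \<epsilon> \<and> t (r n) < \<epsilon> \<and>
     (\<Sum>w\<in>Z. norm (c (r n) w)) < \<sigma> \<and> dist (q (r n) z) z < r0) sequentially" by eventually_elim auto
  then obtain n where n: "dist (y n) z < r0" "norm (s (r n)) < \<epsilon>" "t (r n) < \<epsilon>"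
     "(\<Sum>w\<in>Z. norm (c (r n) w)) < \<sigma>" "dist (q (r n) z) z < r0"
    by (auto simp: eventually_sequentially)
  let ?K = "nodal.perturbed (pert_coeff (s (r n)) (t (r n))) (c (r n))"
  have "(\<Sum>k=m..N + 2. norm (pert_coeff (s (r n)) (t (r n)) k)) \<le> \<sigma>" using \<epsilon>(2) n b(2)[of "r n"] by blast
  moreover have "(\<Sum>w\<in>Z. norm (c (r n) w)) \<le> \<sigma>" using n(4) by simp
  moreover have "y n \<in> ball z r0" "q (r n) z \<in> ball z r0" using n(1,5) by (simp_all add: dist_commute)
  ultimately have "\<kappa> * norm (y n - q (r n) z) \<le> norm (grad ?K (y n) - grad ?K (q (r n) z))"
    using expand z by blast
  moreover have "grad ?K (q (r n) z) = 0" by (rule b(6)[OF z])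
  moreover have "grad ?K (y n) = 0"
    using b(7)[of "r n"] surface_singular_iff[OF b(2)[of "r n"], of "y n" "s (r n)" "c (r n)"] xy by simp
  ultimately have yq: "y n = q (r n) z" using \<kappa>(1) by (simp add: mult_le_0_iff)
  have "x (r n) = (\<lambda>z. proj_point (pt 1 (t (r n) *\<^sub>R q (r n) z))) z"
    using spec[OF xy, of n] unfolding yq .
  then have "x (r n) \<in> (\<lambda>z. proj_point (pt 1 (t (r n) *\<^sub>R q (r n) z))) ` Z" using z by (rule image_eqI)
  with b(8)[of "r n"] show False by contradiction
qed

lemma separated: "\<exists>e>0. \<forall>z\<in>Z. \<forall>w\<in>Z. z \<noteq> w \<longrightarrow> e \<le> dist z w"
proof -
  define S where "S = insert 1 ((\<lambda>(z, w). dist z w) ` {(z, w). (z, w) \<in> Z \<times> Z \<and> z \<noteq> w})"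
  have "finite {(z, w). (z, w) \<in> Z \<times> Z \<and> z \<noteq> w}"
    by (rule finite_subset[of _ "Z \<times> Z"]) (use finite_Z in auto)
  then have S: "finite S" by (simp add: S_def)
  have "Min S > 0" using S by (subst Min_gr_iff) (auto simp: S_def)
  moreover have "Min S \<le> dist z w" if "z \<in> Z" "w \<in> Z" "z \<noteq> w" for z w
    by (rule Min_le[OF S]) (use that in \<open>auto simp: S_def\<close>)
  ultimately show ?thesis by blast
qed

text \<open>
  The restored nodes are all singular points, they stay apart because they are close to different
  points of \<open>Z\<close>, and the lower bound for the gradient at scale \<open>t\<close> makes them ordinary double points.
\<close>

theorem surface_is_nodal:
  "\<exists>\<epsilon>>0. \<forall>s t. norm s < \<epsilon> \<longrightarrow> 0 < t \<longrightarrow> t < \<epsilon> \<longrightarrow> (\<exists>c. (\<forall>z\<in>Z. norm (c z) < 1) \<and>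
     finite (singular_points {0..3} (surface s t c)) \<and> card (singular_points {0..3} (surface s t c)) = card Z \<and>
     (\<forall>x\<in>singular_points {0..3} (surface s t c). node {0..3} (surface s t c) x))"
proof -
  obtain \<eta>1 where \<eta>1: "\<eta>1 > 0" "\<forall>s t c q. norm s < \<eta>1 \<longrightarrow> 0 < t \<longrightarrow> t < \<eta>1 \<longrightarrow>
     (\<forall>z\<in>Z. norm (c z) < \<eta>1 \<and> norm (q z - z) < \<eta>1 \<and> grad (nodal.perturbed (pert_coeff s t) c) (q z) = 0) \<longrightarrow>
     singular_points {0..3} (surface s t c) \<subseteq> (\<lambda>z. proj_point (pt 1 (t *\<^sub>R q z))) ` Z"
    using all_singular_points by blast
  from nodal.grad_perturbed_expanding obtain \<kappa> r0 \<sigma> where \<kappa>: "\<kappa> > 0" "r0 > 0" "\<sigma> > 0" and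
    expand: "\<forall>\<theta> c. (\<Sum>k=m..N + 2. norm (\<theta> k)) \<le> \<sigma> \<longrightarrow> (\<Sum>w\<in>Z. norm (c w)) \<le> \<sigma> \<longrightarrow>
     (\<forall>z\<in>Z. \<forall>x\<in>ball z r0. \<forall>y\<in>ball z r0.
       norm (grad (nodal.perturbed \<theta> c) x - grad (nodal.perturbed \<theta> c) y) \<ge> \<kappa> * norm (x - y))" by blast
  obtain e where e: "e > 0" "\<forall>z\<in>Z. \<forall>w\<in>Z. z \<noteq> w \<longrightarrow> e \<le> dist z w" using separated by blast
  define \<eta> where "\<eta> = Min {\<eta>1, 1, r0, e / 2, \<sigma> / (real (card Z) + 1)}"
  have "0 < \<sigma> / (real (card Z) + 1)" using \<kappa>(3) by simp
  then have \<eta>: "\<eta> > 0" "\<eta> \<le> \<eta>1" "\<eta> \<le> 1" "\<eta> \<le> r0" "\<eta> \<le> e / 2" "\<eta> \<le> \<sigma> / (real (card Z) + 1)"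
    using \<eta>1(1) \<kappa> e(1) unfolding \<eta>_def by (simp_all only: Min_gr_iff Min_le finite.intros insert_not_empty not_False_eq_True ball_simps insert_iff simp_thms half_gt_zero zero_less_one)
  obtain \<sigma>2 where \<sigma>2: "\<sigma>2 > 0" "\<forall>\<theta>. (\<Sum>k=m..N + 2. norm (\<theta> k)) \<le> \<sigma>2 \<longrightarrow>
    (\<exists>c q. \<forall>z\<in>Z. norm (c z) < \<eta> \<and> norm (q z - z) < \<eta> \<and>
       nodal.perturbed \<theta> c (q z) = 0 \<and> grad (nodal.perturbed \<theta> c) (q z) = 0)"
    using nodal.nodes_persist[OF \<eta>(1)] by blast
  obtain \<epsilon>1 where \<epsilon>1: "\<epsilon>1 > 0" "\<forall>s t. norm s < \<epsilon>1 \<longrightarrow> 0 < t \<longrightarrow> t < \<epsilon>1 \<longrightarrow>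
     (\<Sum>k=m..N + 2. norm (pert_coeff s t k)) \<le> min \<sigma> \<sigma>2"
    using pert_coeff_eventually_small[of "min \<sigma> \<sigma>2"] \<kappa>(3) \<sigma>2(1) by auto
  have main: "\<exists>c. (\<forall>z\<in>Z. norm (c z) < 1) \<and>
     finite (singular_points {0..3} (surface s t c)) \<and> card (singular_points {0..3} (surface s t c)) = card Z \<and>
     (\<forall>x\<in>singular_points {0..3} (surface s t c). node {0..3} (surface s t c) x)"
    if st: "norm s < min \<epsilon>1 \<eta>1" "0 < t" "t < min \<epsilon>1 \<eta>1" for s t
  proof -
    let ?\<theta> = "pert_coeff s t"
    have small: "(\<Sum>k=m..N + 2. norm (?\<theta> k)) \<le> min \<sigma> \<sigma>2" using \<epsilon>1(2) st by simp
    then obtain c q where cq: "\<forall>z\<in>Z. norm (c z) < \<eta> \<and> norm (q z - z) < \<eta> \<and>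
       nodal.perturbed ?\<theta> c (q z) = 0 \<and> grad (nodal.perturbed ?\<theta> c) (q z) = 0" using \<sigma>2(2)[THEN spec[of _ ?\<theta>]] by fastforce
    let ?S = "singular_points {0..3} (surface s t c)" and ?x = "\<lambda>z. proj_point (pt 1 (t *\<^sub>R q z))"
    have sub: "?S \<subseteq> ?x ` Z"
    proof -
      have "\<forall>z\<in>Z. norm (c z) < \<eta>1 \<and> norm (q z - z) < \<eta>1 \<and> grad (nodal.perturbed ?\<theta> c) (q z) = 0"
        using cq \<eta>(2) by fastforce
      then show ?thesis using \<eta>1(2) st by simp
    qed
    have S: "?S = ?x ` Z"
      using sub surface_singular_iff[OF st(2)] cq by blast
    have inj: "inj_on ?x Z"
    proof (rule inj_onI, rule ccontr)
      fix z w assume zw: "z \<in> Z" "w \<in> Z" "?x z = ?x w" "z \<noteq> w"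
      from proj_point_pt_inject[OF zw(3)] st(2) have "q z = q w" by simp
      then have "dist z w \<le> norm (q z - z) + norm (q w - w)"
        using dist_triangle2[of z w "q z"] by (simp add: dist_norm norm_minus_commute)
      also have "\<dots> < e / 2 + e / 2" using cq zw \<eta>(5) by (intro add_strict_mono) (auto intro: less_le_trans)
      finally show False using e(2) zw by force
    qed
    have fin: "finite ?S" "card ?S = card Z" using S inj finite_Z by (simp_all add: card_image)
    have csum: "(\<Sum>w\<in>Z. norm (c w)) \<le> \<sigma>"
    proof -
      have "(\<Sum>w\<in>Z. norm (c w)) \<le> (\<Sum>w\<in>Z. \<sigma> / (real (card Z) + 1))"
        using cq \<eta>(6) by (intro sum_mono) (auto intro: less_imp_le less_le_trans)
      also have "\<dots> \<le> \<sigma>" using \<kappa>(3) by (simp add: field_simps)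
      finally show ?thesis .
    qed
    have "node {0..3} (surface s t c) (?x z)" if z: "z \<in> Z" for z
    proof (rule node_at[OF surface_forms fin(1)])
      have qz: "norm (q z - z) < r0" using cq z \<eta>(4) by (auto intro: less_le_trans)
      have "?x z \<in> ?S" using S z by blast
      then show "fn (surface s t c) (t *\<^sub>R q z) = 0" "grad (fn (surface s t c)) (t *\<^sub>R q z) = 0"
        unfolding singular_point_iff[OF surface_forms] by simp_all
      then have g0: "grad (nodal.perturbed ?\<theta> c) (q z) = 0" using cq z by blast
      show "t ^ (m - 1) * \<kappa> / t > 0" using st(2) \<kappa>(1) by simp
      show "t * (r0 - norm (q z - z)) > 0" using st(2) qz by simp
      fix y assume y: "norm (y - t *\<^sub>R q z) < t * (r0 - norm (q z - z))"
      define u where "u = (1 / t) *\<^sub>R y"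
      have yu: "y = t *\<^sub>R u" using st(2) by (simp add: u_def)
      have nyu: "norm (y - t *\<^sub>R q z) = t * norm (u - q z)"
        using st(2) by (simp add: yu scaleR_diff_right[symmetric])
      with y st(2) have "norm (u - q z) < r0 - norm (q z - z)" by simp
      then have "u \<in> ball z r0" using norm_triangle_ineq[of "u - q z" "q z - z"] by (simp add: dist_norm norm_minus_commute)
      moreover have "q z \<in> ball z r0" using qz by (simp add: dist_norm norm_minus_commute)
      moreover have "(\<Sum>k=m..N + 2. norm (?\<theta> k)) \<le> \<sigma>" using small by simp
      ultimately have "\<kappa> * norm (u - q z) \<le> norm (grad (nodal.perturbed ?\<theta> c) u - grad (nodal.perturbed ?\<theta> c) (q z))"
        using expand csum z by blast
      then have ku: "\<kappa> * norm (u - q z) \<le> norm (grad (nodal.perturbed ?\<theta> c) u)"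
        unfolding g0 diff_zero .
      have "grad (fn (surface s t c)) y = t ^ (m - 1) *\<^sub>R grad (nodal.perturbed ?\<theta> c) u"
        using grad_surface_scaled[OF st(2), of s 1 c u] by (simp add: yu rescaled_eq_perturbed)
      then have eq1: "norm (grad (fn (surface s t c)) y) = t ^ (m - 1) * norm (grad (nodal.perturbed ?\<theta> c) u)"
        using st(2) by simp
      have eq2: "t ^ (m - 1) * \<kappa> / t * norm (y - t *\<^sub>R q z) = t ^ (m - 1) * (\<kappa> * norm (u - q z))"
        unfolding nyu using st(2) by simp
      show "t ^ (m - 1) * \<kappa> / t * norm (y - t *\<^sub>R q z) \<le> norm (grad (fn (surface s t c)) y)"
        unfolding eq1 eq2 by (rule mult_left_mono[OF ku]) (use st(2) in simp)
    qed
    then have "\<forall>x\<in>?x ` Z. node {0..3} (surface s t c) x" by (intro ballI) (erule imageE, simp only:)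
    then have "\<forall>x\<in>?S. node {0..3} (surface s t c) x" by (simp only: S)
    moreover have "\<forall>z\<in>Z. norm (c z) < 1" using cq \<eta>(3) by (auto intro: less_le_trans)
    ultimately show ?thesis using fin by blast
  qed
  show ?thesis by (rule exI[of _ "min \<epsilon>1 \<eta>1"]) (use main \<epsilon>1(1) \<eta>1(1) in auto)
qed

end

section \<open>Passage to the Zariski closure\<close>

lemma eval_at_tendsto:
  assumes "\<And>e. (\<lambda>n. b n e) \<longlonglongrightarrow> b' e" shows "(\<lambda>n. eval_at (b n) P) \<longlonglongrightarrow> eval_at b' P"
  unfolding eval_at_eq monomial_value_def by (intro tendsto_intros assms)

lemma eval_at_line_poly:
  "\<exists>p :: complex poly. \<forall>s. poly p s = eval_at (\<lambda>e. \<alpha> e + s * \<beta> e) P"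
proof (intro exI allI)
  fix s
  show "poly (substitute (\<lambda>c. [:c:]) (\<lambda>e. [:\<alpha> e, \<beta> e:]) P) s = eval_at (\<lambda>e. \<alpha> e + s * \<beta> e) P"
    by (simp add: substitute_eq eval_at_eq poly_sum monomial_value_def poly_prod poly_power)
qed

context nodal_smoothing
begin

text \<open>
  Classical limits lie in the Zariski closure, and a polynomial in \<open>s\<close> that vanishes near \<open>0\<close>
  vanishes at \<open>1\<close>.
\<close>

lemma vanishes_at_F:
  assumes Z: "Z \<noteq> {}"
    and P: "\<And>y b. y \<in> severi_variety 3 d (card Z) \<Longrightarrow> b \<in> y \<Longrightarrow> eval_at b P = 0"
  shows "eval_at (Poly_Mapping.lookup F) P = 0"
proof -
  obtain \<epsilon> where \<epsilon>: "\<epsilon> > 0" "\<forall>s t. norm s < \<epsilon> \<longrightarrow> 0 < t \<longrightarrow> t < \<epsilon> \<longrightarrow> (\<exists>c. (\<forall>z\<in>Z. norm (c z) < 1) \<and>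
     finite (singular_points {0..3} (surface s t c)) \<and> card (singular_points {0..3} (surface s t c)) = card Z \<and>
     (\<forall>x\<in>singular_points {0..3} (surface s t c). node {0..3} (surface s t c) x))"
    using surface_is_nodal by blast
  have in_severi: "eval_at (Poly_Mapping.lookup (surface s t c)) P = 0"
    if c: "finite (singular_points {0..3} (surface s t c))" "card (singular_points {0..3} (surface s t c)) = card Z"
     "\<forall>x\<in>singular_points {0..3} (surface s t c). node {0..3} (surface s t c) x" for s t c
  proof (rule P)
    \<comment> \<open>The zero polynomial has no tangent cone, hence no nodes.\<close>
    have "surface s t c \<noteq> 0"
    proof
      assume 0: "surface s t c = 0"
      have "singular_points {0..3} (surface s t c) \<noteq> {}" using c(2) Z finite_Z by auto
      then obtain x where "ordinary_point {0..3} (0 :: nat cpoly) 2 x" using c(3) 0 by auto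
      then obtain j b where "hom_part 2 (local_equation j b (0 :: nat cpoly)) \<noteq> 0" unfolding ordinary_point_def by blast
      then show False by (simp add: local_equation_def substitute_def hom_part_def)
    qed
    then show "hypersurface (surface s t c) \<in> severi_variety 3 d (card Z)"
      unfolding severi_variety_def using surface_forms c by blast
    show "Poly_Mapping.lookup (surface s t c) \<in> hypersurface (surface s t c)"
      by (simp add: hypersurface_def proj_point_self)
  qed
  define line where "line s e = Poly_Mapping.lookup G e + s * (Poly_Mapping.lookup F e - Poly_Mapping.lookup G e)" for s e
  have small: "eval_at (line s) P = 0" if s: "norm s < \<epsilon>" for s
  proof -
    define t where "t n = \<epsilon> / real (n + 2)" for n :: nat
    have t: "0 < t n" "t n < \<epsilon>" for n
    proof -
      show "0 < t n" using \<epsilon>(1) by (simp add: t_def)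
      have "\<epsilon> * 1 < \<epsilon> * real (n + 2)" using \<epsilon>(1) by (intro mult_strict_left_mono) auto
      then show "t n < \<epsilon>" by (simp add: t_def field_simps)
    qed
    have t0: "t \<longlonglongrightarrow> 0"
      unfolding t_def[abs_def]
      using LIMSEQ_ignore_initial_segment[OF lim_const_over_n[of \<epsilon>], of 2] by simp
    have "\<forall>n. \<exists>c. (\<forall>z\<in>Z. norm (c z) < 1) \<and> eval_at (Poly_Mapping.lookup (surface s (t n) c)) P = 0"
      using \<epsilon>(2) s t in_severi by meson
    from choice[OF this] obtain c where c: "\<forall>n. (\<forall>z\<in>Z. norm (c n z) < 1) \<and> eval_at (Poly_Mapping.lookup (surface s (t n) (c n))) P = 0"
      by (rule exE)
    have "(\<lambda>n. Poly_Mapping.lookup (surface s (t n) (c n)) e) \<longlonglongrightarrow> line s e" for e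
    proof -
      have tk: "(\<lambda>n. of_real (t n) ^ (m - k) :: complex) \<longlonglongrightarrow> 0" if "k < m" for k
      proof -
        have "(\<lambda>n. of_real (t n) ^ (m - k) :: complex) \<longlonglongrightarrow> of_real 0 ^ (m - k)" by (intro tendsto_intros t0)
        then show ?thesis using that by (simp add: power_0_left)
      qed
      have low: "(\<lambda>n. of_real (t n) ^ (m - k) * (Poly_Mapping.lookup (c\<gamma> k) e + (\<Sum>w\<in>Z. c n w * Poly_Mapping.lookup (c\<l> w k) e))) \<longlonglongrightarrow> 0"
        if k: "k < m" for k
      proof -
        define B where "B = norm (Poly_Mapping.lookup (c\<gamma> k) e) + (\<Sum>w\<in>Z. norm (Poly_Mapping.lookup (c\<l> w k) e))"
        have B: "norm (Poly_Mapping.lookup (c\<gamma> k) e + (\<Sum>w\<in>Z. c n w * Poly_Mapping.lookup (c\<l> w k) e)) \<le> B" for n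
          unfolding B_def
        proof (intro norm_triangle_le add_mono order_refl sum_norm_le)
          fix w assume "w \<in> Z"
          then have "norm (c n w) \<le> 1" using c less_imp_le by blast
          then show "norm (c n w * Poly_Mapping.lookup (c\<l> w k) e) \<le> norm (Poly_Mapping.lookup (c\<l> w k) e)"
            by (simp add: norm_mult mult_left_le_one_le)
        qed
        show ?thesis
        proof (rule Lim_null_comparison[OF always_eventually])
          show "\<forall>n. norm (of_real (t n) ^ (m - k) * (Poly_Mapping.lookup (c\<gamma> k) e + (\<Sum>w\<in>Z. c n w * Poly_Mapping.lookup (c\<l> w k) e)))
              \<le> norm (of_real (t n) ^ (m - k) :: complex) * B"
            unfolding norm_mult by (intro allI mult_left_mono B norm_ge_zero)
          show "(\<lambda>n. norm (of_real (t n) ^ (m - k) :: complex) * B) \<longlonglongrightarrow> 0"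
            by (rule tendsto_mult_left_zero[OF tendsto_norm_zero[OF tk[OF k]]])
        qed
      qed
      have "(\<lambda>n. (\<Sum>k<m. of_real (t n) ^ (m - k) * (Poly_Mapping.lookup (c\<gamma> k) e + (\<Sum>w\<in>Z. c n w * Poly_Mapping.lookup (c\<l> w k) e)))
         + Poly_Mapping.lookup G e + s * (Poly_Mapping.lookup F e - Poly_Mapping.lookup G e)) \<longlonglongrightarrow>
         (\<Sum>k<m. 0) + Poly_Mapping.lookup G e + s * (Poly_Mapping.lookup F e - Poly_Mapping.lookup G e)"
        by (intro tendsto_intros low) auto
      then show ?thesis
        by (simp add: surface_def line_def lookup_add lookup_sum lookup_minus)
    qed
    from eval_at_tendsto[of "\<lambda>n. Poly_Mapping.lookup (surface s (t n) (c n))" "line s" P, OF this] c show ?thesis by (simp add: LIMSEQ_const_iff)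
  qed
  obtain p :: "complex poly" where p: "\<forall>s. poly p s = eval_at (\<lambda>e. Poly_Mapping.lookup G e + s * (Poly_Mapping.lookup F e - Poly_Mapping.lookup G e)) P"
    using eval_at_line_poly[of "Poly_Mapping.lookup G" "\<lambda>e. Poly_Mapping.lookup F e - Poly_Mapping.lookup G e" P] by (rule exE)
  have "ball 0 \<epsilon> \<subseteq> {s. poly p s = 0}" using small p by (auto simp: line_def[abs_def])
  moreover have "infinite (ball (0::complex) \<epsilon>)" using uncountable_ball[OF \<epsilon>(1)] countable_finite by blast
  ultimately have "infinite {s. poly p s = 0}" using finite_subset by blast
  then have "p = 0" using poly_roots_finite by blast
  then have "poly p 1 = 0" by simp
  then show ?thesis using p by simp
qed

end

section \<open>A comparison surface\<close>

text \<open>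
  At a singular point of \<open>l^(d - m) lead + h\<close> each coordinate either vanishes or has a modulus that is
  determined by \<open>l\<close> and the coefficients of \<open>h\<close>. These are chosen such that the three summands of \<open>lead\<close>, if
  nonzero, have moduli in the ratio \<open>1 : 3 : 9\<close>. Then they cannot cancel, as the vanishing of
  the derivative in \<open>l\<close> would require.
\<close>

lemma diagonal_smoothing:
  fixes \<alpha> :: "3 \<Rightarrow> complex"
  assumes \<alpha>: "\<And>j. \<alpha> j \<noteq> 0" and m: "1 < m" "m \<le> d"
  defines "lead \<equiv> \<lambda>v. \<Sum>j\<in>UNIV. \<alpha> j * v $ j ^ m"
  shows "hform m lead" "\<And>v. grad lead v = 0 \<Longrightarrow> v = 0"
    "\<exists>h. hform d h \<and> (d = m \<longrightarrow> (\<forall>v. h v = 0)) \<and> (\<forall>l v. l ^ (d - m) *s grad lead v + grad h v = 0 \<longrightarrow>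
        of_nat (d - m) * l ^ (d - m - 1) * lead v = 0 \<longrightarrow> v = 0)"
proof -
  have hf: "hform n (\<lambda>v. \<Sum>j\<in>UNIV. \<beta> j * v $ j ^ n)" for n and \<beta> :: "3 \<Rightarrow> complex"
    by (intro hform_sum hform_cmult hform_coord_power)
  have gr: "grad (\<lambda>v. \<Sum>j\<in>UNIV. \<beta> j * v $ j ^ n) v = (\<chi> j. of_nat n * \<beta> j * v $ j ^ (n - 1))" for \<beta> n v
    using grad_separable[of "\<lambda>j. monom (\<beta> j) n" v] by (simp add: poly_monom pderiv_monom)
  show "hform m lead" unfolding lead_def by (rule hf)
  show smooth: "v = 0" if "grad lead v = 0" for v
    using that m(1) \<alpha> unfolding lead_def gr by (auto simp: vec_eq_iff)
  show "\<exists>h. hform d h \<and> (d = m \<longrightarrow> (\<forall>v. h v = 0)) \<and> (\<forall>l v. l ^ (d - m) *s grad lead v + grad h v = 0 \<longrightarrow>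
        of_nat (d - m) * l ^ (d - m - 1) * lead v = 0 \<longrightarrow> v = 0)"
  proof (cases "d = m")
    case True
    then show ?thesis using smooth by (intro exI[of _ "\<lambda>_. 0"]) auto
  next
    case False
    define e where "e = d - m"
    have e: "e > 0" "d = m + e" using False m(2) by (auto simp: e_def)
    define q :: "3 \<Rightarrow> real" where "q j = (if j = 1 then 1 else if j = 2 then 3 else 9)" for j
    have q: "q j > 0" for j by (simp add: q_def)
    define r where "r j = root m (q j / norm (\<alpha> j))" for j
    have r: "r j > 0" "norm (\<alpha> j) * r j ^ m = q j" for j
      using q[of j] \<alpha>[of j] m(1) by (auto simp: r_def real_root_gt_zero real_root_pow_pos2)
    define \<beta> where "\<beta> j = of_nat m * \<alpha> j / (of_nat d * of_real (r j) ^ e)" for j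
    define h where "h v = (\<Sum>j\<in>UNIV. \<beta> j * v $ j ^ d)" for v :: "complex^3"
    have main: "v = 0" if crit: "l ^ e *s grad lead v + grad h v = 0" and val: "of_nat e * l ^ (e - 1) * lead v = 0" for l v
    proof -
      have nj: "v $ j = 0 \<or> norm (v $ j) = norm l * r j" for j
      proof -
        have rj: "of_real (r j) \<noteq> (0 :: complex)" using r(1)[of j] by simp
        have "l ^ e * (of_nat m * \<alpha> j * v $ j ^ (m - 1)) + of_nat d * \<beta> j * v $ j ^ (d - 1) = 0"
          using arg_cong[OF crit, of "\<lambda>x. x $ j"] unfolding lead_def h_def[abs_def] gr by simp
        moreover have "v $ j ^ (d - 1) = v $ j ^ (m - 1) * v $ j ^ e"
          using e m(1) by (simp add: power_add[symmetric])
        moreover have "of_nat d * \<beta> j = of_nat m * \<alpha> j / of_real (r j) ^ e"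
        proof -
          have "of_nat d \<noteq> (0 :: complex)" using m by simp
          then show ?thesis by (simp add: \<beta>_def)
        qed
        ultimately have "of_nat m * \<alpha> j * v $ j ^ (m - 1) * (l ^ e + (v $ j / of_real (r j)) ^ e) = 0"
          by (simp add: power_divide algebra_simps)
        then have "v $ j = 0 \<or> l ^ e + (v $ j / of_real (r j)) ^ e = 0"
          using \<alpha>[of j] m(1) by auto
        then show ?thesis
        proof
          assume "l ^ e + (v $ j / of_real (r j)) ^ e = 0"
          then have "(v $ j / of_real (r j)) ^ e = - (l ^ e)" by (simp add: add_eq_0_iff)
          then have "norm (v $ j / of_real (r j)) ^ e = norm l ^ e" by (metis norm_minus_cancel norm_power)
          then have "norm (v $ j / of_real (r j)) = norm l" using e(1) by (simp add: power_eq_iff_eq_base)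
          then show ?thesis using r(1)[of j] by (simp add: norm_divide field_simps)
        qed simp
      qed
      show "v = 0"
      proof (cases "l = 0")
        case True
        then show ?thesis using nj by (simp add: vec_eq_iff)
      next
        case False
        with val e(1) have lead0: "lead v = 0" by simp
        define K where "K = norm l ^ m"
        have K: "K > 0" using False by (simp add: K_def)
        define y where "y j = \<alpha> j * v $ j ^ m" for j
        have y: "y j = 0 \<and> v $ j = 0 \<or> norm (y j) = q j * K" for j
        proof (cases "v $ j = 0")
          case True
          then show ?thesis using m(1) by (simp add: y_def)
        next
          case False
          then have "norm (y j) = norm (\<alpha> j) * (norm l * r j) ^ m" using nj[of j] by (simp add: y_def norm_mult norm_power)
          also have "\<dots> = q j * K" using r(2)[of j] by (simp add: K_def power_mult_distrib)
          finally show ?thesis by simp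
        qed
        have sum: "y 1 + y 2 + y 3 = 0" using lead0 by (simp add: lead_def y_def sum_3)
        have b: "norm (y 1) \<le> K" "norm (y 2) \<le> 3 * K"
          using y[of 1] y[of 2] K by (auto simp: q_def)
        have "y 3 = - (y 1 + y 2)" using sum by (simp add: add_eq_0_iff)
        then have "norm (y 3) \<le> norm (y 1) + norm (y 2)" by (metis norm_minus_cancel norm_triangle_ineq)
        then have y3: "y 3 = 0 \<and> v $ 3 = 0" using y[of 3] b K by (auto simp: q_def)
        have "y 2 = - y 1" using sum y3 by (simp add: add_eq_0_iff)
        then have "norm (y 2) = norm (y 1)" by simp
        then have y2: "y 2 = 0 \<and> v $ 2 = 0" using y[of 2] b K by (auto simp: q_def)
        then have "y 1 = 0" using sum y3 by simp
        then have "v $ 1 = 0" using y[of 1] K by (auto simp: q_def)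
        then show ?thesis using y2 y3 by (simp add: vec_eq_iff forall_3)
      qed
    qed
    have "hform d h" unfolding h_def[abs_def] by (rule hf)
    moreover have "d = m \<longrightarrow> (\<forall>v. h v = 0)" using False by simp
    moreover have "\<forall>l v. l ^ (d - m) *s grad lead v + grad h v = 0 \<longrightarrow>
        of_nat (d - m) * l ^ (d - m - 1) * lead v = 0 \<longrightarrow> v = 0"
      using main unfolding e_def by blast
    ultimately show ?thesis by (intro exI[of _ h] conjI)
  qed
qed

section \<open>Ordinary multiple points as limits of nodes\<close>

theorem theorem1p2:
  fixes m d \<delta> :: nat
  assumes "1 < m" and "m \<le> d"
    and "\<delta> = (if 3 dvd m then (m div 3) * (m div 3 + 1)\<^sup>2 else (m div 3 + 1) ^ 3)"
  shows "ordinary_locus 3 d m \<subseteq> hypersurface_closure 3 d (severi_variety 3 d \<delta>)"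
proof
  fix X assume "X \<in> ordinary_locus 3 d m"
  then obtain F x where X: "X = hypersurface F" and Ff: "F \<in> forms {0..3} d" "F \<noteq> 0"
    and x: "singular_points {0..3} F = {x}" and ord: "ordinary_point {0..3} F m x"
    unfolding ordinary_locus_def by blast
  from ord obtain i a where i: "i \<in> {0..3}" and a: "a \<in> x" "a i = 1"
    and low: "\<forall>k<m. hom_part k (local_equation i a F) = 0"
    unfolding ordinary_point_def by blast
  have "x \<in> singular_points {0..3} F" using x by simp
  note a_support = singular_point_representative(2)[OF this a(1)]
  have "card ({0..3} - {i}) = CARD(3)" using i by simp
  then obtain idx where idx: "bij_betw idx (UNIV :: 3 set) ({0..3} - {i})"
    using finite_same_card_bij[of "UNIV :: 3 set" "{0..3} - {i}"] by auto
  interpret chart i a idx by standard (use i idx a(2) a_support in auto)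
  obtain g \<alpha> Z L where model: "nodal_model m g \<alpha> Z L" and card: "card Z = \<delta>"
    using nodal_model_exists[OF assms(1,3)] by blast
  define lead where "lead v = (\<Sum>j\<in>UNIV. \<alpha> j * v $ j ^ m)" for v :: "complex^3"
  have \<alpha>: "\<alpha> j \<noteq> 0" for j using model by (simp add: nodal_model_def)
  note diag = diagonal_smoothing[of \<alpha> m d, OF \<alpha> assms(1,2), folded lead_def]
  obtain h where h0: "hform d h \<and> (d = m \<longrightarrow> (\<forall>v. h v = 0)) \<and> (\<forall>l v. l ^ (d - m) *s grad lead v + grad h v = 0 \<longrightarrow>
        of_nat (d - m) * l ^ (d - m - 1) * lead v = 0 \<longrightarrow> v = 0)"
    using diag(3) by (rule exE)
  have h: "hform d h" "\<And>v. d = m \<Longrightarrow> h v = 0"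
    using conjunct1[OF h0] conjunct1[OF conjunct2[OF h0]] by simp_all
  have G_smooth: "v = 0" if "l ^ (d - m) *s grad lead v + grad h v = 0"
      "of_nat (d - m) * l ^ (d - m - 1) * lead v = 0" for l v
    using conjunct2[OF conjunct2[OF h0], THEN spec, THEN spec, THEN mp, THEN mp, OF that] .
  have below: "{..m - 1} = {..<m}" using assms(1) by auto
  have "polyfn (m - 1) (\<lambda>v. g v - lead v)" using model by (simp add: nodal_model_def lead_def)
  from polyfn_decompose[OF this] obtain \<gamma> where "(\<forall>k. hform k (\<gamma> k)) \<and> (\<forall>v. g v - lead v = (\<Sum>k<m. \<gamma> k v))"
    unfolding below by (rule exE)
  then have \<gamma>: "\<And>k. hform k (\<gamma> k)" "\<And>v. g v - lead v = (\<Sum>k<m. \<gamma> k v)" by simp_all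
  have g: "g = (\<lambda>v. (\<Sum>k<m. \<gamma> k v) + lead v)" using \<gamma>(2) unfolding diff_eq_eq by (rule ext)
  have "\<forall>w. \<exists>\<Lambda>. w \<in> Z \<longrightarrow> (\<forall>k. hform k (\<Lambda> k)) \<and> (\<forall>v. L w v = (\<Sum>k<m. \<Lambda> k v))"
  proof
    fix w
    show "\<exists>\<Lambda>. w \<in> Z \<longrightarrow> (\<forall>k. hform k (\<Lambda> k)) \<and> (\<forall>v. L w v = (\<Sum>k<m. \<Lambda> k v))"
    proof (cases "w \<in> Z")
      case True
      then have "polyfn (m - 1) (L w)" using model by (simp add: nodal_model_def)
      from polyfn_decompose[OF this] show ?thesis unfolding below by blast
    qed simp
  qed
  from choice[OF this] obtain \<l> where "\<forall>w. w \<in> Z \<longrightarrow> (\<forall>k. hform k (\<l> w k)) \<and> (\<forall>v. L w v = (\<Sum>k<m. \<l> w k v))" by (rule exE)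
  then have \<l>: "\<And>w k. w \<in> Z \<Longrightarrow> hform k (\<l> w k)" "\<And>w v. w \<in> Z \<Longrightarrow> L w v = (\<Sum>k<m. \<l> w k v)" by blast+
  have "\<forall>k. \<exists>P. k < m \<longrightarrow> P \<in> forms {0..3} d \<and> (\<forall>l v. eval_at (pt l v) P = l ^ (d - k) * \<gamma> k v)"
    using hform_homogenize[OF \<gamma>(1)] assms(2) by (meson less_imp_le less_le_trans)
  from choice[OF this] obtain c\<gamma> where "\<forall>k. k < m \<longrightarrow> c\<gamma> k \<in> forms {0..3} d \<and> (\<forall>l v. eval_at (pt l v) (c\<gamma> k) = l ^ (d - k) * \<gamma> k v)"
    by (rule exE)
  then have c\<gamma>: "\<And>k. k < m \<Longrightarrow> c\<gamma> k \<in> forms {0..3} d" "\<And>k l v. k < m \<Longrightarrow> eval_at (pt l v) (c\<gamma> k) = l ^ (d - k) * \<gamma> k v" by blast+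
  have "\<forall>wk. \<exists>P. fst wk \<in> Z \<and> snd wk < m \<longrightarrow> P \<in> forms {0..3} d \<and> (\<forall>l v. eval_at (pt l v) P = l ^ (d - snd wk) * \<l> (fst wk) (snd wk) v)"
    using hform_homogenize[OF \<l>(1)] assms(2) by (meson less_imp_le less_le_trans)
  from choice[OF this] obtain c where "\<forall>wk. fst wk \<in> Z \<and> snd wk < m \<longrightarrow> c wk \<in> forms {0..3} d \<and> (\<forall>l v. eval_at (pt l v) (c wk) = l ^ (d - snd wk) * \<l> (fst wk) (snd wk) v)"
    by (rule exE)
  then have c\<l>: "\<And>w k. w \<in> Z \<Longrightarrow> k < m \<Longrightarrow> c (w, k) \<in> forms {0..3} d"
    "\<And>w k l v. w \<in> Z \<Longrightarrow> k < m \<Longrightarrow> eval_at (pt l v) (c (w, k)) = l ^ (d - k) * \<l> w k v" by force+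
  obtain G1 where G1: "G1 \<in> forms {0..3} d" "\<And>l v. eval_at (pt l v) G1 = l ^ (d - m) * lead v"
    using hform_homogenize[OF diag(1) assms(2)] by blast
  obtain G2 where G2: "G2 \<in> forms {0..3} d" "\<And>l v. eval_at (pt l v) G2 = l ^ (d - d) * h v"
    using hform_homogenize[OF h(1) order_refl] by blast
  obtain N where N: "\<And>v. fn F v = (\<Sum>k\<le>N. fn_part F k v)" "m \<le> N" using fn_decompose by blast
  have F_parts: "fn F v = (\<Sum>k=m..N. fn_part F k v)" for v
    unfolding N(1) by (rule sum.mono_neutral_right) (use low in \<open>auto simp: fn_part_def\<close>)
  interpret nodal_smoothing i a idx F d m N "fn_part F" Z \<gamma> \<l> lead h c\<gamma> "\<lambda>w k. c (w, k)" "G1 + G2"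
  proof
    show "(\<Sum>k<m. \<gamma> k v) + lead v = 0 \<and> grad (\<lambda>v. (\<Sum>k<m. \<gamma> k v) + lead v) v = 0 \<longleftrightarrow> v \<in> Z" for v
      using model unfolding nodal_model_def g by blast
    show "u = 0" if "z \<in> Z" "hess (\<lambda>v. (\<Sum>k<m. \<gamma> k v) + lead v) z u = 0" for z u
      using that model unfolding nodal_model_def g by blast
    show "(\<Sum>k<m. \<l> w k z) = of_bool (w = z)" if "w \<in> Z" "z \<in> Z" for w z
      using that model \<l>(2)[OF that(1), of z] by (simp add: nodal_model_def)
    show "finite Z" using model by (simp add: nodal_model_def)
    show "eval_at (pt l v) (G1 + G2) = l ^ (d - m) * lead v + h v" for l v
      by (simp add: eval_at_add G1 G2)
    show "G1 + G2 \<in> forms {0..3} d" by (intro forms_add G1 G2)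
  qed (use Ff assms(1,2) N(2) fn_part_hform[OF Ff(1)] F_parts diag(1,2) h G_smooth \<gamma>(1) \<l>(1) c\<gamma> c\<l> in blast)+
  have "\<delta> > 0" using assms(1,3) by (auto simp: dvd_def)
  then have Z: "Z \<noteq> {}" using card by auto
  have "X \<in> proj_space (monomials {0..3} d)"
    unfolding X hypersurface_def
  proof (rule proj_point_in_space)
    have sub: "Poly_Mapping.keys F \<subseteq> monomials {0..3} d" using Ff(1) by (simp add: forms_def)
    then show "\<forall>e. e \<notin> monomials {0..3} d \<longrightarrow> Poly_Mapping.lookup F e = 0" by (auto simp: in_keys_iff)
    from Ff(2) obtain e where "e \<in> Poly_Mapping.keys F" by (metis ex_in_conv keys_eq_empty)
    with sub show "\<exists>e\<in>monomials {0..3} d. Poly_Mapping.lookup F e \<noteq> 0" by (auto simp: in_keys_iff)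
  qed
  moreover have "eval_at b P = 0" if P: "P \<in> forms (monomials {0..3} d) k"
      "\<forall>y\<in>severi_variety 3 d \<delta>. \<forall>b\<in>y. eval_at b P = 0" and b: "b \<in> X" for k P b
  proof -
    obtain c' where "b = (\<lambda>e. c' * Poly_Mapping.lookup F e)" using b by (auto simp: X hypersurface_def proj_point_def)
    then have "eval_at b P = c' ^ k * eval_at (Poly_Mapping.lookup F) P" by (simp add: eval_at_scale[OF P(1)])
    also have "eval_at (Poly_Mapping.lookup F) P = 0"
      by (rule vanishes_at_F[OF Z]) (use P(2) card in auto)
    finally show ?thesis by simp
  qed
  ultimately show "X \<in> hypersurface_closure 3 d (severi_variety 3 d \<delta>)"
    unfolding hypersurface_closure_def proj_closure_def by blast
qed

end
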